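(* The $*$-algebra $L(Z_2)/S(Z_2)$, equipped with the quotient norm, is not $*$-isomorphic to a $C^*$-algebra.
   Context: The scalar field is either $\mathbb{R}$ or $\mathbb{C}$. The Kalton--Peck space $Z_2$ is the twisted sum $\ell_2\oplus_{\Omega}\ell_2$, where $\Omega=\Omega_2$ is the quasi-linear map given on finitely supported vectors by $\Omega(x)(n)=x(n)\log\frac{\|x\|_2}{|x(n)|}$ (with value $0$ where $x(n)=0$); i.e. $Z_2$ is the space of pairs $(x,y)$ of sequences with $y\in\ell_2$, $x-\Omega y\in\ell_2$, with quasi-norm $\|(x,y)\|=\|x-\Omega y\|_2+\|y\|_2$, which is equivalent to a Banach space norm. $L(Z_2)$ is the algebra of bounded linear operators on $Z_2$ and $S(Z_2)$ the closed ideal of strictly singular operators (operators whose restriction to any infinite dimensional closed subspace is not an isomorphism onto its range). The quotient norm is $\|T+S(Z_2)\|=\inf\{\|T-S\|:S\in S(Z_2)\}$. The form $\omega((x,y),(x',y'))=\langle x,y'\rangle-\langle y,x'\rangle$ (with the $\ell_2$ inner product, on finitely supported vectors, extended by continuity) is a symplectic form on $Z_2$, and the involution $*$ on $L(Z_2)$ is defined by $\omega(Tu,v)=\omega(u,T^*v)$; since $T$ is strictly singular iff $T^*$ is, it induces an involution on $L(Z_2)/S(Z_2)$. A $C^*$-algebra is (an isometric $*$-copy of) a norm-closed $*$-subalgebra of $L(K)$ for some Hilbert space $K$ over the same scalar field. A $*$-isomorphism of Banach $*$-algebras is a bijective algebra homomorphism preserving the involution which is a linear homeomorphism. *)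

theory Defs
  imports "HOL-Analysis.Analysis"
begin

section \<open>The scalar field\<close>

text \<open>
  A common class for the two scalar fields. That it contains nothing else is the
  lemma \<open>real_or_complex_cases\<close> below; \<open>scalar_cnj\<close> is the identity on the reals
  and complex conjugation on the complex numbers.
\<close>

class real_or_complex = real_normed_field +
  fixes scalar_cnj :: "'a \<Rightarrow> 'a"
  assumes scalar_cnj_add: "scalar_cnj (a + b) = scalar_cnj a + scalar_cnj b"
    and scalar_cnj_mult: "scalar_cnj (a * b) = scalar_cnj a * scalar_cnj b"
    and scalar_cnj_cnj: "scalar_cnj (scalar_cnj a) = a"
    and mult_scalar_cnj': "a * scalar_cnj a = (norm a)\<^sup>2 *\<^sub>R 1"
    and scalar_cnj_fixed': "scalar_cnj a = a \<longleftrightarrow> (\<exists>r. a = r *\<^sub>R 1)"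

lemma mult_scalar_cnj: "a * scalar_cnj a = of_real ((norm a)\<^sup>2)"
  by (simp add: mult_scalar_cnj' of_real_def)

lemma scalar_cnj_fixed: "scalar_cnj a = a \<longleftrightarrow> a \<in> \<real>"
  by (auto simp: scalar_cnj_fixed' of_real_def Reals_def)

instantiation real :: real_or_complex
begin

definition scalar_cnj_real :: "real \<Rightarrow> real" where "scalar_cnj_real a = a"

instance
  by standard (auto simp: scalar_cnj_real_def power2_eq_square)

end

instantiation complex :: real_or_complex
begin

definition scalar_cnj_complex :: "complex \<Rightarrow> complex" where "scalar_cnj_complex a = cnj a"

instance
proof
  fix a b :: complex
  show "scalar_cnj (a + b) = scalar_cnj a + scalar_cnj b"
    and "scalar_cnj (a * b) = scalar_cnj a * scalar_cnj b"
    and "scalar_cnj (scalar_cnj a) = a"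
    by (simp_all add: scalar_cnj_complex_def)
  show "a * scalar_cnj a = (norm a)\<^sup>2 *\<^sub>R 1"
    by (simp only: scalar_cnj_complex_def complex_norm_square[symmetric] scaleR_conv_of_real mult_1_right)
  have "scalar_cnj a = a \<longleftrightarrow> a \<in> \<real>"
    by (simp add: scalar_cnj_complex_def Reals_cnj_iff)
  then show "scalar_cnj a = a \<longleftrightarrow> (\<exists>r. a = r *\<^sub>R 1)"
    by (auto simp: Reals_def of_real_def)
qed

end

lemma real_or_complex_cases:
  "(\<forall>z :: 'k :: real_or_complex. \<exists>a. z = of_real a \<and> scalar_cnj z = z) \<or>
   (\<exists>i :: 'k. i * i = - 1 \<and>
      (\<forall>z. \<exists>a b. z = of_real a + i * of_real b \<and> scalar_cnj z = of_real a - i * of_real b))"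
proof (cases "\<forall>z :: 'k. z \<in> \<real>")
  case True
  then show ?thesis by (metis Reals_cases scalar_cnj_fixed)
next
  case False
  then obtain w :: 'k where w: "scalar_cnj w \<noteq> w"
    using scalar_cnj_fixed by blast
  have cnj_of_real: "scalar_cnj (of_real r :: 'k) = of_real r" for r
    by (simp add: scalar_cnj_fixed)
  have cnj_0: "scalar_cnj (0::'k) = 0"
    using cnj_of_real[of 0] by simp
  have cnj_minus: "scalar_cnj (- a) = - scalar_cnj a" for a :: 'k
    using scalar_cnj_add[of a "- a"] cnj_0 by (simp add: eq_neg_iff_add_eq_0 add.commute)
  have cnj_diff: "scalar_cnj (a - b) = scalar_cnj a - scalar_cnj b" for a b :: 'k
    using scalar_cnj_add[of a "- b"] by (simp add: cnj_minus)
  define d where "d = w - scalar_cnj w"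
  have d0: "d \<noteq> 0" using w by (simp add: d_def)
  have cd: "scalar_cnj d = - d"
    by (simp add: d_def cnj_diff scalar_cnj_cnj)
  define i where "i = d * of_real (1 / norm d)"
  have ci: "scalar_cnj i = - i"
    unfolding i_def scalar_cnj_mult cnj_of_real cd by simp
  have "norm i = 1" using d0 by (simp add: i_def norm_mult norm_divide)
  then have ii: "i * i = - 1"
    using mult_scalar_cnj[of i] by (simp add: ci minus_equation_iff)
  have ii': "i * (i * x) = - x" for x
    using ii by (metis mult.assoc mult_minus1)
  have "\<exists>a b. z = of_real a + i * of_real b \<and> scalar_cnj z = of_real a - i * of_real b" for z
  proof -
    have "scalar_cnj (z + scalar_cnj z) = z + scalar_cnj z"
      by (simp add: scalar_cnj_add scalar_cnj_cnj add.commute)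
    then obtain a where a: "z + scalar_cnj z = of_real a"
      using scalar_cnj_fixed Reals_cases by metis
    have "scalar_cnj (- (i * (z - scalar_cnj z))) = - (i * (z - scalar_cnj z))"
      by (simp add: cnj_minus cnj_diff scalar_cnj_mult ci scalar_cnj_cnj right_diff_distrib)
    then obtain b where b: "- (i * (z - scalar_cnj z)) = of_real b"
      using scalar_cnj_fixed Reals_cases by metis
    have b': "z - scalar_cnj z = i * of_real b"
      unfolding b[symmetric] by (simp add: ii')
    have "z * 2 = (z + scalar_cnj z) + (z - scalar_cnj z)"
      and "scalar_cnj z * 2 = (z + scalar_cnj z) - (z - scalar_cnj z)"
      by simp_all
    then have "z = of_real (a / 2) + i * of_real (b / 2)"
      and "scalar_cnj z = of_real (a / 2) - i * of_real (b / 2)"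
      unfolding a b' by (simp_all add: field_simps)
    then show ?thesis by blast
  qed
  with ii show ?thesis by blast
qed

section \<open>Operators on (quasi-)normed spaces\<close>

text \<open>
  The topology induced by a quasi-metric \<open>d\<close> on \<open>S\<close>; the triangle inequality up to a
  constant suffices for the balls to be neighbourhoods of their centres.
\<close>

definition gauge_topology :: "'a set \<Rightarrow> ('a \<Rightarrow> 'a \<Rightarrow> real) \<Rightarrow> 'a topology" where
  "gauge_topology S d =
     topology (\<lambda>U. U \<subseteq> S \<and> (\<forall>x\<in>U. \<exists>e>0. \<forall>y\<in>S. d x y < e \<longrightarrow> y \<in> U))"

lemma openin_gauge_topology:
  "openin (gauge_topology S d) U \<longleftrightarrow> U \<subseteq> S \<and> (\<forall>x\<in>U. \<exists>e>0. \<forall>y\<in>S. d x y < e \<longrightarrow> y \<in> U)"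
proof -
  have "istopology (\<lambda>U. U \<subseteq> S \<and> (\<forall>x\<in>U. \<exists>e>0. \<forall>y\<in>S. d x y < e \<longrightarrow> y \<in> U))"
    unfolding istopology_def
  proof (intro conjI allI impI)
    fix U V
    assume U: "U \<subseteq> S \<and> (\<forall>x\<in>U. \<exists>e>0. \<forall>y\<in>S. d x y < e \<longrightarrow> y \<in> U)"
      and V: "V \<subseteq> S \<and> (\<forall>x\<in>V. \<exists>e>0. \<forall>y\<in>S. d x y < e \<longrightarrow> y \<in> V)"
    show "U \<inter> V \<subseteq> S" using U by blast
    show "\<forall>x\<in>U \<inter> V. \<exists>e>0. \<forall>y\<in>S. d x y < e \<longrightarrow> y \<in> U \<inter> V"
    proof
      fix x assume "x \<in> U \<inter> V"
      then obtain e f where "e > 0" "f > 0"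
        and "\<forall>y\<in>S. d x y < e \<longrightarrow> y \<in> U" "\<forall>y\<in>S. d x y < f \<longrightarrow> y \<in> V"
        using U V by blast
      then show "\<exists>e>0. \<forall>y\<in>S. d x y < e \<longrightarrow> y \<in> U \<inter> V"
        by (intro exI[of _ "min e f"]) auto
    qed
  next
    fix K
    assume K: "\<forall>U\<in>K. U \<subseteq> S \<and> (\<forall>x\<in>U. \<exists>e>0. \<forall>y\<in>S. d x y < e \<longrightarrow> y \<in> U)"
    show "\<Union>K \<subseteq> S" using K by blast
    show "\<forall>x\<in>\<Union>K. \<exists>e>0. \<forall>y\<in>S. d x y < e \<longrightarrow> y \<in> \<Union>K"
    proof
      fix x assume "x \<in> \<Union>K"
      then obtain U where "U \<in> K" "x \<in> U" by blast
      then obtain e where "e > 0" "\<forall>y\<in>S. d x y < e \<longrightarrow> y \<in> U" using K by blast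
      with \<open>U \<in> K\<close> show "\<exists>e>0. \<forall>y\<in>S. d x y < e \<longrightarrow> y \<in> \<Union>K" by blast
    qed
  qed
  then show ?thesis
    by (simp add: gauge_topology_def)
qed

lemma topspace_gauge_topology: "topspace (gauge_topology S d) = S"
proof -
  have "openin (gauge_topology S d) S"
    unfolding openin_gauge_topology by (auto intro: exI[of _ 1])
  then show ?thesis
    by (metis openin_subset openin_topspace openin_gauge_topology subset_antisym)
qed

abbreviation norm_topology :: "('a \<Rightarrow> real) \<Rightarrow> 'a::ab_group_add topology" where
  "norm_topology N \<equiv> gauge_topology UNIV (\<lambda>x y. N (y - x))"

definition bounded_ops ::
    "('k::field \<Rightarrow> 'v::ab_group_add \<Rightarrow> 'v) \<Rightarrow> ('v \<Rightarrow> real) \<Rightarrow> ('v \<Rightarrow> 'v) set" where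
  "bounded_ops s N = {T. Vector_Spaces.linear s s T \<and> (\<exists>C. \<forall>u. N (T u) \<le> C * N u)}"

definition op_norm :: "('v \<Rightarrow> real) \<Rightarrow> ('v \<Rightarrow> 'v) \<Rightarrow> real" where
  "op_norm N T = (SUP u\<in>{u. N u \<le> 1}. N (T u))"

definition strictly_singular_ops ::
    "('k::field \<Rightarrow> 'v::ab_group_add \<Rightarrow> 'v) \<Rightarrow> ('v \<Rightarrow> real) \<Rightarrow> ('v \<Rightarrow> 'v) set" where
  "strictly_singular_ops s N =
     {T \<in> bounded_ops s N.
        \<forall>M. module.subspace s M \<longrightarrow> closedin (norm_topology N) M \<longrightarrow>
            (\<nexists>B. finite B \<and> module.span s B = M) \<longrightarrow>
            \<not> homeomorphic_map (subtopology (norm_topology N) M)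
                 (subtopology (norm_topology N) (T ` M)) T}"

definition form_adjoint ::
    "('k::field \<Rightarrow> 'v::ab_group_add \<Rightarrow> 'v) \<Rightarrow> ('v \<Rightarrow> real) \<Rightarrow> ('v \<Rightarrow> 'v \<Rightarrow> 'k) \<Rightarrow>
     ('v \<Rightarrow> 'v) \<Rightarrow> ('v \<Rightarrow> 'v)" where
  "form_adjoint s N \<beta> T = (THE R. R \<in> bounded_ops s N \<and> (\<forall>u v. \<beta> (T u) v = \<beta> u (R v)))"

section \<open>Normed star-algebras\<close>

record ('k, 'a) star_algebra =
  carrier :: "'a set"
  add :: "'a \<Rightarrow> 'a \<Rightarrow> 'a"
  mult :: "'a \<Rightarrow> 'a \<Rightarrow> 'a"
  smult :: "'k \<Rightarrow> 'a \<Rightarrow> 'a"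
  star :: "'a \<Rightarrow> 'a"
  nrm :: "'a \<Rightarrow> real"

definition algebra_topology :: "('k::field, 'a) star_algebra \<Rightarrow> 'a topology" where
  "algebra_topology A =
     gauge_topology (carrier A) (\<lambda>x y. nrm A (add A y (smult A (- 1) x)))"

text \<open>
  The algebra of bounded operators, with the involution given by adjoints with respect to
  the form \<open>\<beta>\<close>.
\<close>

definition op_algebra ::
    "('k::field \<Rightarrow> 'v::ab_group_add \<Rightarrow> 'v) \<Rightarrow> ('v \<Rightarrow> real) \<Rightarrow> ('v \<Rightarrow> 'v \<Rightarrow> 'k) \<Rightarrow>
     ('k, 'v \<Rightarrow> 'v) star_algebra" where
  "op_algebra s N \<beta> =
     \<lparr>carrier = bounded_ops s N,
      add = (\<lambda>T R u. T u + R u),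
      mult = (\<lambda>T R. T \<circ> R),
      smult = (\<lambda>c T u. s c (T u)),
      star = form_adjoint s N \<beta>,
      nrm = op_norm N\<rparr>"

definition alg_coset :: "('k, 'a) star_algebra \<Rightarrow> 'a set \<Rightarrow> 'a \<Rightarrow> 'a set" where
  "alg_coset A I x = add A x ` I"

text \<open>
  The operations are computed on representatives (for a star-invariant two-sided ideal \<open>I\<close> the
  unions below are unions of equal cosets). As \<open>I = - I\<close>, the quotient norm
  \<open>Inf {nrm (x - s) | s. s \<in> I}\<close> is the infimum of the norm over the coset of \<open>x\<close>.
\<close>

definition quotient_algebra ::
    "('k, 'a) star_algebra \<Rightarrow> 'a set \<Rightarrow> ('k, 'a set) star_algebra" where
  "quotient_algebra A I =
     \<lparr>carrier = alg_coset A I ` carrier A,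
      add = (\<lambda>X Y. \<Union>x\<in>X. \<Union>y\<in>Y. alg_coset A I (add A x y)),
      mult = (\<lambda>X Y. \<Union>x\<in>X. \<Union>y\<in>Y. alg_coset A I (mult A x y)),
      smult = (\<lambda>c X. \<Union>x\<in>X. alg_coset A I (smult A c x)),
      star = (\<lambda>X. \<Union>x\<in>X. alg_coset A I (star A x)),
      nrm = (\<lambda>X. INF x\<in>X. nrm A x)\<rparr>"

definition star_isomorphism ::
    "('k::field, 'a) star_algebra \<Rightarrow> ('k, 'b) star_algebra \<Rightarrow> ('a \<Rightarrow> 'b) \<Rightarrow> bool" where
  "star_isomorphism A B \<phi> \<longleftrightarrow>
     bij_betw \<phi> (carrier A) (carrier B) \<and>
     (\<forall>x\<in>carrier A. \<forall>y\<in>carrier A. \<phi> (add A x y) = add B (\<phi> x) (\<phi> y)) \<and>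
     (\<forall>x\<in>carrier A. \<forall>y\<in>carrier A. \<phi> (mult A x y) = mult B (\<phi> x) (\<phi> y)) \<and>
     (\<forall>c. \<forall>x\<in>carrier A. \<phi> (smult A c x) = smult B c (\<phi> x)) \<and>
     (\<forall>x\<in>carrier A. \<phi> (star A x) = star B (\<phi> x)) \<and>
     homeomorphic_map (algebra_topology A) (algebra_topology B) \<phi>"

definition star_isomorphic ::
    "('k::field, 'a) star_algebra \<Rightarrow> ('k, 'b) star_algebra \<Rightarrow> bool" where
  "star_isomorphic A B \<longleftrightarrow> (\<exists>\<phi>. star_isomorphism A B \<phi>)"

definition closed_star_subalgebra :: "('k::field, 'a) star_algebra \<Rightarrow> 'a set \<Rightarrow> bool" where
  "closed_star_subalgebra L A \<longleftrightarrow>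
     A \<noteq> {} \<and> A \<subseteq> carrier L \<and>
     (\<forall>x\<in>A. \<forall>y\<in>A. add L x y \<in> A) \<and>
     (\<forall>x\<in>A. \<forall>y\<in>A. mult L x y \<in> A) \<and>
     (\<forall>c. \<forall>x\<in>A. smult L c x \<in> A) \<and>
     (\<forall>x\<in>A. star L x \<in> A) \<and>
     closedin (algebra_topology L) A"

section \<open>Hilbert spaces and C*-algebras\<close>

definition ip_norm :: "('h \<Rightarrow> 'h \<Rightarrow> 'k::real_normed_field) \<Rightarrow> 'h \<Rightarrow> real" where
  "ip_norm ip x = sqrt (norm (ip x x))"

locale hilbert_space = vector_space s
  for s :: "'k::real_or_complex \<Rightarrow> 'h::ab_group_add \<Rightarrow> 'h" +
  fixes ip :: "'h \<Rightarrow> 'h \<Rightarrow> 'k"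
  assumes ip_add_left: "ip (x + y) z = ip x z + ip y z"
    and ip_scale_left: "ip (s c x) y = c * ip x y"
    and ip_cnj: "ip y x = scalar_cnj (ip x y)"
    and ip_pos: "x \<noteq> 0 \<Longrightarrow> \<exists>r>0. ip x x = of_real r"
    and complete:
      "(\<And>e. e > 0 \<Longrightarrow> \<exists>M. \<forall>m\<ge>M. \<forall>n\<ge>M. ip_norm ip (X m - X n) < e) \<Longrightarrow>
       \<exists>l. (\<lambda>n::nat. ip_norm ip (X n - l)) \<longlonglongrightarrow> 0"

text \<open>
  \<open>A\<close> is a norm-closed star-subalgebra of the operators on the Hilbert space \<open>(s, ip)\<close>, with
  the restricted operations and the operator norm.
\<close>

definition cstar_algebra_on ::
    "('k::real_or_complex \<Rightarrow> 'h::ab_group_add \<Rightarrow> 'h) \<Rightarrow> ('h \<Rightarrow> 'h \<Rightarrow> 'k) \<Rightarrow>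
     ('k, 'h \<Rightarrow> 'h) star_algebra \<Rightarrow> bool" where
  "cstar_algebra_on s ip A \<longleftrightarrow>
     hilbert_space s ip \<and>
     (\<exists>C. closed_star_subalgebra (op_algebra s (ip_norm ip) ip) C \<and>
          A = op_algebra s (ip_norm ip) ip \<lparr>carrier := C\<rparr>)"

section \<open>The Kalton--Peck space\<close>

definition l2 :: "(nat \<Rightarrow> 'k::real_normed_field) \<Rightarrow> bool" where
  "l2 x \<longleftrightarrow> summable (\<lambda>n. (norm (x n))\<^sup>2)"

definition l2_norm :: "(nat \<Rightarrow> 'k::real_normed_field) \<Rightarrow> real" where
  "l2_norm x = sqrt (\<Sum>n. (norm (x n))\<^sup>2)"

definition l2_inner :: "(nat \<Rightarrow> 'k::real_or_complex) \<Rightarrow> (nat \<Rightarrow> 'k) \<Rightarrow> 'k" where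
  "l2_inner x y = (\<Sum>n. x n * scalar_cnj (y n))"

definition KP_map :: "(nat \<Rightarrow> 'k::real_normed_field) \<Rightarrow> nat \<Rightarrow> 'k" where
  "KP_map x n = (if x n = 0 then 0 else x n * of_real (ln (l2_norm x / norm (x n))))"

lemma l2_bound:
  assumes "l2 x" "\<And>n. norm (y n) \<le> C * norm (x n)"
  shows "l2 y"
  unfolding l2_def
proof (rule summable_comparison_test)
  have "norm ((norm (y n))\<^sup>2) \<le> C\<^sup>2 * (norm (x n))\<^sup>2" for n
    using power_mono[OF assms(2)[of n], of 2] by (simp add: power_mult_distrib)
  then show "\<exists>M. \<forall>n\<ge>M. norm ((norm (y n))\<^sup>2) \<le> C\<^sup>2 * (norm (x n))\<^sup>2"
    by blast
  show "summable (\<lambda>n. C\<^sup>2 * (norm (x n))\<^sup>2)"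
    using assms(1) by (simp add: l2_def summable_mult)
qed

lemma l2_add:
  assumes "l2 x" "l2 y"
  shows "l2 (\<lambda>n. x n + y n)"
  unfolding l2_def
proof (rule summable_comparison_test)
  have "norm ((norm (x n + y n))\<^sup>2) \<le> 2 * (norm (x n))\<^sup>2 + 2 * (norm (y n))\<^sup>2" for n
  proof -
    have "(norm (x n + y n))\<^sup>2 \<le> (norm (x n) + norm (y n))\<^sup>2"
      by (intro power_mono norm_triangle_ineq norm_ge_zero)
    also have "\<dots> \<le> 2 * (norm (x n))\<^sup>2 + 2 * (norm (y n))\<^sup>2"
      using zero_le_power2[of "norm (x n) - norm (y n)"] by (simp add: power2_eq_square algebra_simps)
    finally show ?thesis by simp
  qed
  then show "\<exists>M. \<forall>n\<ge>M. norm ((norm (x n + y n))\<^sup>2) \<le> 2 * (norm (x n))\<^sup>2 + 2 * (norm (y n))\<^sup>2"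
    by blast
  show "summable (\<lambda>n. 2 * (norm (x n))\<^sup>2 + 2 * (norm (y n))\<^sup>2)"
    using assms unfolding l2_def by (intro summable_add summable_mult)
qed

lemma l2_scale: "l2 x \<Longrightarrow> l2 (\<lambda>n. c * x n)"
  by (rule l2_bound[where C = "norm c"]) (auto simp: norm_mult)

lemma l2_zero: "l2 (\<lambda>n. 0)"
  by (simp add: l2_def)

lemma l2_norm_scale:
  assumes "l2 x"
  shows "l2_norm (\<lambda>n. c * x n) = norm c * l2_norm x"
proof -
  have "(\<Sum>n. (norm c)\<^sup>2 * (norm (x n))\<^sup>2) = (norm c)\<^sup>2 * (\<Sum>n. (norm (x n))\<^sup>2)"
    using assms unfolding l2_def by (rule suminf_mult)
  then show ?thesis
    by (simp add: l2_norm_def norm_mult power_mult_distrib real_sqrt_mult)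
qed

lemma KP_map_scale: "l2 x \<Longrightarrow> KP_map (\<lambda>n. c * x n) n = c * KP_map x n"
  by (cases "c = 0") (auto simp: KP_map_def l2_norm_scale norm_mult)

lemma KP_map_zero: "KP_map (\<lambda>n. 0) n = 0"
  by (simp add: KP_map_def)

lemma abs_ln_diff_bound:
  fixes r s :: real
  assumes "0 \<le> r" "0 < s" "r \<le> 2 * s"
  shows "r * \<bar>ln r - ln s\<bar> \<le> 2 * s"
proof (cases "r = 0")
  case False
  with assms have r: "0 < r" by simp
  show ?thesis
  proof (cases "r \<le> s")
    case True
    have "ln (s / r) \<le> s / r - 1"
      using r assms by (intro ln_le_minus_one) simp
    then have "\<bar>ln r - ln s\<bar> \<le> s / r - 1"
      using r assms True by (simp add: ln_div)
    then have "r * \<bar>ln r - ln s\<bar> \<le> r * (s / r - 1)"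
      using r by (intro mult_left_mono) auto
    also have "\<dots> = s - r" using r by (simp add: field_simps)
    finally show ?thesis using r assms by simp
  next
    case False
    have "ln (r / s) \<le> r / s - 1"
      using r assms by (intro ln_le_minus_one) simp
    then have "\<bar>ln r - ln s\<bar> \<le> r / s - 1"
      using r assms False by (simp add: ln_div)
    also have "\<dots> \<le> 1" using assms by (simp add: field_simps)
    finally have "r * \<bar>ln r - ln s\<bar> \<le> r * 1"
      using r by (intro mult_left_mono) auto
    then show ?thesis using assms by simp
  qed
qed (use assms in simp)

lemma log_quasi_additive:
  fixes a b :: "'k::real_normed_field"
  defines "g \<equiv> (\<lambda>a::'k. a * of_real (ln (norm a)))"
  shows "norm (g (a + b) - g a - g b) \<le> 4 * (norm a + norm b)"
proof -
  have main: "norm (g (a + b) - g a - g b) \<le> 4 * (norm a + norm b)"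
    if "norm b \<le> norm a" for a b
  proof (cases "a = 0")
    case False
    let ?s = "norm a"
    have s: "0 < ?s" using False by simp
    have "g (a + b) - g a - g b =
        (a + b) * of_real (ln (norm (a + b)) - ln ?s) - b * of_real (ln (norm b) - ln ?s)"
      by (simp add: g_def algebra_simps)
    also have "norm \<dots> \<le> norm (a + b) * \<bar>ln (norm (a + b)) - ln ?s\<bar> + norm b * \<bar>ln (norm b) - ln ?s\<bar>"
      by (rule order_trans[OF norm_triangle_ineq4]) (simp only: norm_mult norm_of_real order_refl)
    also have "\<dots> \<le> 2 * ?s + 2 * ?s"
    proof (intro add_mono abs_ln_diff_bound)
      show "norm (a + b) \<le> 2 * ?s" "norm b \<le> 2 * ?s"
        using s that norm_triangle_ineq[of a b] by linarith+
    qed (use s in simp_all)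
    also have "\<dots> \<le> 4 * (norm a + norm b)" by simp
    finally show ?thesis .
  qed (use that in \<open>simp add: g_def\<close>)
  show ?thesis
  proof (cases "norm b \<le> norm a")
    case False
    then have "norm (g (b + a) - g b - g a) \<le> 4 * (norm b + norm a)"
      by (intro main) simp
    then show ?thesis by (simp add: algebra_simps)
  qed (rule main)
qed

lemma l2_norm_pos: "l2 x \<Longrightarrow> x n \<noteq> 0 \<Longrightarrow> 0 < l2_norm x"
  unfolding l2_def l2_norm_def by (auto intro!: suminf_pos2[where i = n])

lemma KP_map_eq:
  assumes "l2 x"
  shows "KP_map x n = x n * of_real (ln (l2_norm x)) - x n * of_real (ln (norm (x n)))"
proof (cases "x n = 0")
  case False
  then have "ln (l2_norm x / norm (x n)) = ln (l2_norm x) - ln (norm (x n))"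
    using l2_norm_pos[OF assms False] by (intro ln_divide_pos) auto
  then show ?thesis
    using False by (simp add: KP_map_def right_diff_distrib)
qed (simp add: KP_map_def)

lemma norm_diff4:
  fixes a :: "'a::real_normed_vector"
  shows "norm (a - b - c - d) \<le> norm a + norm b + norm c + norm d"
  using norm_triangle_ineq4[of "a - b - c" d] norm_triangle_ineq4[of "a - b" c]
    norm_triangle_ineq4[of a b] by linarith

lemma KP_map_quasi_linear:
  assumes x: "l2 x" and y: "l2 y"
  shows "l2 (\<lambda>n. KP_map (\<lambda>n. x n + y n) n - KP_map x n - KP_map y n)"
proof -
  let ?z = "\<lambda>n. x n + y n"
  let ?C = "4 + \<bar>ln (l2_norm ?z)\<bar> + \<bar>ln (l2_norm x)\<bar> + \<bar>ln (l2_norm y)\<bar>"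
  define w where "w n = norm (x n) + norm (y n)" for n
  have "l2 w"
    using l2_add[of "\<lambda>n. norm (x n)" "\<lambda>n. norm (y n)"] x y
    by (simp add: l2_def w_def)
  moreover have "norm (KP_map ?z n - KP_map x n - KP_map y n) \<le> ?C * norm (w n)" for n
  proof -
    let ?g = "\<lambda>a::'a. a * of_real (ln (norm a))"
    have w: "norm (x n) \<le> w n" "norm (y n) \<le> w n" "norm (?z n) \<le> w n" "norm (w n) = w n"
      by (simp_all add: w_def norm_triangle_ineq)
    have g: "norm (?g (?z n) - ?g (x n) - ?g (y n)) \<le> 4 * w n"
      unfolding w_def by (rule log_quasi_additive)
    have le: "norm (a * of_real t) \<le> w n * \<bar>t\<bar>" if "norm a \<le> w n" for a :: 'a and t
      using that by (simp add: norm_mult mult_right_mono)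
    have eq: "KP_map ?z n - KP_map x n - KP_map y n =
        ?z n * of_real (ln (l2_norm ?z)) - x n * of_real (ln (l2_norm x))
        - y n * of_real (ln (l2_norm y)) - (?g (?z n) - ?g (x n) - ?g (y n))"
      by (simp only: KP_map_eq[OF x] KP_map_eq[OF y] KP_map_eq[OF l2_add[OF x y]]) simp
    have "norm (KP_map ?z n - KP_map x n - KP_map y n) \<le>
        w n * \<bar>ln (l2_norm ?z)\<bar> + w n * \<bar>ln (l2_norm x)\<bar> + w n * \<bar>ln (l2_norm y)\<bar> + 4 * w n"
      unfolding eq
      by (rule order_trans[OF norm_diff4 add_mono[OF add_mono[OF add_mono[OF le le] le] g]])
        (rule w)+
    then show ?thesis
      unfolding w(4) by (simp add: algebra_simps)
  qed
  ultimately have "l2 (\<lambda>n. of_real (w n) :: 'a)"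
    by (simp add: l2_def)
  then show ?thesis
    by (rule l2_bound[where C = ?C])
      (use \<open>\<And>n. norm (KP_map ?z n - KP_map x n - KP_map y n) \<le> ?C * norm (w n)\<close> in simp)
qed

typedef (overloaded) 'k kalton_peck =
  "{p :: (nat \<Rightarrow> 'k::real_or_complex) \<times> (nat \<Rightarrow> 'k).
     l2 (snd p) \<and> l2 (\<lambda>n. fst p n - KP_map (snd p) n)}"
  by (rule exI[of _ "(\<lambda>n. 0, \<lambda>n. 0)"]) (simp add: KP_map_zero l2_zero)

setup_lifting type_definition_kalton_peck

lift_definition kp_fst :: "'k::real_or_complex kalton_peck \<Rightarrow> nat \<Rightarrow> 'k" is fst .

lift_definition kp_snd :: "'k::real_or_complex kalton_peck \<Rightarrow> nat \<Rightarrow> 'k" is snd .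

lift_definition kp_scale :: "'k::real_or_complex \<Rightarrow> 'k kalton_peck \<Rightarrow> 'k kalton_peck" is
  "\<lambda>c p. (\<lambda>n. c * fst p n, \<lambda>n. c * snd p n)"
  subgoal for c p
  proof -
    assume p: "l2 (snd p) \<and> l2 (\<lambda>n. fst p n - KP_map (snd p) n)"
    then have "l2 (\<lambda>n. c * (fst p n - KP_map (snd p) n))"
      by (intro l2_scale) simp
    then have "l2 (\<lambda>n. c * fst p n - KP_map (\<lambda>n. c * snd p n) n)"
      using p by (simp only: KP_map_scale right_diff_distrib)
    moreover have "l2 (\<lambda>n. c * snd p n)"
      using p by (intro l2_scale) simp
    ultimately show ?thesis by simp
  qed
  done

instantiation kalton_peck :: (real_or_complex) ab_group_add
begin

lift_definition zero_kalton_peck :: "'a kalton_peck" is "(\<lambda>n. 0, \<lambda>n. 0)"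
  by (simp add: KP_map_zero l2_zero)

lift_definition plus_kalton_peck :: "'a kalton_peck \<Rightarrow> 'a kalton_peck \<Rightarrow> 'a kalton_peck" is
  "\<lambda>p q. (\<lambda>n. fst p n + fst q n, \<lambda>n. snd p n + snd q n)"
  subgoal for p q
  proof -
    assume p: "l2 (snd p) \<and> l2 (\<lambda>n. fst p n - KP_map (snd p) n)"
      and q: "l2 (snd q) \<and> l2 (\<lambda>n. fst q n - KP_map (snd q) n)"
    have "l2 (\<lambda>n. ((fst p n - KP_map (snd p) n) + (fst q n - KP_map (snd q) n))
        + (- 1) * (KP_map (\<lambda>n. snd p n + snd q n) n - KP_map (snd p) n - KP_map (snd q) n))"
      using p q by (intro l2_add l2_scale KP_map_quasi_linear) auto
    moreover have "((fst p n - KP_map (snd p) n) + (fst q n - KP_map (snd q) n))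
        + (- 1) * (KP_map (\<lambda>n. snd p n + snd q n) n - KP_map (snd p) n - KP_map (snd q) n)
        = fst p n + fst q n - KP_map (\<lambda>n. snd p n + snd q n) n" for n
      by simp
    ultimately have "l2 (\<lambda>n. fst p n + fst q n - KP_map (\<lambda>n. snd p n + snd q n) n)"
      by (simp only:)
    moreover have "l2 (\<lambda>n. snd p n + snd q n)"
      using p q by (intro l2_add) auto
    ultimately show ?thesis by simp
  qed
  done

definition uminus_kalton_peck :: "'a kalton_peck \<Rightarrow> 'a kalton_peck" where
  "uminus_kalton_peck u = kp_scale (- 1) u"

definition minus_kalton_peck :: "'a kalton_peck \<Rightarrow> 'a kalton_peck \<Rightarrow> 'a kalton_peck" where
  "minus_kalton_peck u v = u + kp_scale (- 1) v"

instance
proof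
  fix u v w :: "'a kalton_peck"
  show "u + v + w = u + (v + w)" by transfer (simp add: add.assoc)
  show "u + v = v + u" by transfer (simp add: add.commute)
  show "0 + u = u" by transfer simp
  show "- u + u = 0" unfolding uminus_kalton_peck_def by transfer simp
  show "u - v = u + - v" by (simp add: uminus_kalton_peck_def minus_kalton_peck_def)
qed

end

lemma vector_space_kp_scale: "vector_space kp_scale"
  by unfold_locales (transfer; simp add: distrib_left distrib_right mult.assoc)+

definition kp_qnorm :: "'k::real_or_complex kalton_peck \<Rightarrow> real" where
  "kp_qnorm u = l2_norm (\<lambda>n. kp_fst u n - KP_map (kp_snd u) n) + l2_norm (kp_snd u)"

text \<open>
  The homogeneous functionals equivalent to the quasi-norm: the quasi-norm itself as well as
  all Banach space norms defining the topology. The operator norm and hence the quotient norm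
  depend on this choice, the topology does not.
\<close>

definition equivalent_kp_qnorm :: "('k::real_or_complex kalton_peck \<Rightarrow> real) \<Rightarrow> bool" where
  "equivalent_kp_qnorm N \<longleftrightarrow>
     (\<forall>c u. N (kp_scale c u) = norm c * N u) \<and>
     (\<exists>a>0. \<exists>b>0. \<forall>u. a * kp_qnorm u \<le> N u \<and> N u \<le> b * kp_qnorm u)"

lemma equivalent_kp_qnorm_self: "equivalent_kp_qnorm kp_qnorm"
proof -
  have "kp_qnorm (kp_scale c u) = norm c * kp_qnorm u" for c and u :: "'a kalton_peck"
  proof -
    have "kp_fst (kp_scale c u) = (\<lambda>n. c * kp_fst u n)" "kp_snd (kp_scale c u) = (\<lambda>n. c * kp_snd u n)"
      and "l2 (kp_snd u)" "l2 (\<lambda>n. kp_fst u n - KP_map (kp_snd u) n)"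
      by (transfer, simp)+
    then show ?thesis
      by (simp add: kp_qnorm_def KP_map_scale l2_norm_scale distrib_left flip: right_diff_distrib)
  qed
  then show ?thesis
    unfolding equivalent_kp_qnorm_def by (auto intro!: exI[of _ 1])
qed

definition kp_finite_support :: "'k::real_or_complex kalton_peck \<Rightarrow> bool" where
  "kp_finite_support u \<longleftrightarrow> finite {n. kp_fst u n \<noteq> 0} \<and> finite {n. kp_snd u n \<noteq> 0}"

text \<open>
  The extension by continuity of the form on the finitely supported vectors; it is unique
  because these are dense. For complex scalars \<open>l2_inner\<close> is conjugate-linear in its second
  argument, so the form is sesquilinear and skew-Hermitian.
\<close>

definition kp_form :: "'k::real_or_complex kalton_peck \<Rightarrow> 'k kalton_peck \<Rightarrow> 'k" where
  "kp_form =
     (THE \<omega>. continuous_map (prod_topology (norm_topology kp_qnorm) (norm_topology kp_qnorm))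
               euclidean (\<lambda>(u, v). \<omega> u v) \<and>
             (\<forall>u v. kp_finite_support u \<longrightarrow> kp_finite_support v \<longrightarrow>
                \<omega> u v = l2_inner (kp_fst u) (kp_snd v) - l2_inner (kp_snd u) (kp_fst v)))"

text \<open>\<open>L(Z\<^sub>2)/S(Z\<^sub>2)\<close> with the quotient norm induced by \<open>N\<close>.\<close>

definition kp_quotient_algebra ::
    "('k::real_or_complex kalton_peck \<Rightarrow> real) \<Rightarrow>
     ('k, ('k kalton_peck \<Rightarrow> 'k kalton_peck) set) star_algebra" where
  "kp_quotient_algebra N =
     quotient_algebra (op_algebra kp_scale N kp_form) (strictly_singular_ops kp_scale N)"

end

theory Submission
  imports Defs
begin

text \<open>
  In a \<open>C\<^sup>*\<close>-algebra every element \<open>V\<close> with \<open>V\<^sup>* V = 1\<close> is a contraction, so it suffices to find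
  involutive symplectic operators \<open>T\<^sub>m\<close> on the Kalton--Peck space whose distances to the strictly
  singular operators are unbounded. Let \<open>U\<^sub>m\<close> be the direct sum of infinitely many copies of the
  symmetric orthogonal Hadamard matrix of size \<open>2\<^sup>m\<close>, and let \<open>T\<^sub>m\<close> act as \<open>U\<^sub>m\<close> on both components.
  The map \<open>\<Omega>\<close> vanishes on unit vectors and multiplies their images under \<open>U\<^sub>m\<close> by \<open>L = m ln 2 / 2\<close>.
  If \<open>T\<^sub>m + S\<close> has norm \<open>C\<close>, this determines the upper right corner of \<open>S\<close> up to \<open>O(C)\<close> on either of
  these two bases of a block, and comparing the two traces shows that \<open>L = O(C)\<close>.

  For the operations of the quotient algebra to be computed on representatives, the strictly singular
  operators have to be known to form a \<open>*\<close>-ideal. They are those operators which map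
  coordinatewise null bounded sequences of the kernel \<open>\<ell>\<^sub>2\<close> of the quotient map to norm null sequences.
\<close>

section \<open>Scalars\<close>

text \<open>The ideal of strictly singular operators is large: every bounded operator that factors
  through \<open>kp_quot\<close> followed by \<open>kp_incl\<close> vanishes on the kernel and
  belongs to it. Adding such an \<open>S\<close> can absorb the logarithmic term of
  \<open>\<Omega>\<close> on any single basis of a block, so a lower bound has to play two bases off
  against each other. The trace suits this, because it does not see the basis and the Hadamard
  matrix has the same entries in both. That matrix is flat, so that \<open>\<Omega>\<close> acts on
  its columns as one large scalar; it is real, symmetric and orthogonal, so that the operator is its
  own adjoint under the form and its own inverse. The isomorphism is only a homeomorphism, without
  any control of norms. The distances enter through its openness at 0: if all images of the
  \<open>T_m\<close> are contractions, then one fixed multiple of all of them lies in a given ball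
  around 0. The logarithm also governs the ideal: averages of N disjoint vectors whose quotients
  stay large have norm of order ln N, and this growth takes place in the kernel. An operator that is
  compact there cannot see it.\<close>

lemma scalar_cnj_of_real [simp]: "scalar_cnj (of_real r :: 'k::real_or_complex) = of_real r"
  by (simp add: scalar_cnj_fixed)

lemma scalar_cnj_0 [simp]: "scalar_cnj (0 :: 'k::real_or_complex) = 0"
  using scalar_cnj_of_real[of 0] by simp

lemma scalar_cnj_1 [simp]: "scalar_cnj (1 :: 'k::real_or_complex) = 1"
  using scalar_cnj_of_real[of 1] by simp

lemma scalar_cnj_minus: "scalar_cnj (- a) = - scalar_cnj (a :: 'k::real_or_complex)"
  using scalar_cnj_add[of a "- a"] by (simp add: eq_neg_iff_add_eq_0 add.commute)

lemma scalar_cnj_diff: "scalar_cnj (a - b) = scalar_cnj a - scalar_cnj (b :: 'k::real_or_complex)"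
  using scalar_cnj_add[of a "- b"] by (simp add: scalar_cnj_minus)

lemma norm_scalar_cnj [simp]: "norm (scalar_cnj a) = norm (a :: 'k::real_or_complex)"
proof (cases "a = 0")
  case False
  have "norm (a * scalar_cnj a) = (norm a)\<^sup>2"
    unfolding mult_scalar_cnj norm_of_real by simp
  with False show ?thesis
    by (simp add: norm_mult power2_eq_square)
qed simp

lemma scalar_cnj_eq_0_iff [simp]: "scalar_cnj a = 0 \<longleftrightarrow> (a :: 'k::real_or_complex) = 0"
  by (metis norm_eq_zero norm_scalar_cnj)

lemma scalar_cnj_mult_self: "scalar_cnj a * a = of_real ((norm (a :: 'k::real_or_complex))\<^sup>2)"
  by (metis mult.commute mult_scalar_cnj)

lemma scalar_cnj_scaleR: "scalar_cnj (r *\<^sub>R a) = r *\<^sub>R scalar_cnj (a :: 'k::real_or_complex)"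
  by (simp add: scaleR_conv_of_real scalar_cnj_mult)

lemma bounded_linear_scalar_cnj: "bounded_linear (scalar_cnj :: 'k::real_or_complex \<Rightarrow> 'k)"
  by (rule bounded_linear_intro[where K = 1]) (simp_all add: scalar_cnj_add scalar_cnj_scaleR)

lemma scalar_cnj_sum: "scalar_cnj (\<Sum>i\<in>I. f i) = (\<Sum>i\<in>I. scalar_cnj (f i :: 'k::real_or_complex))"
  by (induction I rule: infinite_finite_induct) (simp_all add: scalar_cnj_add)

lemma of_real_Re_part:
  "\<exists>r. (z + scalar_cnj z) / 2 = of_real r" for z :: "'k::real_or_complex"
proof -
  have "scalar_cnj (z + scalar_cnj z) = z + scalar_cnj z"
    by (simp add: scalar_cnj_add scalar_cnj_cnj add.commute)
  then obtain r where "z + scalar_cnj z = of_real r"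
    using scalar_cnj_fixed Reals_cases by metis
  then have "(z + scalar_cnj z) / 2 = of_real (r / 2)" by simp
  then show ?thesis by blast
qed

text \<open>The real part over both fields; over the reals it is the identity.\<close>

definition scalar_Re :: "'k::real_or_complex \<Rightarrow> real" where
  "scalar_Re z = (SOME r. (z + scalar_cnj z) / 2 = of_real r)"

lemma of_real_scalar_Re: "of_real (scalar_Re z) = (z + scalar_cnj z :: 'k::real_or_complex) / 2"
  unfolding scalar_Re_def using someI_ex[OF of_real_Re_part[of z]] by simp

lemma bounded_linear_scalar_Re: "bounded_linear (scalar_Re :: 'k::real_or_complex \<Rightarrow> real)"
proof (rule bounded_linear_intro[where K = 1])
  fix x y :: 'k and r
  have "(of_real (scalar_Re (x + y)) :: 'k) = of_real (scalar_Re x + scalar_Re y)"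
    by (simp add: of_real_scalar_Re scalar_cnj_add field_simps)
  then show "scalar_Re (x + y) = scalar_Re x + scalar_Re y" by (simp only: of_real_eq_iff)
  have "(of_real (scalar_Re (r *\<^sub>R x)) :: 'k) = of_real (r * scalar_Re x)"
    by (simp add: of_real_scalar_Re scalar_cnj_mult scaleR_conv_of_real field_simps)
  then show "scalar_Re (r *\<^sub>R x) = r *\<^sub>R scalar_Re x" by (simp only: of_real_eq_iff) simp
  have "\<bar>scalar_Re x\<bar> = norm (of_real (scalar_Re x) :: 'k)" by simp
  also have "\<dots> = norm (x + scalar_cnj x) / 2"
    unfolding of_real_scalar_Re by (simp add: norm_divide)
  also have "\<dots> \<le> norm x"
    using norm_triangle_ineq[of x "scalar_cnj x"] by simp
  finally show "norm (scalar_Re x) \<le> norm x * 1" by simp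
qed

text \<open>Completeness turns absolute convergence of scalar series into convergence, on which the
  inner product and the form rest. A scalar is recovered from two bounded real functionals, so it
  suffices that these converge along a Cauchy sequence.\<close>

instance real_or_complex \<subseteq> banach
proof
  fix X :: "nat \<Rightarrow> 'a"
  assume X: "Cauchy X"
  have "\<exists>i::'a. \<forall>z. z = of_real (scalar_Re z) + i * of_real (scalar_Re (- (i * z)))"
    using real_or_complex_cases[where 'k = 'a]
  proof
    assume "\<forall>z::'a. \<exists>a. z = of_real a \<and> scalar_cnj z = z"
    \<comment> \<open>Over the reals \<open>0\<close> takes the place of the imaginary unit.\<close>
    then have "(z::'a) = of_real (scalar_Re z) + 0 * of_real (scalar_Re (- (0 * z)))" for z
      by (simp add: of_real_scalar_Re)
    then show ?thesis by blast
  next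
    assume "\<exists>i :: 'a. i * i = - 1 \<and>
      (\<forall>z. \<exists>a b. z = of_real a + i * of_real b \<and> scalar_cnj z = of_real a - i * of_real b)"
    then obtain i :: 'a where i: "i * i = - 1"
      and r: "\<And>z. \<exists>a b. z = of_real a + i * of_real b \<and> scalar_cnj z = of_real a - i * of_real b"
      by blast
    have ii: "i * (i * x) = - x" for x
      using i by (metis mult.assoc mult_minus1)
    \<comment> \<open>Squaring \<open>a = i (1 - b)\<close> gives a vanishing sum of two real
      squares, so a = 0 and b = 1. This determines the conjugate of \<open>i\<close>.\<close>
    obtain a b where ab: "i = of_real a + i * of_real b" "scalar_cnj i = of_real a - i * of_real b"
      using r[of i] by blast
    have "of_real a = i * (1 - of_real b)"
      using ab(1) by (simp add: algebra_simps)
    then have "(of_real (a * a) :: 'a) = (i * (1 - of_real b)) * (i * (1 - of_real b))"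
      by simp
    also have "\<dots> = of_real (- ((1 - b) * (1 - b)))"
      using i by (simp add: ii algebra_simps)
    finally have "a * a = - ((1 - b) * (1 - b))" by (simp only: of_real_eq_iff)
    then have "a * a + (1 - b) * (1 - b) = 0" by simp
    then have "a = 0" "b = 1"
      by (simp_all add: sum_squares_eq_zero_iff)
    then have ci: "scalar_cnj i = - i" using ab(2) by simp
    have "z = of_real (scalar_Re z) + i * of_real (scalar_Re (- (i * z)))" for z
      by (simp add: of_real_scalar_Re scalar_cnj_minus scalar_cnj_mult ci ii field_simps)
    then show ?thesis by blast
  qed
  then obtain i :: 'a where i: "\<And>z::'a. z = of_real (scalar_Re z) + i * of_real (scalar_Re (- (i * z)))"
    by blast
  have b2: "bounded_linear (\<lambda>z::'a. scalar_Re (- (i * z)))"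
    by (intro bounded_linear_compose[OF bounded_linear_scalar_Re] bounded_linear_minus
        bounded_linear_mult_right)
  have "Cauchy (\<lambda>n. scalar_Re (X n))" "Cauchy (\<lambda>n. scalar_Re (- (i * X n)))"
    using bounded_linear.Cauchy[OF bounded_linear_scalar_Re X] bounded_linear.Cauchy[OF b2 X]
    by auto
  then obtain a b where "(\<lambda>n. scalar_Re (X n)) \<longlonglongrightarrow> a" "(\<lambda>n. scalar_Re (- (i * X n))) \<longlonglongrightarrow> b"
    by (meson Cauchy_convergent convergent_def)
  then have "(\<lambda>n. of_real (scalar_Re (X n)) + i * of_real (scalar_Re (- (i * X n)))) \<longlonglongrightarrow> of_real a + i * of_real b"
    by (intro tendsto_intros)
  then show "convergent X"
    by (metis (no_types, lifting) convergent_def i ext)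
qed

section \<open>The space of square summable sequences\<close>

lemma l2_sum_le: "l2 x \<Longrightarrow> L2_set (\<lambda>n. norm (x n)) {..<m} \<le> l2_norm x"
  unfolding L2_set_def l2_norm_def l2_def
  by (intro real_sqrt_le_mono sum_le_suminf) auto

lemma l2_norm_le:
  assumes "l2 x" "\<And>m. L2_set (\<lambda>n. norm (x n)) {..<m} \<le> C"
  shows "l2_norm x \<le> C"
proof -
  have C: "0 \<le> C" using assms(2)[of 0] by simp
  have "(\<Sum>n<m. (norm (x n))\<^sup>2) \<le> C\<^sup>2" for m
    using assms(2)[of m] C unfolding L2_set_def
    by (metis real_sqrt_le_iff real_sqrt_unique)
  then have "(\<Sum>n. (norm (x n))\<^sup>2) \<le> C\<^sup>2"
    using assms(1) unfolding l2_def by (intro suminf_le_const)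
  then show ?thesis
    unfolding l2_norm_def using C real_le_lsqrt by blast
qed

lemma l2_iff_bounded: "(\<And>m. L2_set (\<lambda>n. norm (x n)) {..<m} \<le> C) \<Longrightarrow> l2 x"
  unfolding l2_def
proof (rule summableI_nonneg_bounded[where x = "C\<^sup>2"])
  fix m assume *: "\<And>m. L2_set (\<lambda>n. norm (x n)) {..<m} \<le> C"
  have C: "0 \<le> C" using *[of 0] by simp
  then show "(\<Sum>n<m. (norm (x n))\<^sup>2) \<le> C\<^sup>2"
    using *[of m] unfolding L2_set_def by (metis real_sqrt_le_iff real_sqrt_unique)
qed simp

lemma l2_norm_nonneg: "l2 x \<Longrightarrow> 0 \<le> l2_norm x"
  unfolding l2_norm_def l2_def by (simp add: suminf_nonneg)

lemma l2_norm_triangle: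
  assumes "l2 x" "l2 y"
  shows "l2_norm (\<lambda>n. x n + y n) \<le> l2_norm x + l2_norm y"
proof (rule l2_norm_le[OF l2_add[OF assms]])
  fix m
  have "L2_set (\<lambda>n. norm (x n + y n)) {..<m} \<le> L2_set (\<lambda>n. norm (x n) + norm (y n)) {..<m}"
    by (intro L2_set_mono) (auto simp: norm_triangle_ineq)
  also have "\<dots> \<le> L2_set (\<lambda>n. norm (x n)) {..<m} + L2_set (\<lambda>n. norm (y n)) {..<m}"
    by (rule L2_set_triangle_ineq)
  also have "\<dots> \<le> l2_norm x + l2_norm y"
    using assms by (intro add_mono l2_sum_le)
  finally show "L2_set (\<lambda>n. norm (x n + y n)) {..<m} \<le> l2_norm x + l2_norm y" .
qed

lemma l2_norm_eq_0_iff: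
  assumes x: "l2 x"
  shows "l2_norm x = 0 \<longleftrightarrow> (\<forall>n. x n = 0)"
proof
  assume "l2_norm x = 0"
  then show "\<forall>n. x n = 0" using l2_norm_pos[OF x] by (metis less_irrefl)
next
  assume "\<forall>n. x n = 0"
  then show "l2_norm x = 0" by (simp add: l2_norm_def)
qed

lemma norm_le_l2_norm:
  assumes "l2 x"
  shows "norm (x n) \<le> l2_norm x"
proof -
  have "norm (x n) \<le> L2_set (\<lambda>n. norm (x n)) {..<Suc n}"
    by (rule member_le_L2_set) auto
  also have "\<dots> \<le> l2_norm x" by (rule l2_sum_le[OF assms])
  finally show ?thesis .
qed

lemma
  assumes x: "l2 x" and y: "l2 y"
  shows summable_l2_mult: "summable (\<lambda>n. norm (x n) * norm (y n))"
    and suminf_l2_mult_le: "(\<Sum>n. norm (x n) * norm (y n)) \<le> l2_norm x * l2_norm y"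
proof -
  have *: "(\<Sum>n<m. norm (x n) * norm (y n)) \<le> l2_norm x * l2_norm y" for m
  proof -
    have "(\<Sum>n<m. norm (x n) * norm (y n)) \<le> (\<Sum>n<m. \<bar>norm (x n)\<bar> * \<bar>norm (y n)\<bar>)" by simp
    also have "\<dots> \<le> L2_set (\<lambda>n. norm (x n)) {..<m} * L2_set (\<lambda>n. norm (y n)) {..<m}"
      by (rule L2_set_mult_ineq)
    also have "\<dots> \<le> l2_norm x * l2_norm y"
      using x y by (intro mult_mono l2_sum_le l2_norm_nonneg L2_set_nonneg)
    finally show ?thesis .
  qed
  show 1: "summable (\<lambda>n. norm (x n) * norm (y n))"
    by (rule summableI_nonneg_bounded[OF _ *]) simp
  show "(\<Sum>n. norm (x n) * norm (y n)) \<le> l2_norm x * l2_norm y"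
    by (rule suminf_le_const[OF 1 *])
qed

section \<open>The space l2 with its inner product\<close>

typedef (overloaded) 'k ell2 = "{x :: nat \<Rightarrow> 'k::real_or_complex. l2 x}"
  morphisms ell2_nth Abs_ell2
  by (rule exI[of _ "\<lambda>n. 0"]) (simp add: l2_zero)

setup_lifting type_definition_ell2

lemma l2_ell2_nth [simp]: "l2 (ell2_nth x)"
  using ell2_nth by simp

lemma ell2_eqI: "(\<And>n. ell2_nth x n = ell2_nth y n) \<Longrightarrow> x = y"
  by (metis ell2_nth_inject ext)

instantiation ell2 :: (real_or_complex) real_normed_vector
begin

lift_definition zero_ell2 :: "'a ell2" is "\<lambda>n. 0" by (rule l2_zero)
lift_definition plus_ell2 :: "'a ell2 \<Rightarrow> 'a ell2 \<Rightarrow> 'a ell2" is "\<lambda>x y n. x n + y n" by (rule l2_add)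
lift_definition uminus_ell2 :: "'a ell2 \<Rightarrow> 'a ell2" is "\<lambda>x n. - x n"
  by (auto intro: l2_bound[where C = 1])
definition minus_ell2 :: "'a ell2 \<Rightarrow> 'a ell2 \<Rightarrow> 'a ell2" where "x - y = x + - (y :: 'a ell2)"
lift_definition scaleR_ell2 :: "real \<Rightarrow> 'a ell2 \<Rightarrow> 'a ell2" is "\<lambda>r x n. of_real r * x n"
  by (rule l2_scale)
lift_definition norm_ell2 :: "'a ell2 \<Rightarrow> real" is l2_norm .
definition sgn_ell2 :: "'a ell2 \<Rightarrow> 'a ell2" where "sgn_ell2 x = inverse (norm x) *\<^sub>R x"
definition dist_ell2 :: "'a ell2 \<Rightarrow> 'a ell2 \<Rightarrow> real" where "dist_ell2 x y = norm (x - y)"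
definition uniformity_ell2 :: "('a ell2 \<times> 'a ell2) filter"
  where "uniformity_ell2 = (INF e\<in>{0 <..}. principal {(x, y). dist x y < e})"
definition open_ell2 :: "'a ell2 set \<Rightarrow> bool"
  where "open_ell2 U = (\<forall>x\<in>U. eventually (\<lambda>(x', y). x' = x \<longrightarrow> y \<in> U) uniformity)"

instance
proof
  fix x y z :: "'a ell2" and a b :: real
  show "x + y + z = x + (y + z)" by transfer (simp add: add.assoc)
  show "x + y = y + x" by transfer (simp add: add.commute)
  show "0 + x = x" by transfer simp
  show "- x + x = 0" by transfer simp
  show "x - y = x + - y" by (rule minus_ell2_def)
  show "a *\<^sub>R (x + y) = a *\<^sub>R x + a *\<^sub>R y" by transfer (simp add: algebra_simps)
  show "(a + b) *\<^sub>R x = a *\<^sub>R x + b *\<^sub>R x" by transfer (simp add: algebra_simps)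
  show "a *\<^sub>R b *\<^sub>R x = (a * b) *\<^sub>R x" by transfer (simp add: algebra_simps)
  show "1 *\<^sub>R x = x" by transfer simp
  show "dist x y = norm (x - y)" by (rule dist_ell2_def)
  show "sgn x = inverse (norm x) *\<^sub>R x" by (rule sgn_ell2_def)
  show "uniformity = (INF e\<in>{0 <..}. principal {(x, y :: 'a ell2). dist x y < e})"
    by (rule uniformity_ell2_def)
  show "open U = (\<forall>x\<in>U. eventually (\<lambda>(x', y). x' = x \<longrightarrow> y \<in> U) uniformity)" for U :: "'a ell2 set"
    by (rule open_ell2_def)
  show "norm x = 0 \<longleftrightarrow> x = 0" by transfer (auto simp: l2_norm_eq_0_iff)
  show "norm (x + y) \<le> norm x + norm y" by transfer (rule l2_norm_triangle)
  show "norm (a *\<^sub>R x) = \<bar>a\<bar> * norm x" by transfer (simp add: l2_norm_scale)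
qed

end

lift_definition ell2_scale :: "'k::real_or_complex \<Rightarrow> 'k ell2 \<Rightarrow> 'k ell2" is "\<lambda>c x n. c * x n"
  by (rule l2_scale)

lift_definition ell2_inner :: "'k::real_or_complex ell2 \<Rightarrow> 'k ell2 \<Rightarrow> 'k" is l2_inner .

lift_definition ell2_unit :: "nat \<Rightarrow> 'k::real_or_complex ell2" is "\<lambda>i n. if n = i then 1 else 0"
  unfolding l2_def by (rule summable_finite[of "{_}"]) auto

lemma ell2_nth_zero [simp]: "ell2_nth 0 n = 0" by transfer simp
lemma ell2_nth_add [simp]: "ell2_nth (x + y) n = ell2_nth x n + ell2_nth y n" by transfer simp
lemma ell2_nth_uminus [simp]: "ell2_nth (- x) n = - ell2_nth x n" by transfer simp
lemma ell2_nth_diff [simp]: "ell2_nth (x - y) n = ell2_nth x n - ell2_nth y n"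
  by (metis ell2_nth_add ell2_nth_uminus diff_conv_add_uminus)
lemma ell2_nth_scaleR [simp]: "ell2_nth (r *\<^sub>R x) n = of_real r * ell2_nth x n" by transfer simp
lemma ell2_nth_scale [simp]: "ell2_nth (ell2_scale c x) n = c * ell2_nth x n" by transfer simp
lemma ell2_nth_unit: "ell2_nth (ell2_unit i) n = (if n = i then 1 else 0)" by transfer simp
lemma ell2_nth_sum: "ell2_nth (\<Sum>i\<in>I. f i) n = (\<Sum>i\<in>I. ell2_nth (f i) n)"
  by (induction I rule: infinite_finite_induct) simp_all

lemma l2_norm_ell2_nth: "l2_norm (ell2_nth x) = norm x"
  by (rule norm_ell2.rep_eq[symmetric])

lemma norm_ell2_scale [simp]: "norm (ell2_scale c x) = norm c * norm x"
  by (simp add: norm_ell2.rep_eq ell2_scale.rep_eq l2_norm_scale)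

lemma norm_ell2_nth_le: "norm (ell2_nth x n) \<le> norm x"
  unfolding norm_ell2.rep_eq by (rule norm_le_l2_norm) simp

lemma norm_ell2_power2: "(norm x)\<^sup>2 = (\<Sum>n. (norm (ell2_nth x n))\<^sup>2)"
proof -
  have "0 \<le> (\<Sum>n. (norm (ell2_nth x n))\<^sup>2)"
    using l2_ell2_nth[of x] unfolding l2_def by (rule suminf_nonneg) simp
  then show ?thesis
    unfolding l2_norm_ell2_nth[symmetric] l2_norm_def by (rule real_sqrt_pow2)
qed

lemma summable_norm_ell2_mult:
  "summable (\<lambda>n. norm (ell2_nth x n * scalar_cnj (ell2_nth y n)))"
  using summable_l2_mult[OF l2_ell2_nth l2_ell2_nth] by (simp add: norm_mult)

lemma summable_ell2_mult: "summable (\<lambda>n. ell2_nth x n * scalar_cnj (ell2_nth y n))"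
  by (rule summable_norm_cancel[OF summable_norm_ell2_mult])

lemma ell2_inner_eq: "ell2_inner x y = (\<Sum>n. ell2_nth x n * scalar_cnj (ell2_nth y n))"
  by (simp add: ell2_inner.rep_eq l2_inner_def)

lemma norm_ell2_inner_le: "norm (ell2_inner x y) \<le> norm x * norm y"
proof -
  have "norm (ell2_inner x y) \<le> (\<Sum>n. norm (ell2_nth x n * scalar_cnj (ell2_nth y n)))"
    unfolding ell2_inner_eq by (rule summable_norm[OF summable_norm_ell2_mult])
  also have "\<dots> \<le> norm x * norm y"
    using suminf_l2_mult_le[OF l2_ell2_nth[of x] l2_ell2_nth[of y]]
    by (simp add: norm_mult l2_norm_ell2_nth)
  finally show ?thesis .
qed

lemma ell2_inner_add_left: "ell2_inner (x + y) z = ell2_inner x z + ell2_inner y z"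
  by (simp add: ell2_inner_eq suminf_add summable_ell2_mult algebra_simps)

lemma ell2_inner_scale_left: "ell2_inner (ell2_scale c x) z = c * ell2_inner x z"
  unfolding ell2_inner_eq suminf_mult[OF summable_ell2_mult, symmetric] by (simp add: mult.assoc)

lemma ell2_inner_commute: "ell2_inner y x = scalar_cnj (ell2_inner x y)"
  unfolding ell2_inner_eq bounded_linear.suminf[OF bounded_linear_scalar_cnj summable_ell2_mult]
  by (simp add: scalar_cnj_mult scalar_cnj_cnj mult.commute)

lemma ell2_inner_add_right: "ell2_inner x (y + z) = ell2_inner x y + ell2_inner x z"
  unfolding ell2_inner_commute[of x] by (simp add: ell2_inner_add_left scalar_cnj_add)

lemma ell2_inner_scale_right: "ell2_inner x (ell2_scale c y) = scalar_cnj c * ell2_inner x y"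
  unfolding ell2_inner_commute[of x] by (simp add: ell2_inner_scale_left scalar_cnj_mult)

lemma ell2_inner_zero_left [simp]: "ell2_inner 0 x = 0"
  using ell2_inner_add_left[of 0 0 x] by simp

lemma ell2_inner_zero_right [simp]: "ell2_inner x 0 = 0"
  using ell2_inner_add_right[of x 0 0] by simp

lemma ell2_inner_sum_left: "ell2_inner (\<Sum>i\<in>I. f i) y = (\<Sum>i\<in>I. ell2_inner (f i) y)"
  by (induction I rule: infinite_finite_induct) (simp_all add: ell2_inner_add_left)

lemma ell2_inner_sum_right: "ell2_inner x (\<Sum>i\<in>I. f i) = (\<Sum>i\<in>I. ell2_inner x (f i))"
  by (induction I rule: infinite_finite_induct) (simp_all add: ell2_inner_add_right)

lemma ell2_inner_self: "ell2_inner x x = of_real ((norm x)\<^sup>2)"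
proof -
  have s: "summable (\<lambda>n. (norm (ell2_nth x n))\<^sup>2)"
    using l2_ell2_nth[of x] by (simp add: l2_def)
  show ?thesis
    unfolding ell2_inner_eq norm_ell2_power2 mult_scalar_cnj
    by (rule suminf_of_real[OF s, symmetric])
qed

lemma ell2_inner_unit_left: "ell2_inner (ell2_unit i) x = scalar_cnj (ell2_nth x i)"
proof -
  have "ell2_inner (ell2_unit i) x = (\<Sum>n. if n = i then scalar_cnj (ell2_nth x n) else 0)"
    unfolding ell2_inner_eq ell2_nth_unit by (intro suminf_cong) auto
  also have "\<dots> = scalar_cnj (ell2_nth x i)"
    using sums_single[of i "\<lambda>n. scalar_cnj (ell2_nth x n)"] by (simp add: sums_iff eq_commute)
  finally show ?thesis .
qed

lemma norm_ell2_unit [simp]: "norm (ell2_unit i :: 'k::real_or_complex ell2) = 1"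
proof -
  have "(of_real ((norm (ell2_unit i :: 'k ell2))\<^sup>2) :: 'k) = of_real 1"
    unfolding ell2_inner_self[symmetric] ell2_inner_unit_left by (simp add: ell2_nth_unit)
  then have "(norm (ell2_unit i :: 'k ell2))\<^sup>2 = 1" by (simp only: of_real_eq_iff)
  then show ?thesis using norm_ge_zero[of "ell2_unit i :: 'k ell2"] by (auto simp: power2_eq_1_iff)
qed

definition ell2_trunc :: "nat \<Rightarrow> 'k::real_or_complex ell2 \<Rightarrow> 'k ell2" where
  "ell2_trunc m x = (\<Sum>i<m. ell2_scale (ell2_nth x i) (ell2_unit i))"

lemma ell2_nth_trunc: "ell2_nth (ell2_trunc m x) n = (if n < m then ell2_nth x n else 0)"
  by (simp add: ell2_trunc_def ell2_nth_sum ell2_nth_unit if_distrib cong: if_cong)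

lemma tendsto_ell2_trunc: "(\<lambda>m. ell2_trunc m x) \<longlonglongrightarrow> x"
proof -
  have s: "summable (\<lambda>n. (norm (ell2_nth x n))\<^sup>2)"
    using l2_ell2_nth[of x] by (simp add: l2_def)
  have "(norm (ell2_trunc m x - x))\<^sup>2 = (\<Sum>n. (norm (ell2_nth x (n + m)))\<^sup>2)" for m
  proof -
    have s': "summable (\<lambda>n. (norm (ell2_nth (ell2_trunc m x - x) n))\<^sup>2)"
      using l2_ell2_nth[of "ell2_trunc m x - x"] by (simp only: l2_def)
    show ?thesis
      unfolding norm_ell2_power2 suminf_split_initial_segment[OF s', of m]
      by (simp add: ell2_nth_trunc)
  qed
  moreover have "(\<lambda>m. \<Sum>n. (norm (ell2_nth x (n + m)))\<^sup>2) \<longlonglongrightarrow> 0"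
    by (rule suminf_exist_split2[OF s])
  ultimately have "(\<lambda>m. sqrt ((norm (ell2_trunc m x - x))\<^sup>2)) \<longlonglongrightarrow> sqrt 0"
    by (intro tendsto_real_sqrt) simp
  then show ?thesis
    by (simp add: LIM_zero_iff tendsto_norm_zero_iff)
qed

text \<open>The coordinates of the representing vector are forced to be the conjugates of the values
  at the unit vectors. Testing \<open>f\<close> on an initial segment of this very sequence bounds
  the segment by C, so the sequence is square summable; both functionals agree on truncations, which
  are dense.\<close>

lemma ell2_inner_rep:
  fixes f :: "'k::real_or_complex ell2 \<Rightarrow> 'k"
  assumes add: "\<And>x y. f (x + y) = f x + f y" and scale: "\<And>c x. f (ell2_scale c x) = c * f x"
    and bound: "\<And>x. norm (f x) \<le> C * norm x"
  shows "\<exists>w. \<forall>x. f x = ell2_inner x w"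
proof -
  define h where "h i = scalar_cnj (f (ell2_unit i))" for i
  have f0: "f 0 = 0" using add[of 0 0] by simp
  have fsum: "f (\<Sum>i\<in>I. g i) = (\<Sum>i\<in>I. f (g i))" for I and g :: "nat \<Rightarrow> _"
    by (induction I rule: infinite_finite_induct) (simp_all add: f0 add)
  have C: "0 \<le> C" using order_trans[OF norm_ge_zero bound, of "ell2_unit 0"] by simp
  have "L2_set (\<lambda>i. norm (h i)) {..<m} \<le> C" for m
  proof -
    let ?s = "L2_set (\<lambda>i. norm (h i)) {..<m}"
    let ?z = "\<Sum>i<m. ell2_scale (h i) (ell2_unit i)"
    have nth: "ell2_nth ?z n = (if n < m then h n else 0)" for n
      by (simp add: ell2_nth_sum ell2_nth_unit if_distrib cong: if_cong)
    have "(norm ?z)\<^sup>2 = (\<Sum>n. if n < m then (norm (h n))\<^sup>2 else 0)"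
      unfolding norm_ell2_power2 nth by (intro suminf_cong) auto
    also have "\<dots> = (\<Sum>n<m. (norm (h n))\<^sup>2)"
      by (subst suminf_finite[of "{..<m}"]) auto
    also have "\<dots> = ?s\<^sup>2" by (simp add: L2_set_def sum_nonneg)
    finally have nz: "norm ?z = ?s" by (simp add: L2_set_nonneg)
    have "f ?z = (\<Sum>i<m. h i * f (ell2_unit i))" by (simp add: fsum scale)
    also have "\<dots> = of_real (\<Sum>i<m. (norm (h i))\<^sup>2)"
      unfolding h_def scalar_cnj_mult_self by simp
    also have "\<dots> = of_real (?s\<^sup>2)" by (simp add: L2_set_def sum_nonneg)
    finally have "?s\<^sup>2 \<le> C * ?s" using bound[of ?z] nz by (simp add: norm_power)
    then show ?thesis
      using C L2_set_nonneg[of "\<lambda>i. norm (h i)" "{..<m}"]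
      by (cases "?s = 0") (auto simp: power2_eq_square)
  qed
  then have "l2 h" by (rule l2_iff_bounded)
  then have hw: "ell2_nth (Abs_ell2 h) = h" by (simp add: Abs_ell2_inverse)
  define w where "w = Abs_ell2 h"
  have "f x = ell2_inner x w" for x
  proof -
    have t: "f (ell2_trunc m x) = ell2_inner (ell2_trunc m x) w" for m
      by (simp add: ell2_trunc_def fsum scale ell2_inner_sum_left ell2_inner_scale_left
          ell2_inner_unit_left w_def hw h_def scalar_cnj_cnj)
    let ?g = "\<lambda>x. f x - ell2_inner x w"
    have "norm (?g x) \<le> (C + norm w) * norm (x - ell2_trunc m x)" for m
    proof -
      have "?g x = ?g ((x - ell2_trunc m x) + ell2_trunc m x)" by simp
      also have "\<dots> = ?g (x - ell2_trunc m x)"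
        unfolding add ell2_inner_add_left t by simp
      finally have "norm (?g x) \<le> norm (f (x - ell2_trunc m x)) + norm (ell2_inner (x - ell2_trunc m x) w)"
        by (metis norm_triangle_ineq4)
      also have "\<dots> \<le> C * norm (x - ell2_trunc m x) + norm (x - ell2_trunc m x) * norm w"
        by (intro add_mono bound norm_ell2_inner_le)
      finally show ?thesis by (simp add: algebra_simps)
    qed
    moreover have "(\<lambda>m. (C + norm w) * norm (x - ell2_trunc m x)) \<longlonglongrightarrow> (C + norm w) * norm (x - x)"
      by (intro tendsto_intros tendsto_ell2_trunc)
    ultimately have "norm (?g x) \<le> (C + norm w) * norm (x - x)"
      by (intro LIMSEQ_le_const) auto
    then show ?thesis by simp
  qed
  then show ?thesis by blast
qed

section \<open>The Kalton--Peck space as a normed space\<close>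

text \<open>The short exact sequence with l2 as kernel and as quotient: \<open>kp_incl\<close> and
  \<open>kp_quot\<close> are linear, whereas \<open>kp_defect\<close> and \<open>kp_section\<close>,
  which split it, are merely homogeneous.\<close>

lift_definition kp_quot :: "'k::real_or_complex kalton_peck \<Rightarrow> 'k ell2" is snd by simp

lift_definition kp_defect :: "'k::real_or_complex kalton_peck \<Rightarrow> 'k ell2" is
  "\<lambda>p n. fst p n - KP_map (snd p) n" by simp

lift_definition kp_incl :: "'k::real_or_complex ell2 \<Rightarrow> 'k kalton_peck" is "\<lambda>x. (x, \<lambda>n. 0)"
  by (simp add: KP_map_zero l2_zero)

lift_definition kp_section :: "'k::real_or_complex ell2 \<Rightarrow> 'k kalton_peck" is "\<lambda>y. (KP_map y, y)"
  by (simp add: l2_zero)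

lemma kp_snd_eq: "kp_snd u n = ell2_nth (kp_quot u) n"
  by (simp add: kp_snd.rep_eq kp_quot.rep_eq)

lemma kp_fst_eq: "kp_fst u n = ell2_nth (kp_defect u) n + KP_map (ell2_nth (kp_quot u)) n"
  by (simp add: kp_fst.rep_eq kp_quot.rep_eq kp_defect.rep_eq)

lemma kp_eqI:
  assumes "\<And>n. kp_fst u n = kp_fst v n" "\<And>n. kp_snd u n = kp_snd v n"
  shows "u = v"
  using assms by (metis kp_fst.rep_eq kp_snd.rep_eq Rep_kalton_peck_inject prod_eqI ext)

lemma kp_fst_zero [simp]: "kp_fst 0 n = 0" by (simp add: kp_fst.rep_eq zero_kalton_peck.rep_eq)
lemma kp_snd_zero [simp]: "kp_snd 0 n = 0" by (simp add: kp_snd.rep_eq zero_kalton_peck.rep_eq)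
lemma kp_fst_add [simp]: "kp_fst (u + v) n = kp_fst u n + kp_fst v n"
  by (simp add: kp_fst.rep_eq plus_kalton_peck.rep_eq)
lemma kp_snd_add [simp]: "kp_snd (u + v) n = kp_snd u n + kp_snd v n"
  by (simp add: kp_snd.rep_eq plus_kalton_peck.rep_eq)
lemma kp_fst_scale [simp]: "kp_fst (kp_scale c u) n = c * kp_fst u n"
  by (simp add: kp_fst.rep_eq kp_scale.rep_eq)
lemma kp_snd_scale [simp]: "kp_snd (kp_scale c u) n = c * kp_snd u n"
  by (simp add: kp_snd.rep_eq kp_scale.rep_eq)
lemma kp_fst_diff [simp]: "kp_fst (u - v) n = kp_fst u n - kp_fst v n"
  by (simp add: minus_kalton_peck_def)
lemma kp_snd_diff [simp]: "kp_snd (u - v) n = kp_snd u n - kp_snd v n"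
  by (simp add: minus_kalton_peck_def)
lemma kp_fst_sum: "kp_fst (\<Sum>i\<in>I. f i) n = (\<Sum>i\<in>I. kp_fst (f i) n)"
  by (induction I rule: infinite_finite_induct) simp_all
lemma kp_snd_sum: "kp_snd (\<Sum>i\<in>I. f i) n = (\<Sum>i\<in>I. kp_snd (f i) n)"
  by (induction I rule: infinite_finite_induct) simp_all
lemma kp_fst_incl [simp]: "kp_fst (kp_incl x) n = ell2_nth x n"
  by (simp add: kp_fst.rep_eq kp_incl.rep_eq)
lemma kp_snd_incl [simp]: "kp_snd (kp_incl x) n = 0"
  by (simp add: kp_snd.rep_eq kp_incl.rep_eq)
lemma kp_fst_section: "kp_fst (kp_section y) n = KP_map (ell2_nth y) n"
  by (simp add: kp_fst.rep_eq kp_section.rep_eq)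
lemma kp_snd_section [simp]: "kp_snd (kp_section y) n = ell2_nth y n"
  by (simp add: kp_snd.rep_eq kp_section.rep_eq)

lemma kp_quot_add: "kp_quot (u + v) = kp_quot u + kp_quot v"
  by (rule ell2_eqI) (simp flip: kp_snd_eq)
lemma kp_quot_diff: "kp_quot (u - v) = kp_quot u - kp_quot v"
  by (rule ell2_eqI) (simp flip: kp_snd_eq)
lemma kp_quot_scale: "kp_quot (kp_scale c u) = ell2_scale c (kp_quot u)"
  by (rule ell2_eqI) (simp flip: kp_snd_eq)
lemma kp_quot_incl [simp]: "kp_quot (kp_incl x) = 0"
  by (rule ell2_eqI) (simp flip: kp_snd_eq)
lemma kp_quot_section [simp]: "kp_quot (kp_section y) = y"
  by (rule ell2_eqI) (simp flip: kp_snd_eq)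
lemma kp_incl_add: "kp_incl (x + y) = kp_incl x + kp_incl y"
  by (rule kp_eqI) simp_all
lemma kp_incl_diff: "kp_incl (x - y) = kp_incl x - kp_incl y"
  by (rule kp_eqI) simp_all
lemma kp_incl_scale: "kp_incl (ell2_scale c x) = kp_scale c (kp_incl x)"
  by (rule kp_eqI) simp_all
lemma kp_defect_incl [simp]: "kp_defect (kp_incl x) = x"
  by (rule ell2_eqI) (simp add: kp_defect.rep_eq kp_incl.rep_eq KP_map_zero)
lemma kp_defect_section [simp]: "kp_defect (kp_section y) = 0"
  by (rule ell2_eqI) (simp add: kp_defect.rep_eq kp_section.rep_eq)

lemma kp_decompose: "u = kp_incl (kp_defect u) + kp_section (kp_quot u)"
  by (rule kp_eqI) (simp_all add: kp_fst_section kp_fst_eq[of u] kp_snd_eq[of u])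

lemma kp_qnorm_eq: "kp_qnorm u = norm (kp_defect u) + norm (kp_quot u)"
  by (simp add: kp_qnorm_def norm_ell2.rep_eq kp_defect.rep_eq kp_quot.rep_eq
      kp_fst.rep_eq kp_snd.rep_eq)

lemma kp_qnorm_nonneg: "0 \<le> kp_qnorm u"
  by (simp add: kp_qnorm_eq)

lemma kp_qnorm_incl [simp]: "kp_qnorm (kp_incl x) = norm x"
  by (simp add: kp_qnorm_eq)

lemma kp_qnorm_section [simp]: "kp_qnorm (kp_section x) = norm x"
  by (simp add: kp_qnorm_eq)

lemma kp_qnorm_scale: "kp_qnorm (kp_scale c u) = norm c * kp_qnorm u"
  using equivalent_kp_qnorm_self by (auto simp: equivalent_kp_qnorm_def)

lemma kp_qnorm_eq_0_iff: "kp_qnorm u = 0 \<longleftrightarrow> u = 0"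
proof
  assume "kp_qnorm u = 0"
  then have "norm (kp_defect u) = 0" "norm (kp_quot u) = 0"
    unfolding kp_qnorm_eq using norm_ge_zero[of "kp_defect u"] norm_ge_zero[of "kp_quot u"]
    by linarith+
  then have "kp_defect u = 0" "kp_quot u = 0" by simp_all
  then show "u = 0"
    by (intro kp_eqI) (simp_all add: kp_fst_eq[of u] kp_snd_eq[of u] KP_map_def)
next
  assume "u = 0"
  then have "u = kp_incl 0" by (metis kp_eqI kp_fst_zero kp_snd_zero kp_fst_incl kp_snd_incl ell2_nth_zero)
  then show "kp_qnorm u = 0" by simp
qed

lemma kp_qnorm_zero [simp]: "kp_qnorm 0 = 0"
  by (simp add: kp_qnorm_eq_0_iff)

text \<open>
  The individual terms of \<open>\<langle>\<Omega> x, y\<rangle> - \<langle>x, \<Omega> y\<rangle>\<close>: the two logarithms combine to that of a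
  quotient, and \<open>a * b * \<bar>ln (a / b)\<bar> \<le> a\<^sup>2 + b\<^sup>2\<close>.
\<close>

lemma norm_KP_map_commutator_le:
  fixes x y :: "'k::real_or_complex ell2"
  shows "norm (KP_map (ell2_nth x) n * scalar_cnj (ell2_nth y n)
        - ell2_nth x n * scalar_cnj (KP_map (ell2_nth y) n))
      \<le> norm y / norm x * (norm (ell2_nth x n))\<^sup>2 + norm x / norm y * (norm (ell2_nth y n))\<^sup>2"
    (is "norm ?l \<le> ?r")
proof (cases "ell2_nth x n = 0 \<or> ell2_nth y n = 0")
  case True
  then have "?l = 0" by (auto simp: KP_map_def)
  moreover have "0 \<le> ?r" by simp
  ultimately show ?thesis by (simp only: norm_zero)
next
  case False
  let ?x = "norm (ell2_nth x n)" and ?y = "norm (ell2_nth y n)"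
  have p: "0 < ?x" "0 < ?y" using False by auto
  then have P: "0 < norm x" "0 < norm y"
    using norm_ell2_nth_le[of x n] norm_ell2_nth_le[of y n] by linarith+
  define a b where "a = ?x / norm x" and "b = ?y / norm y"
  have ab: "0 < a" "0 < b" using p P by (simp_all add: a_def b_def)
  have "?l = ell2_nth x n * scalar_cnj (ell2_nth y n) * of_real (ln b - ln a)"
    using p P
    by (simp add: KP_map_eq l2_norm_ell2_nth scalar_cnj_diff scalar_cnj_mult a_def b_def
        ln_divide_pos algebra_simps)
  then have "norm ?l = ?x * ?y * \<bar>ln b - ln a\<bar>"
    by (simp only: norm_mult norm_scalar_cnj norm_of_real)
  also have "\<dots> = norm x * norm y * (a * b * \<bar>ln b - ln a\<bar>)"
    using P by (simp add: a_def b_def)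
  also have "a * b * \<bar>ln b - ln a\<bar> \<le> a\<^sup>2 + b\<^sup>2"
  proof -
    have *: "a * b * (ln b - ln a) \<le> b\<^sup>2" if "0 < a" "0 < b" for a b :: real
    proof -
      have "ln (b / a) \<le> b / a - 1" using that by (intro ln_le_minus_one) simp
      then have "ln b - ln a \<le> b / a" using that by (simp add: ln_divide_pos)
      then have "a * b * (ln b - ln a) \<le> a * b * (b / a)"
        using that by (intro mult_left_mono) auto
      then show ?thesis using that by (simp add: power2_eq_square)
    qed
    show ?thesis
    proof (cases "ln b \<ge> ln a")
      case True
      then have "a * b * \<bar>ln b - ln a\<bar> = a * b * (ln b - ln a)" by simp
      also have "\<dots> \<le> b\<^sup>2" using *[OF ab] .
      also have "\<dots> \<le> a\<^sup>2 + b\<^sup>2" by simp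
      finally show ?thesis .
    next
      case False
      then have "a * b * \<bar>ln b - ln a\<bar> = b * a * (ln a - ln b)" by simp
      also have "\<dots> \<le> a\<^sup>2" using *[OF ab(2) ab(1)] .
      also have "\<dots> \<le> a\<^sup>2 + b\<^sup>2" by simp
      finally show ?thesis .
    qed
  qed
  then have "norm x * norm y * (a * b * \<bar>ln b - ln a\<bar>) \<le> norm x * norm y * (a\<^sup>2 + b\<^sup>2)"
    by (intro mult_left_mono) auto
  also have "norm x * norm y * (a\<^sup>2 + b\<^sup>2) = ?r"
    using P by (simp add: a_def b_def power2_eq_square field_simps)
  finally show ?thesis by simp
qed

lemma ell2_sums_norm_power2: "(\<lambda>n. (norm (ell2_nth x n))\<^sup>2) sums (norm x)\<^sup>2"
proof -
  have "summable (\<lambda>n. (norm (ell2_nth x n))\<^sup>2)"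
    using l2_ell2_nth[of x] by (simp only: l2_def)
  then show ?thesis unfolding norm_ell2_power2 by (rule summable_sums)
qed

text \<open>The weights \<open>norm y / norm x\<close> and \<open>norm x / norm y\<close> make both
  halves of the majorant sum to \<open>norm x * norm y\<close>. The single series with
  \<open>\<Omega> x\<close> or with \<open>\<Omega> y\<close> need not converge; for
  \<open>x = y\<close> it is an entropy.\<close>

lemma
  fixes x y :: "'k::real_or_complex ell2"
  defines "t \<equiv> \<lambda>n. KP_map (ell2_nth x) n * scalar_cnj (ell2_nth y n)
        - ell2_nth x n * scalar_cnj (KP_map (ell2_nth y) n)"
  shows summable_KP_map_commutator: "summable t"
    and norm_suminf_KP_map_commutator_le: "norm (suminf t) \<le> 2 * norm x * norm y"
proof -
  let ?r = "\<lambda>n. norm y / norm x * (norm (ell2_nth x n))\<^sup>2 + norm x / norm y * (norm (ell2_nth y n))\<^sup>2"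
  have s: "?r sums (norm y / norm x * (norm x)\<^sup>2 + norm x / norm y * (norm y)\<^sup>2)"
    by (intro sums_add sums_mult ell2_sums_norm_power2)
  have le: "norm (t n) \<le> ?r n" for n
    unfolding t_def by (rule norm_KP_map_commutator_le)
  have n: "summable (\<lambda>n. norm (t n))"
    by (rule summable_comparison_test'[OF sums_summable[OF s], of 0]) (use le in simp)
  then show "summable t" by (rule summable_norm_cancel)
  have "norm (suminf t) \<le> (\<Sum>n. norm (t n))" by (rule summable_norm[OF n])
  also have "\<dots> \<le> suminf ?r" by (rule suminf_le[OF le n sums_summable[OF s]])
  also have "\<dots> = norm y / norm x * (norm x)\<^sup>2 + norm x / norm y * (norm y)\<^sup>2"
    using s by (rule sums_unique[symmetric])
  also have "\<dots> \<le> 2 * norm x * norm y"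
    by (simp add: power2_eq_square)
  finally show "norm (suminf t) \<le> 2 * norm x * norm y" .
qed

text \<open>The subtraction takes place inside the series, since in general only the differences are
  summable.\<close>

definition kp_omega :: "'k::real_or_complex kalton_peck \<Rightarrow> 'k kalton_peck \<Rightarrow> 'k" where
  "kp_omega u v = (\<Sum>n. kp_fst u n * scalar_cnj (kp_snd v n) - kp_snd u n * scalar_cnj (kp_fst v n))"

lemma kp_omega_sums:
  "(\<lambda>n. kp_fst u n * scalar_cnj (kp_snd v n) - kp_snd u n * scalar_cnj (kp_fst v n)) sums
     (ell2_inner (kp_defect u) (kp_quot v) - ell2_inner (kp_quot u) (kp_defect v)
      + (\<Sum>n. KP_map (ell2_nth (kp_quot u)) n * scalar_cnj (ell2_nth (kp_quot v) n)
        - ell2_nth (kp_quot u) n * scalar_cnj (KP_map (ell2_nth (kp_quot v)) n)))"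
proof -
  have i: "(\<lambda>n. ell2_nth x n * scalar_cnj (ell2_nth y n)) sums ell2_inner x y" for x y :: "'a ell2"
    unfolding ell2_inner_eq by (rule summable_sums[OF summable_ell2_mult])
  have "kp_fst u n * scalar_cnj (kp_snd v n) - kp_snd u n * scalar_cnj (kp_fst v n) =
      ell2_nth (kp_defect u) n * scalar_cnj (ell2_nth (kp_quot v) n)
      - ell2_nth (kp_quot u) n * scalar_cnj (ell2_nth (kp_defect v) n)
      + (KP_map (ell2_nth (kp_quot u)) n * scalar_cnj (ell2_nth (kp_quot v) n)
        - ell2_nth (kp_quot u) n * scalar_cnj (KP_map (ell2_nth (kp_quot v)) n))" for n
    by (simp add: kp_fst_eq kp_snd_eq scalar_cnj_add algebra_simps)
  then show ?thesis
    by (simp only:) (intro sums_add sums_diff i summable_sums summable_KP_map_commutator)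
qed

lemma kp_omega_summable:
  "summable (\<lambda>n. kp_fst u n * scalar_cnj (kp_snd v n) - kp_snd u n * scalar_cnj (kp_fst v n))"
  by (rule sums_summable[OF kp_omega_sums])

lemma kp_omega_eq:
  "kp_omega u v = ell2_inner (kp_defect u) (kp_quot v) - ell2_inner (kp_quot u) (kp_defect v)
      + (\<Sum>n. KP_map (ell2_nth (kp_quot u)) n * scalar_cnj (ell2_nth (kp_quot v) n)
        - ell2_nth (kp_quot u) n * scalar_cnj (KP_map (ell2_nth (kp_quot v)) n))"
  unfolding kp_omega_def by (rule sums_unique[OF kp_omega_sums, symmetric])

lemma norm_kp_omega_le_qnorm: "norm (kp_omega u v) \<le> 2 * kp_qnorm u * kp_qnorm v"
proof -
  let ?b = "norm (kp_defect u)" and ?y = "norm (kp_quot u)"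
  let ?b' = "norm (kp_defect v)" and ?y' = "norm (kp_quot v)"
  have "norm (kp_omega u v) \<le> ?b * ?y' + ?y * ?b' + 2 * ?y * ?y'"
    unfolding kp_omega_eq
    by (intro norm_triangle_le order_trans[OF norm_triangle_ineq4] add_mono
        norm_ell2_inner_le norm_suminf_KP_map_commutator_le)
  also have "\<dots> \<le> 2 * (?b + ?y) * (?b' + ?y')"
  proof -
    have "2 * (?b + ?y) * (?b' + ?y') - (?b * ?y' + ?y * ?b' + 2 * ?y * ?y')
        = 2 * (?b * ?b') + ?b * ?y' + ?y * ?b'" by (simp add: algebra_simps)
    moreover have "0 \<le> 2 * (?b * ?b') + ?b * ?y' + ?y * ?b'" by simp
    ultimately show ?thesis by linarith
  qed
  finally show ?thesis by (simp add: kp_qnorm_eq)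
qed

lemma kp_omega_add_left: "kp_omega (u + v) w = kp_omega u w + kp_omega v w"
  unfolding kp_omega_def suminf_add[OF kp_omega_summable kp_omega_summable]
  by (simp add: algebra_simps)

lemma kp_omega_scale_left: "kp_omega (kp_scale c u) w = c * kp_omega u w"
  unfolding kp_omega_def suminf_mult[OF kp_omega_summable, symmetric]
  by (simp add: algebra_simps)

lemma kp_omega_commute: "kp_omega v u = - scalar_cnj (kp_omega u v)"
proof -
  have "scalar_cnj (kp_omega u v) =
      (\<Sum>n. scalar_cnj (kp_fst u n * scalar_cnj (kp_snd v n) - kp_snd u n * scalar_cnj (kp_fst v n)))"
    unfolding kp_omega_def
    by (rule bounded_linear.suminf[OF bounded_linear_scalar_cnj kp_omega_summable])
  also have "\<dots> = (\<Sum>n. - (kp_fst v n * scalar_cnj (kp_snd u n) - kp_snd v n * scalar_cnj (kp_fst u n)))"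
    by (intro suminf_cong) (simp add: scalar_cnj_diff scalar_cnj_mult scalar_cnj_cnj algebra_simps)
  also have "\<dots> = - kp_omega v u"
    unfolding kp_omega_def by (rule suminf_minus[OF kp_omega_summable])
  finally show ?thesis by simp
qed

lemma norm_kp_omega_commute: "norm (kp_omega u v) = norm (kp_omega v u)"
  by (subst kp_omega_commute) simp

lemma kp_omega_add_right: "kp_omega w (u + v) = kp_omega w u + kp_omega w v"
  unfolding kp_omega_commute[of w] by (simp add: kp_omega_add_left scalar_cnj_add)

lemma kp_omega_scale_right: "kp_omega w (kp_scale c u) = scalar_cnj c * kp_omega w u"
  unfolding kp_omega_commute[of w] by (simp add: kp_omega_scale_left scalar_cnj_mult)

lemma kp_omega_zero_left [simp]: "kp_omega 0 w = 0"
  using kp_omega_add_left[of 0 0 w] by simp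

lemma kp_omega_zero_right [simp]: "kp_omega w 0 = 0"
  using kp_omega_add_right[of w 0 0] by simp

lemma kp_omega_minus_left: "kp_omega (- u) w = - kp_omega u w"
  using kp_omega_add_left[of u "- u" w] by (simp add: eq_neg_iff_add_eq_0 add.commute)

lemma kp_omega_minus_right: "kp_omega w (- u) = - kp_omega w u"
  using kp_omega_add_right[of w u "- u"] by (simp add: eq_neg_iff_add_eq_0 add.commute)

lemma kp_omega_diff_left: "kp_omega (u - v) w = kp_omega u w - kp_omega v w"
  using kp_omega_add_left[of u "- v" w] by (simp add: kp_omega_minus_left)

lemma kp_omega_diff_right: "kp_omega w (u - v) = kp_omega w u - kp_omega w v"
  using kp_omega_add_right[of w u "- v"] by (simp add: kp_omega_minus_right)

lemma kp_omega_sum_left: "kp_omega (\<Sum>i\<in>I. f i) w = (\<Sum>i\<in>I. kp_omega (f i) w)"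
  by (induction I rule: infinite_finite_induct) (simp_all add: kp_omega_add_left)

lemma kp_omega_sum_right: "kp_omega w (\<Sum>i\<in>I. f i) = (\<Sum>i\<in>I. kp_omega w (f i))"
  by (induction I rule: infinite_finite_induct) (simp_all add: kp_omega_add_right)

lemma kp_omega_incl_left: "kp_omega (kp_incl x) v = ell2_inner x (kp_quot v)"
  by (simp add: kp_omega_def ell2_inner_eq flip: kp_snd_eq)

lemma kp_omega_incl_right: "kp_omega v (kp_incl x) = - ell2_inner (kp_quot v) x"
  unfolding kp_omega_commute[of v] kp_omega_incl_left by (subst ell2_inner_commute) (simp add: scalar_cnj_cnj)

text \<open>The form pairs the kernel with the quotient. In this and the next estimate
  \<open>u\<close> is tested against the copy of its quotient in the kernel and against the section
  over its defect, which recovers both components; the second test leaves a commutator error. They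
  bound the dual norm from below.\<close>

lemma power2_norm_quot_le: "(norm (kp_quot u))\<^sup>2 \<le> norm (kp_omega u (kp_incl (kp_quot u)))"
  unfolding kp_omega_incl_right ell2_inner_self norm_minus_cancel norm_of_real by simp

lemma power2_norm_defect_le:
  "(norm (kp_defect u))\<^sup>2 \<le>
     norm (kp_omega u (kp_section (kp_defect u))) + 2 * norm (kp_quot u) * norm (kp_defect u)"
proof -
  let ?r = "\<Sum>n. KP_map (ell2_nth (kp_quot u)) n * scalar_cnj (ell2_nth (kp_defect u) n)
        - ell2_nth (kp_quot u) n * scalar_cnj (KP_map (ell2_nth (kp_defect u)) n)"
  have "of_real ((norm (kp_defect u))\<^sup>2) = kp_omega u (kp_section (kp_defect u)) - ?r"
    by (simp only: kp_omega_eq kp_quot_section kp_defect_section ell2_inner_self) simp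
  then have "norm (of_real ((norm (kp_defect u))\<^sup>2) :: 'a) \<le>
      norm (kp_omega u (kp_section (kp_defect u))) + norm ?r"
    by (metis norm_triangle_ineq4)
  also have "norm ?r \<le> 2 * norm (kp_quot u) * norm (kp_defect u)"
    by (rule norm_suminf_KP_map_commutator_le)
  finally show ?thesis unfolding norm_of_real by simp
qed

text \<open>
  The quasi-norm is equivalent to the norm dual to it under the form; with the latter the space
  becomes an honest normed space.
\<close>

instantiation kalton_peck :: (real_or_complex) real_normed_vector
begin

definition scaleR_kalton_peck :: "real \<Rightarrow> 'a kalton_peck \<Rightarrow> 'a kalton_peck" where
  "scaleR_kalton_peck r u = kp_scale (of_real r) u"
definition norm_kalton_peck :: "'a kalton_peck \<Rightarrow> real" where
  "norm_kalton_peck u = (SUP v\<in>{v. kp_qnorm v \<le> 1}. norm (kp_omega u v))"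
definition sgn_kalton_peck :: "'a kalton_peck \<Rightarrow> 'a kalton_peck" where
  "sgn_kalton_peck u = inverse (norm u) *\<^sub>R u"
definition dist_kalton_peck :: "'a kalton_peck \<Rightarrow> 'a kalton_peck \<Rightarrow> real" where
  "dist_kalton_peck u v = norm (u - v)"
definition uniformity_kalton_peck :: "('a kalton_peck \<times> 'a kalton_peck) filter"
  where "uniformity_kalton_peck = (INF e\<in>{0 <..}. principal {(x, y). dist x y < e})"
definition open_kalton_peck :: "'a kalton_peck set \<Rightarrow> bool"
  where "open_kalton_peck U = (\<forall>x\<in>U. eventually (\<lambda>(x', y). x' = x \<longrightarrow> y \<in> U) uniformity)"

lemma bdd_above_kp_norm: "bdd_above ((\<lambda>v. norm (kp_omega (u :: 'a kalton_peck) v)) ` {v. kp_qnorm v \<le> 1})"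
proof (rule bdd_aboveI2)
  fix v :: "'a kalton_peck" assume "v \<in> {v. kp_qnorm v \<le> 1}"
  then have "2 * kp_qnorm u * kp_qnorm v \<le> 2 * kp_qnorm u * 1"
    by (intro mult_left_mono) (auto simp: kp_qnorm_nonneg)
  then show "norm (kp_omega u v) \<le> 2 * kp_qnorm u"
    using norm_kp_omega_le_qnorm[of u v] by linarith
qed

lemma norm_kp_leI: "(\<And>v. kp_qnorm v \<le> 1 \<Longrightarrow> norm (kp_omega u v) \<le> C) \<Longrightarrow> norm u \<le> C"
  unfolding norm_kalton_peck_def
  by (rule cSUP_least) (auto simp: kp_qnorm_eq_0_iff intro!: exI[of _ 0])

lemma norm_kp_omega_le_unit: "kp_qnorm v \<le> 1 \<Longrightarrow> norm (kp_omega u v) \<le> norm u"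
  unfolding norm_kalton_peck_def by (rule cSUP_upper[OF _ bdd_above_kp_norm]) simp

lemma norm_kp_nonneg: "0 \<le> norm (u :: 'a kalton_peck)"
  using norm_kp_omega_le_unit[of 0 u] by (simp add: kp_qnorm_eq_0_iff)

lemma norm_kp_omega_le: "norm (kp_omega u v) \<le> norm u * kp_qnorm v"
proof (cases "v = 0")
  case False
  then have q: "0 < kp_qnorm v"
    using kp_qnorm_nonneg[of v] kp_qnorm_eq_0_iff[of v] by linarith
  have "norm (kp_omega u (kp_scale (of_real (1 / kp_qnorm v)) v)) \<le> norm u"
    by (rule norm_kp_omega_le_unit) (use q in \<open>simp only: kp_qnorm_scale norm_of_real, simp\<close>)
  then show ?thesis
    using q unfolding kp_omega_scale_right norm_mult scalar_cnj_of_real norm_of_real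
    by (simp add: field_simps)
qed (simp add: kp_qnorm_eq_0_iff)

lemma norm_kp_le_qnorm: "norm u \<le> 2 * kp_qnorm u"
proof (rule norm_kp_leI)
  fix v :: "'a kalton_peck" assume "kp_qnorm v \<le> 1"
  then have "2 * kp_qnorm u * kp_qnorm v \<le> 2 * kp_qnorm u * 1"
    by (intro mult_left_mono) (auto simp: kp_qnorm_nonneg)
  then show "norm (kp_omega u v) \<le> 2 * kp_qnorm u"
    using norm_kp_omega_le_qnorm[of u v] by linarith
qed

lemma norm_quot_le: "norm (kp_quot u) \<le> norm u"
proof (cases "kp_quot u = 0")
  case False
  have "(norm (kp_quot u))\<^sup>2 \<le> norm u * norm (kp_quot u)"
    using power2_norm_quot_le[of u] norm_kp_omega_le[of u "kp_incl (kp_quot u)"] by simp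
  then show ?thesis using False by (simp add: power2_eq_square)
qed (simp add: norm_kp_nonneg)

lemma norm_defect_le: "norm (kp_defect u) \<le> 3 * norm u"
proof (cases "kp_defect u = 0")
  case False
  have "(norm (kp_defect u))\<^sup>2 \<le> norm u * norm (kp_defect u) + 2 * norm (kp_quot u) * norm (kp_defect u)"
    using power2_norm_defect_le[of u] norm_kp_omega_le[of u "kp_section (kp_defect u)"] by simp
  then have "norm (kp_defect u) * norm (kp_defect u) \<le> (norm u + 2 * norm (kp_quot u)) * norm (kp_defect u)"
    by (simp add: power2_eq_square algebra_simps)
  then have "norm (kp_defect u) \<le> norm u + 2 * norm (kp_quot u)"
    using False by (simp add: mult_le_cancel_right)
  then show ?thesis using norm_quot_le[of u] by linarith
qed (simp add: norm_kp_nonneg)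

lemma kp_qnorm_le: "kp_qnorm u \<le> 4 * norm u"
  using norm_quot_le[of u] norm_defect_le[of u] by (simp add: kp_qnorm_eq)

lemma norm_kp_scale [simp]: "norm (kp_scale c u) = norm c * norm u"
proof -
  have le: "norm (kp_scale c u) \<le> norm c * norm u" for c and u :: "'a kalton_peck"
    by (rule norm_kp_leI) (simp add: kp_omega_scale_left norm_mult norm_kp_omega_le_unit mult_left_mono)
  show ?thesis
  proof (cases "c = 0")
    case True
    then show ?thesis using le[of c u] norm_kp_nonneg[of "kp_scale c u"] by simp
  next
    case False
    have "kp_scale (inverse c) (kp_scale c u) = u"
      by (rule kp_eqI) (use False in simp_all)
    then have "norm u \<le> norm (inverse c) * norm (kp_scale c u)" using le[of "inverse c" "kp_scale c u"] by simp
    then have "norm u \<le> inverse (norm c) * norm (kp_scale c u)" by (simp only: norm_inverse)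
    then have "norm c * norm u \<le> norm (kp_scale c u)"
      using False by (simp add: field_simps)
    with le[of c u] show ?thesis by (rule order_antisym)
  qed
qed

instance
proof
  fix x y z :: "'a kalton_peck" and a b :: real
  show "a *\<^sub>R (x + y) = a *\<^sub>R x + a *\<^sub>R y"
    by (rule kp_eqI) (simp_all add: scaleR_kalton_peck_def algebra_simps)
  show "(a + b) *\<^sub>R x = a *\<^sub>R x + b *\<^sub>R x"
    by (rule kp_eqI) (simp_all add: scaleR_kalton_peck_def algebra_simps)
  show "a *\<^sub>R b *\<^sub>R x = (a * b) *\<^sub>R x"
    by (rule kp_eqI) (simp_all add: scaleR_kalton_peck_def algebra_simps)
  show "1 *\<^sub>R x = x"
    by (rule kp_eqI) (simp_all add: scaleR_kalton_peck_def)
  show "dist x y = norm (x - y)" by (rule dist_kalton_peck_def)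
  show "sgn x = inverse (norm x) *\<^sub>R x" by (rule sgn_kalton_peck_def)
  show "uniformity = (INF e\<in>{0 <..}. principal {(x, y :: 'a kalton_peck). dist x y < e})"
    by (rule uniformity_kalton_peck_def)
  show "open U = (\<forall>x\<in>U. eventually (\<lambda>(x', y). x' = x \<longrightarrow> y \<in> U) uniformity)" for U :: "'a kalton_peck set"
    by (rule open_kalton_peck_def)
  show "norm x = 0 \<longleftrightarrow> x = 0"
  proof
    assume "norm x = 0"
    then have "kp_qnorm x = 0" using kp_qnorm_le[of x] kp_qnorm_nonneg[of x] by linarith
    then show "x = 0" by (simp add: kp_qnorm_eq_0_iff)
  next
    assume "x = 0"
    then have "kp_qnorm x = 0" by (simp add: kp_qnorm_eq_0_iff)
    then show "norm x = 0" using norm_kp_le_qnorm[of x] norm_kp_nonneg[of x] by linarith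
  qed
  show "norm (x + y) \<le> norm x + norm y"
  proof (rule norm_kp_leI)
    fix v :: "'a kalton_peck" assume "kp_qnorm v \<le> 1"
    then show "norm (kp_omega (x + y) v) \<le> norm x + norm y"
      unfolding kp_omega_add_left by (intro norm_triangle_mono norm_kp_omega_le_unit)
  qed
  show "norm (a *\<^sub>R x) = \<bar>a\<bar> * norm x"
    unfolding scaleR_kalton_peck_def norm_kp_scale norm_of_real ..
qed

end

lemma norm_incl_le: "norm (kp_incl x) \<le> 2 * norm x"
  using norm_kp_le_qnorm[of "kp_incl x"] by simp

lemma norm_section_le: "norm (kp_section x) \<le> 2 * norm x"
  using norm_kp_le_qnorm[of "kp_section x"] by simp

lemma kp_incl_scaleR: "kp_incl (r *\<^sub>R x) = r *\<^sub>R kp_incl x"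
  by (rule kp_eqI) (simp_all add: scaleR_kalton_peck_def)

lemma kp_quot_scaleR: "kp_quot (r *\<^sub>R u) = r *\<^sub>R kp_quot u"
  by (rule ell2_eqI) (simp add: scaleR_kalton_peck_def flip: kp_snd_eq)

lemma bounded_linear_kp_incl: "bounded_linear kp_incl"
  using norm_incl_le
  by (intro bounded_linear_intro[where K = 2]) (simp_all add: kp_incl_add kp_incl_scaleR mult.commute)

lemma bounded_linear_kp_quot: "bounded_linear kp_quot"
  by (rule bounded_linear_intro[where K = 1])
    (simp_all add: kp_quot_add kp_quot_scaleR norm_quot_le)

lemma norm_kp_omega_le4: "norm (kp_omega u v) \<le> 4 * norm u * norm v"
proof -
  have "norm (kp_omega u v) \<le> norm u * kp_qnorm v" by (rule norm_kp_omega_le)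
  also have "\<dots> \<le> norm u * (4 * norm v)" by (intro mult_left_mono kp_qnorm_le) simp
  finally show ?thesis by simp
qed

lemma bounded_bilinear_kp_omega: "bounded_bilinear kp_omega"
proof
  fix a b :: "'a kalton_peck" and r :: real
  show "kp_omega (r *\<^sub>R a) b = r *\<^sub>R kp_omega a b" "kp_omega a (r *\<^sub>R b) = r *\<^sub>R kp_omega a b"
    by (simp_all add: scaleR_kalton_peck_def kp_omega_scale_left kp_omega_scale_right scaleR_conv_of_real)
  show "\<exists>K. \<forall>a b :: 'a kalton_peck. norm (kp_omega a b) \<le> norm a * norm b * K"
    using norm_kp_omega_le4 by (intro exI[of _ 4]) (auto simp: algebra_simps)
qed (simp_all add: kp_omega_add_left kp_omega_add_right)

section \<open>Density of the finitely supported vectors\<close>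

lemma KP_map_unit: "KP_map (ell2_nth (ell2_unit i)) n = 0"
  by (simp add: KP_map_def l2_norm_ell2_nth ell2_nth_unit)

lemma kp_fst_section_unit [simp]: "kp_fst (kp_section (ell2_unit i)) n = 0"
  by (simp add: kp_fst_section KP_map_unit)

definition kp_trunc :: "nat \<Rightarrow> 'k::real_or_complex kalton_peck \<Rightarrow> 'k kalton_peck" where
  "kp_trunc m u = (\<Sum>i<m. kp_scale (kp_fst u i) (kp_incl (ell2_unit i))
     + kp_scale (kp_snd u i) (kp_section (ell2_unit i)))"

lemma kp_fst_trunc: "kp_fst (kp_trunc m u) n = (if n < m then kp_fst u n else 0)"
proof -
  have "kp_fst (kp_trunc m u) n = (\<Sum>i<m. if n = i then kp_fst u i else 0)"
    unfolding kp_trunc_def kp_fst_sum by (intro sum.cong) (auto simp: ell2_nth_unit)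
  then show ?thesis by simp
qed

lemma kp_snd_trunc: "kp_snd (kp_trunc m u) n = (if n < m then kp_snd u n else 0)"
proof -
  have "kp_snd (kp_trunc m u) n = (\<Sum>i<m. if n = i then kp_snd u i else 0)"
    unfolding kp_trunc_def kp_snd_sum by (intro sum.cong) (auto simp: ell2_nth_unit)
  then show ?thesis by simp
qed

text \<open>A quantitative form of the fact that t ln t tends to 0, from
  \<open>ln y \<le> y - 1\<close> at \<open>y = 1 / sqrt t\<close>.\<close>

lemma mult_ln_le_sqrt:
  fixes t :: real
  assumes "0 \<le> t" "t \<le> 1"
  shows "t * \<bar>ln t\<bar> \<le> 2 * sqrt t"
proof (cases "t = 0")
  case False
  with assms have t: "0 < t" by simp
  have "ln (1 / sqrt t) \<le> 1 / sqrt t - 1" using t by (intro ln_le_minus_one) simp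
  then have "- ln t / 2 \<le> 1 / sqrt t" using t by (simp add: ln_divide_pos ln_sqrt)
  moreover have "ln t \<le> 0" using t assms by simp
  ultimately have "\<bar>ln t\<bar> \<le> 2 / sqrt t" by simp
  then have "t * \<bar>ln t\<bar> \<le> t * (2 / sqrt t)" using t by (intro mult_left_mono) auto
  also have "\<dots> = 2 * (t / sqrt t)" by simp
  also have "\<dots> = 2 * sqrt t" using t by (simp only: real_div_sqrt)
  finally show ?thesis .
qed simp

text \<open>\<open>\<Omega>\<close> is not local: on the tail \<open>t m\<close> of the quotient it
  uses ln (norm (t m)) instead of ln (norm y). The resulting error is \<open>c m\<close> times
  \<open>t m\<close>, and it tends to 0 because t ln t does.\<close>

lemma tendsto_kp_trunc: "(\<lambda>m. kp_trunc m u) \<longlonglongrightarrow> u"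
proof -
  let ?y = "kp_quot u" and ?b = "kp_defect u"
  define t where "t m = ?y - ell2_trunc m ?y" for m
  define c where "c m = ln (norm ?y) - ln (norm (t m))" for m
  have quot: "kp_quot (u - kp_trunc m u) = t m" for m
    unfolding t_def by (rule ell2_eqI) (simp add: ell2_nth_trunc kp_snd_trunc flip: kp_snd_eq)
  have defect: "kp_defect (u - kp_trunc m u) = (?b - ell2_trunc m ?b) + ell2_scale (of_real (c m)) (t m)" for m
  proof (rule ell2_eqI)
    fix n
    have "ell2_nth (kp_defect (u - kp_trunc m u)) n =
        kp_fst u n - kp_fst (kp_trunc m u) n - KP_map (ell2_nth (t m)) n"
      using kp_fst_eq[of "u - kp_trunc m u" n] unfolding quot by (simp add: algebra_simps)
    also have "\<dots> = ell2_nth ((?b - ell2_trunc m ?b) + ell2_scale (of_real (c m)) (t m)) n"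
    proof (cases "n < m")
      case True
      then have "ell2_nth (t m) n = 0" by (simp add: t_def ell2_nth_trunc)
      with True show ?thesis by (simp add: KP_map_def kp_fst_trunc ell2_nth_trunc)
    next
      case False
      then have "ell2_nth (t m) n = ell2_nth ?y n" by (simp add: t_def ell2_nth_trunc)
      with False show ?thesis
        by (simp add: KP_map_eq l2_norm_ell2_nth kp_fst_trunc kp_fst_eq[of u] ell2_nth_trunc
            c_def algebra_simps)
    qed
    finally show "ell2_nth (kp_defect (u - kp_trunc m u)) n =
      ell2_nth ((?b - ell2_trunc m ?b) + ell2_scale (of_real (c m)) (t m)) n" .
  qed
  have t0: "(\<lambda>m. norm (t m)) \<longlonglongrightarrow> 0"
    unfolding t_def using tendsto_norm[OF tendsto_diff[OF tendsto_const tendsto_ell2_trunc], of ?y ?y] by simp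
  have b0: "(\<lambda>m. norm (?b - ell2_trunc m ?b)) \<longlonglongrightarrow> 0"
    using tendsto_norm[OF tendsto_diff[OF tendsto_const tendsto_ell2_trunc], of ?b ?b] by simp
  let ?r = "\<lambda>m. 2 * (norm (?b - ell2_trunc m ?b) + (\<bar>ln (norm ?y)\<bar> * norm (t m) + 2 * sqrt (norm (t m))) + norm (t m))"
  have "eventually (\<lambda>m. norm (t m) < 1) sequentially"
    using t0 by (rule order_tendstoD) simp
  then have "eventually (\<lambda>m. norm (u - kp_trunc m u) \<le> ?r m) sequentially"
  proof eventually_elim
    case (elim m)
    have "norm (u - kp_trunc m u) \<le> 2 * kp_qnorm (u - kp_trunc m u)" by (rule norm_kp_le_qnorm)
    also have "kp_qnorm (u - kp_trunc m u) \<le> norm (?b - ell2_trunc m ?b) + \<bar>c m\<bar> * norm (t m) + norm (t m)"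
      unfolding kp_qnorm_eq quot defect
      by (intro add_right_mono order_trans[OF norm_triangle_ineq])
        (simp only: norm_ell2_scale norm_of_real order_refl)
    also have "\<bar>c m\<bar> * norm (t m) \<le> \<bar>ln (norm ?y)\<bar> * norm (t m) + norm (t m) * \<bar>ln (norm (t m))\<bar>"
    proof -
      have "\<bar>c m\<bar> * norm (t m) \<le> (\<bar>ln (norm ?y)\<bar> + \<bar>ln (norm (t m))\<bar>) * norm (t m)"
        unfolding c_def by (intro mult_right_mono) auto
      then show ?thesis by (simp add: algebra_simps)
    qed
    also have "norm (t m) * \<bar>ln (norm (t m))\<bar> \<le> 2 * sqrt (norm (t m))"
      using elim by (intro mult_ln_le_sqrt) auto
    finally show ?case by simp
  qed
  moreover have "?r \<longlonglongrightarrow> 2 * (0 + (\<bar>ln (norm ?y)\<bar> * 0 + 2 * sqrt 0) + 0)"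
    by (intro tendsto_intros t0 b0)
  then have "?r \<longlonglongrightarrow> 0" by simp
  ultimately have "(\<lambda>m. u - kp_trunc m u) \<longlonglongrightarrow> 0" by (rule Lim_null_comparison)
  from tendsto_diff[OF tendsto_const this, of u] show ?thesis by simp
qed

section \<open>Topology, form and adjoints\<close>

lemma norm_topology_eq_euclidean:
  fixes N :: "'v::real_normed_vector \<Rightarrow> real"
  assumes "0 < a" and a: "\<And>u. a * norm u \<le> N u" and b: "\<And>u. N u \<le> b * norm u"
  shows "norm_topology N = euclidean"
proof -
  have b': "N u \<le> (\<bar>b\<bar> + 1) * norm u" for u
    using order_trans[OF b[of u] mult_right_mono[of b "\<bar>b\<bar> + 1" "norm u"]] by simp
  have "openin (norm_topology N) U \<longleftrightarrow> open U" for U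
  proof
    assume U: "openin (norm_topology N) U"
    show "open U" unfolding open_dist
    proof
      fix x assume "x \<in> U"
      then obtain e where e: "e > 0" "\<And>y. N (y - x) < e \<Longrightarrow> y \<in> U"
        using U unfolding openin_gauge_topology by auto
      have "y \<in> U" if "dist y x < e / (\<bar>b\<bar> + 1)" for y
      proof (rule e(2))
        have "(\<bar>b\<bar> + 1) * norm (y - x) < e"
          using that by (simp add: dist_norm pos_less_divide_eq mult.commute)
        then show "N (y - x) < e" using b'[of "y - x"] by linarith
      qed
      then show "\<exists>e>0. \<forall>y. dist y x < e \<longrightarrow> y \<in> U"
        using e(1) by (intro exI[of _ "e / (\<bar>b\<bar> + 1)"]) auto
    qed
  next
    assume U: "open U"
    show "openin (norm_topology N) U" unfolding openin_gauge_topology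
    proof (intro conjI ballI)
      fix x assume "x \<in> U"
      then obtain e where e: "e > 0" "\<And>y. dist y x < e \<Longrightarrow> y \<in> U"
        using U unfolding open_dist by blast
      have "y \<in> U" if "N (y - x) < a * e" for y
      proof (rule e(2))
        have "a * norm (y - x) < a * e" using that a[of "y - x"] by linarith
        then show "dist y x < e" using \<open>0 < a\<close> by (simp add: dist_norm)
      qed
      then show "\<exists>e>0. \<forall>y\<in>UNIV. N (y - x) < e \<longrightarrow> y \<in> U"
        using e(1) \<open>0 < a\<close> by (intro exI[of _ "a * e"]) auto
    qed simp
  qed
  then show ?thesis by (simp add: topology_eq)
qed

lemma kp_qnorm_equiv: "1 / 2 * norm u \<le> kp_qnorm u" "kp_qnorm u \<le> 4 * norm u"
  using norm_kp_le_qnorm[of u] kp_qnorm_le[of u] by simp_all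

lemma norm_topology_kp_qnorm: "norm_topology (kp_qnorm :: 'k::real_or_complex kalton_peck \<Rightarrow> real) = euclidean"
  by (rule norm_topology_eq_euclidean[OF _ kp_qnorm_equiv]) simp

lemma kp_finite_support_trunc: "kp_finite_support (kp_trunc m u)"
proof -
  have "{n. kp_fst (kp_trunc m u) n \<noteq> 0} \<subseteq> {..<m}" "{n. kp_snd (kp_trunc m u) n \<noteq> 0} \<subseteq> {..<m}"
    by (auto simp: kp_fst_trunc kp_snd_trunc split: if_splits)
  then show ?thesis
    unfolding kp_finite_support_def by (meson finite_lessThan finite_subset)
qed

lemma kp_omega_finite_support:
  assumes "kp_finite_support u" "kp_finite_support v"
  shows "kp_omega u v = l2_inner (kp_fst u) (kp_snd v) - l2_inner (kp_snd u) (kp_fst v)"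
proof -
  have "summable (\<lambda>n. kp_fst u n * scalar_cnj (kp_snd v n))"
    using assms by (intro summable_finite[of "{n. kp_fst u n \<noteq> 0}"]) (auto simp: kp_finite_support_def)
  moreover have "summable (\<lambda>n. kp_snd u n * scalar_cnj (kp_fst v n))"
    using assms by (intro summable_finite[of "{n. kp_snd u n \<noteq> 0}"]) (auto simp: kp_finite_support_def)
  ultimately show ?thesis unfolding kp_omega_def l2_inner_def by (rule suminf_diff[symmetric])
qed

text \<open>Boundedness of \<open>kp_omega\<close> makes it a candidate for the definite
  description; truncating both arguments leaves a continuous candidate no freedom.\<close>

lemma kp_form_eq_omega: "kp_form = (kp_omega :: 'k::real_or_complex kalton_peck \<Rightarrow> 'k kalton_peck \<Rightarrow> 'k)"
proof -
  let ?P = "\<lambda>\<omega> :: 'k kalton_peck \<Rightarrow> 'k kalton_peck \<Rightarrow> 'k.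
    continuous_on UNIV (\<lambda>(u, v). \<omega> u v) \<and>
    (\<forall>u v. kp_finite_support u \<longrightarrow> kp_finite_support v \<longrightarrow>
      \<omega> u v = l2_inner (kp_fst u) (kp_snd v) - l2_inner (kp_snd u) (kp_fst v))"
  have 1: "?P kp_omega"
    unfolding case_prod_beta
    by (intro conjI allI impI bounded_bilinear.continuous_on[OF bounded_bilinear_kp_omega]
        continuous_intros kp_omega_finite_support)
  have 2: "\<omega> u v = kp_omega u v" if *: "?P \<omega>" for \<omega> u v
  proof -
    have lim: "(\<lambda>m. kp_omega (kp_trunc m u) (kp_trunc m v)) \<longlonglongrightarrow> kp_omega u v"
      by (intro bounded_bilinear.tendsto[OF bounded_bilinear_kp_omega] tendsto_kp_trunc)
    have "(\<lambda>m. (kp_trunc m u, kp_trunc m v)) \<longlonglongrightarrow> (u, v)"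
      by (intro tendsto_Pair tendsto_kp_trunc)
    from continuous_on_tendsto_compose[OF conjunct1[OF *] this]
    have "(\<lambda>m. \<omega> (kp_trunc m u) (kp_trunc m v)) \<longlonglongrightarrow> \<omega> u v" by simp
    moreover have "\<omega> (kp_trunc m u) (kp_trunc m v) = kp_omega (kp_trunc m u) (kp_trunc m v)" for m
      using conjunct2[OF *] kp_omega_finite_support kp_finite_support_trunc by metis
    ultimately show ?thesis using LIMSEQ_unique[OF _ lim] by simp
  qed
  have "kp_form = (THE \<omega>. ?P \<omega>)"
    unfolding kp_form_def norm_topology_kp_qnorm prod_topology_euclidean continuous_map_iff_continuous2 ..
  also have "\<dots> = kp_omega"
    using 1 by (rule the_equality[where P = ?P and a = kp_omega]) (intro ext 2)
  finally show ?thesis .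
qed

text \<open>Nondegeneracy is built in, the norm being a supremum of values of the form.\<close>

lemma kp_omega_eqI:
  assumes "\<And>u. kp_omega u v = kp_omega u w"
  shows "v = w"
proof -
  have "norm (v - w) \<le> 0"
  proof (rule norm_kp_leI)
    fix u :: "'a kalton_peck"
    have "kp_omega (v - w) u = 0"
      unfolding kp_omega_commute[of "v - w"] by (simp add: kp_omega_diff_right assms)
    then show "norm (kp_omega (v - w) u) \<le> 0" by simp
  qed
  then show ?thesis by simp
qed

lemma kp_incl_defect: "kp_quot u = 0 \<Longrightarrow> kp_incl (kp_defect u) = u"
proof -
  assume "kp_quot u = 0"
  moreover have "kp_section 0 = 0"
    by (rule kp_eqI) (simp_all add: kp_fst_section KP_map_def)
  ultimately show ?thesis using kp_decompose[of u] by (metis add.right_neutral)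
qed

text \<open>
  The functional is corrected by one given by the form so as to vanish on the kernel of the
  quotient map, through which it then factors.
\<close>

lemma kp_omega_rep:
  fixes f :: "'k::real_or_complex kalton_peck \<Rightarrow> 'k"
  assumes add: "\<And>u v. f (u + v) = f u + f v" and scale: "\<And>c u. f (kp_scale c u) = c * f u"
    and bound: "\<And>u. norm (f u) \<le> C * norm u"
  shows "\<exists>w. \<forall>u. f u = kp_omega u w"
proof -
  have C: "0 \<le> C"
  proof -
    have "kp_incl (ell2_unit 0 :: 'k ell2) \<noteq> 0"
      by (metis kp_qnorm_incl kp_qnorm_zero norm_ell2_unit zero_neq_one)
    then show ?thesis
      using order_trans[OF norm_ge_zero bound, of "kp_incl (ell2_unit 0)"]
      by (simp add: zero_le_mult_iff)
  qed
  have 1: "norm (f (kp_incl x)) \<le> (C * 2) * norm x" for x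
    using order_trans[OF bound mult_left_mono[OF norm_incl_le C]] by (simp add: mult.assoc)
  obtain h where h: "\<And>x. f (kp_incl x) = ell2_inner x h"
    using ell2_inner_rep[of "\<lambda>x. f (kp_incl x)", OF _ _ 1] by (auto simp: kp_incl_add kp_incl_scale add scale)
  define g where "g u = f u - kp_omega u (kp_section h)" for u
  have g_incl: "g (kp_incl x) = 0" for x
    by (simp add: g_def h kp_omega_incl_left)
  have g_add: "g (u + v) = g u + g v" and g_scale: "g (kp_scale c u) = c * g u" for u v c
    by (simp_all add: g_def add scale kp_omega_add_left kp_omega_scale_left algebra_simps)
  have g_eq: "g u = g v" if "kp_quot u = kp_quot v" for u v
  proof -
    have "g (u - v + v) = g (kp_incl (kp_defect (u - v))) + g v"
      unfolding g_add using that by (simp add: kp_incl_defect kp_quot_diff)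
    then show ?thesis by (simp add: g_incl)
  qed
  have 2: "norm (g (kp_section y)) \<le> (C * 2 + 2 * norm h * 2) * norm y" for y
  proof -
    have "norm (g (kp_section y)) \<le> norm (f (kp_section y)) + norm (kp_omega (kp_section y) (kp_section h))"
      unfolding g_def by (rule norm_triangle_ineq4)
    also have "\<dots> \<le> C * (2 * norm y) + 2 * norm y * norm h"
    proof (rule add_mono)
      show "norm (f (kp_section y)) \<le> C * (2 * norm y)"
        by (rule order_trans[OF bound mult_left_mono[OF norm_section_le C]])
      show "norm (kp_omega (kp_section y) (kp_section h)) \<le> 2 * norm y * norm h"
        using norm_kp_omega_le_qnorm[of "kp_section y" "kp_section h"] by simp
    qed
    also have "\<dots> \<le> (C * 2 + 2 * norm h * 2) * norm y"
      by (simp add: algebra_simps)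
    finally show ?thesis .
  qed
  \<comment> \<open>\<open>kp_section\<close> is not additive, but \<open>g\<close> depends on the
    quotient alone, which makes the composition linear.\<close>
  have "\<exists>z. \<forall>y. g (kp_section y) = ell2_inner y z"
  proof (rule ell2_inner_rep[OF _ _ 2])
    show "g (kp_section (x + y)) = g (kp_section x) + g (kp_section y)" for x y
      unfolding g_add[symmetric] by (rule g_eq) (simp add: kp_quot_add)
    show "g (kp_section (ell2_scale c y)) = c * g (kp_section y)" for c y
      unfolding g_scale[symmetric] by (rule g_eq) (simp add: kp_quot_scale)
  qed
  then obtain z where z: "\<And>y. g (kp_section y) = ell2_inner y z" by blast
  have "f u = kp_omega u (kp_section h - kp_incl z)" for u
  proof -
    have "g u = ell2_inner (kp_quot u) z" unfolding z[symmetric] by (rule g_eq) simp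
    then show ?thesis by (simp add: g_def kp_omega_diff_right kp_omega_incl_right algebra_simps)
  qed
  then show ?thesis by blast
qed

section \<open>Bounded operators and their adjoints\<close>

abbreviation kp_ops :: "('k::real_or_complex kalton_peck \<Rightarrow> 'k kalton_peck) set" where
  "kp_ops \<equiv> bounded_ops kp_scale norm"

lemma kp_opsI:
  assumes "\<And>u v. T (u + v) = T u + T v" "\<And>c u. T (kp_scale c u) = kp_scale c (T u)"
    and "\<And>u. norm (T u) \<le> C * norm u"
  shows "T \<in> kp_ops"
  using assms unfolding bounded_ops_def Vector_Spaces.linear_iff
  by (auto simp: vector_space_kp_scale)

lemma
  assumes "T \<in> kp_ops"
  shows kp_ops_add: "T (u + v) = T u + T v" and kp_ops_scale: "T (kp_scale c u) = kp_scale c (T u)"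
    and kp_ops_bounded_linear: "bounded_linear T"
proof -
  show 1: "T (u + v) = T u + T v" and 2: "T (kp_scale c u) = kp_scale c (T u)" for u v c
    using assms unfolding bounded_ops_def Vector_Spaces.linear_iff by auto
  obtain C where "\<And>u. norm (T u) \<le> C * norm u"
    using assms unfolding bounded_ops_def by auto
  then show "bounded_linear T"
    by (intro bounded_linear_intro[where K = C]) (auto simp: 1 2 scaleR_kalton_peck_def mult.commute)
qed

lemma kp_ops_boundE:
  assumes "T \<in> kp_ops"
  obtains C where "0 < C" "\<And>u. norm (T u) \<le> C * norm u"
  using bounded_linear.pos_bounded[OF kp_ops_bounded_linear[OF assms]] by (auto simp: mult.commute)

lemma kp_ops_comp: "S \<in> kp_ops \<Longrightarrow> T \<in> kp_ops \<Longrightarrow> S \<circ> T \<in> kp_ops"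
proof -
  assume ST: "S \<in> kp_ops" "T \<in> kp_ops"
  then have "bounded_linear (\<lambda>u. S (T u))"
    using bounded_linear_compose[OF kp_ops_bounded_linear kp_ops_bounded_linear] by blast
  then obtain C where "\<And>u. norm (S (T u)) \<le> norm u * C" using bounded_linear.bounded by blast
  then show ?thesis
    by (intro kp_opsI[where C = C]) (simp_all add: ST kp_ops_add kp_ops_scale mult.commute)
qed

lemma kp_ops_plus: "S \<in> kp_ops \<Longrightarrow> T \<in> kp_ops \<Longrightarrow> (\<lambda>u. S u + T u) \<in> kp_ops"
proof -
  assume ST: "S \<in> kp_ops" "T \<in> kp_ops"
  then have "bounded_linear (\<lambda>u. S u + T u)"
    using bounded_linear_add[OF kp_ops_bounded_linear kp_ops_bounded_linear] by blast
  then obtain C where "\<And>u. norm (S u + T u) \<le> norm u * C" using bounded_linear.bounded by blast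
  moreover have "kp_scale c (u + v) = kp_scale c u + kp_scale c v" for c and u v :: "'a kalton_peck"
    by (rule kp_eqI) (simp_all add: algebra_simps)
  ultimately show ?thesis
    by (intro kp_opsI[where C = C]) (simp_all add: ST kp_ops_add kp_ops_scale mult.commute add_ac)
qed

lemma kp_scale_commute: "kp_scale c (kp_scale d u) = kp_scale d (kp_scale c u)"
  by (rule kp_eqI) simp_all

lemma kp_scale_add: "kp_scale c (u + v) = kp_scale c u + kp_scale c v"
  by (rule kp_eqI) (simp_all add: algebra_simps)

lemma kp_ops_smult: "T \<in> kp_ops \<Longrightarrow> (\<lambda>u. kp_scale c (T u)) \<in> kp_ops"
proof -
  assume T: "T \<in> kp_ops"
  obtain C where "0 < C" "\<And>u. norm (T u) \<le> C * norm u" using kp_ops_boundE[OF T] by blast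
  then have "norm (kp_scale c (T u)) \<le> (norm c * C) * norm u" for u
    by (simp add: mult.assoc mult_left_mono)
  then show ?thesis
    by (intro kp_opsI[where C = "norm c * C"])
      (simp_all add: T kp_ops_add kp_ops_scale kp_scale_add kp_scale_commute)
qed

text \<open>\<open>form_adjoint\<close> is a definite description and says nothing until a bounded
  adjoint is known to exist. The representation of functionals provides its values, nondegeneracy
  its linearity, and the norm as a supremum of the form its bound.\<close>

lemma kp_adjoint_exists:
  assumes T: "T \<in> kp_ops"
  shows "\<exists>R\<in>kp_ops. \<forall>u v. kp_omega (T u) v = kp_omega u (R v)"
proof -
  obtain C where C: "0 < C" "\<And>u. norm (T u) \<le> C * norm u" using kp_ops_boundE[OF T] by blast
  have b: "norm (kp_omega (T u) v) \<le> C * norm u * (4 * norm v)" for u v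
  proof -
    have "norm (kp_omega (T u) v) \<le> norm (T u) * kp_qnorm v" by (rule norm_kp_omega_le)
    also have "\<dots> \<le> C * norm u * (4 * norm v)"
      using C by (intro mult_mono kp_qnorm_le) (auto simp: kp_qnorm_nonneg)
    finally show ?thesis .
  qed
  have "\<exists>w. \<forall>u. kp_omega (T u) v = kp_omega u w" for v
    by (rule kp_omega_rep[where C = "C * (4 * norm v)"])
      (use b[of _ v] in \<open>simp_all add: T kp_ops_add kp_ops_scale kp_omega_add_left kp_omega_scale_left mult_ac\<close>)
  then obtain R where R: "\<And>u v. kp_omega (T u) v = kp_omega u (R v)" by metis
  have "R \<in> kp_ops"
  proof (rule kp_opsI)
    show "R (u + v) = R u + R v" for u v
      by (rule kp_omega_eqI) (simp add: kp_omega_add_right flip: R)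
    show "R (kp_scale c u) = kp_scale c (R u)" for c u
      by (rule kp_omega_eqI) (simp add: kp_omega_scale_right flip: R)
    show "norm (R v) \<le> (8 * C) * norm v" for v
    proof (rule norm_kp_leI)
      fix u :: "'a kalton_peck" assume "kp_qnorm u \<le> 1"
      then have u: "norm u \<le> 2" using norm_kp_le_qnorm[of u] by simp
      have "norm (kp_omega (R v) u) = norm (kp_omega (T u) v)"
        unfolding R by (rule norm_kp_omega_commute)
      also have "\<dots> \<le> C * norm u * (4 * norm v)" by (rule b)
      also have "\<dots> \<le> C * 2 * (4 * norm v)"
        using C u by (intro mult_right_mono mult_left_mono) auto
      finally show "norm (kp_omega (R v) u) \<le> (8 * C) * norm v" by simp
    qed
  qed
  with R show ?thesis by blast
qed

definition kp_adj :: "('k::real_or_complex kalton_peck \<Rightarrow> 'k kalton_peck) \<Rightarrow> 'k kalton_peck \<Rightarrow> 'k kalton_peck"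
  where "kp_adj = form_adjoint kp_scale norm kp_omega"

lemma kp_adj_unique:
  assumes "R \<in> kp_ops" "\<And>u v. kp_omega (T u) v = kp_omega u (R v)"
  shows "kp_adj T = R"
  unfolding kp_adj_def form_adjoint_def
proof (rule the_equality)
  show "R \<in> kp_ops \<and> (\<forall>u v. kp_omega (T u) v = kp_omega u (R v))" using assms by blast
  fix R' assume "R' \<in> kp_ops \<and> (\<forall>u v. kp_omega (T u) v = kp_omega u (R' v))"
  then show "R' = R" by (intro ext kp_omega_eqI) (metis assms(2))
qed

lemma
  assumes "T \<in> kp_ops"
  shows kp_adj_ops: "kp_adj T \<in> kp_ops" and kp_omega_adj: "kp_omega (T u) v = kp_omega u (kp_adj T v)"
  using kp_adjoint_exists[OF assms] kp_adj_unique by metis+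

lemma kp_omega_adj': "T \<in> kp_ops \<Longrightarrow> kp_omega (kp_adj T u) v = kp_omega u (T v)"
  by (metis kp_omega_adj kp_omega_commute)

lemma kp_adj_adj: "T \<in> kp_ops \<Longrightarrow> kp_adj (kp_adj T) = T"
  by (rule kp_adj_unique) (simp, rule kp_omega_adj')

lemma kp_adj_comp: "S \<in> kp_ops \<Longrightarrow> T \<in> kp_ops \<Longrightarrow> kp_adj (S \<circ> T) = kp_adj T \<circ> kp_adj S"
proof (rule kp_adj_unique)
  assume S: "S \<in> kp_ops" and T: "T \<in> kp_ops"
  then show "kp_adj T \<circ> kp_adj S \<in> kp_ops" by (intro kp_ops_comp kp_adj_ops)
  show "kp_omega ((S \<circ> T) u) v = kp_omega u ((kp_adj T \<circ> kp_adj S) v)" for u v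
    using kp_omega_adj[OF S, of "T u" v] kp_omega_adj[OF T, of u "kp_adj S v"] by simp
qed

lemma kp_adj_plus: "S \<in> kp_ops \<Longrightarrow> T \<in> kp_ops \<Longrightarrow> kp_adj (\<lambda>u. S u + T u) = (\<lambda>u. kp_adj S u + kp_adj T u)"
proof (rule kp_adj_unique)
  assume S: "S \<in> kp_ops" and T: "T \<in> kp_ops"
  then show "(\<lambda>u. kp_adj S u + kp_adj T u) \<in> kp_ops" by (intro kp_ops_plus kp_adj_ops)
  show "kp_omega (S u + T u) v = kp_omega u (kp_adj S v + kp_adj T v)" for u v
    unfolding kp_omega_add_left kp_omega_add_right kp_omega_adj[OF S] kp_omega_adj[OF T] ..
qed

section \<open>Null sequences and the averaging estimate\<close>

lemma kp_fst_scaleR [simp]: "kp_fst (r *\<^sub>R u) n = of_real r * kp_fst u n"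
  by (simp add: scaleR_kalton_peck_def)

lemma kp_snd_scaleR [simp]: "kp_snd (r *\<^sub>R u) n = of_real r * kp_snd u n"
  by (simp add: scaleR_kalton_peck_def)

lemma kp_quot_sum: "kp_quot (\<Sum>i\<in>I. f i) = (\<Sum>i\<in>I. kp_quot (f i))"
  by (rule linear_sum[OF bounded_linear.linear[OF bounded_linear_kp_quot]])

lemma kp_incl_sum: "kp_incl (\<Sum>i\<in>I. f i) = (\<Sum>i\<in>I. kp_incl (f i))"
  by (rule linear_sum[OF bounded_linear.linear[OF bounded_linear_kp_incl]])

lemma norm_le_norm_incl: "norm x \<le> 4 * norm (kp_incl x)"
  using kp_qnorm_le[of "kp_incl x"] by simp

text \<open>For bounded sequences coordinatewise convergence to 0 is weak convergence to 0. In this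
  form it suits gliding humps and passes through the nonlinear maps \<open>kp_defect\<close> and
  \<open>kp_section\<close>.\<close>

definition ell2_null :: "(nat \<Rightarrow> 'k::real_or_complex ell2) \<Rightarrow> bool" where
  "ell2_null x \<longleftrightarrow> (\<exists>C. \<forall>n. norm (x n) \<le> C) \<and> (\<forall>i. (\<lambda>n. ell2_nth (x n) i) \<longlonglongrightarrow> 0)"

definition kp_null :: "(nat \<Rightarrow> 'k::real_or_complex kalton_peck) \<Rightarrow> bool" where
  "kp_null u \<longleftrightarrow> (\<exists>C. \<forall>n. norm (u n) \<le> C) \<and>
     (\<forall>i. (\<lambda>n. kp_fst (u n) i) \<longlonglongrightarrow> 0) \<and> (\<forall>i. (\<lambda>n. kp_snd (u n) i) \<longlonglongrightarrow> 0)"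

lemma kp_null_boundE:
  assumes "kp_null u"
  obtains C where "0 < C" "\<And>n. norm (u n) \<le> C"
proof -
  obtain C where C: "\<And>n. norm (u n) \<le> C" using assms unfolding kp_null_def by blast
  have "norm (u n) \<le> \<bar>C\<bar> + 1" for n using C[of n] by linarith
  then show ?thesis by (intro that[of "\<bar>C\<bar> + 1"]) auto
qed

lemma ell2_null_boundE:
  assumes "ell2_null u"
  obtains C where "0 < C" "\<And>n. norm (u n) \<le> C"
proof -
  obtain C where C: "\<And>n. norm (u n) \<le> C" using assms unfolding ell2_null_def by blast
  have "norm (u n) \<le> \<bar>C\<bar> + 1" for n using C[of n] by linarith
  then show ?thesis by (intro that[of "\<bar>C\<bar> + 1"]) auto
qed

lemma kp_null_filterlim:
  assumes "kp_null u" "filterlim r at_top sequentially"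
  shows "kp_null (\<lambda>n. u (r n))"
  using assms(1) filterlim_compose[OF _ assms(2)] unfolding kp_null_def by blast

lemma ell2_null_filterlim:
  assumes "ell2_null u" "filterlim r at_top sequentially"
  shows "ell2_null (\<lambda>n. u (r n))"
  using assms(1) filterlim_compose[OF _ assms(2)] unfolding ell2_null_def by blast

lemma kp_null_quot: "kp_null u \<Longrightarrow> ell2_null (\<lambda>n. kp_quot (u n))"
proof -
  assume u: "kp_null u"
  obtain C where C: "0 < C" "\<And>n. norm (u n) \<le> C" using kp_null_boundE[OF u] by blast
  have "norm (kp_quot (u n)) \<le> C" for n
    using norm_quot_le[of "u n"] C(2)[of n] by linarith
  with u show ?thesis unfolding kp_null_def ell2_null_def kp_snd_eq by blast
qed

lemma kp_null_incl: "ell2_null x \<Longrightarrow> kp_null (\<lambda>n. kp_incl (x n))"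
proof -
  assume x: "ell2_null x"
  obtain C where C: "0 < C" "\<And>n. norm (x n) \<le> C" using ell2_null_boundE[OF x] by blast
  have "norm (kp_incl (x n)) \<le> 2 * C" for n
    using norm_incl_le[of "x n"] C(2)[of n] by linarith
  with x show ?thesis unfolding kp_null_def ell2_null_def by auto
qed

text \<open>If \<open>s\<close> is the modulus of the coordinate and \<open>C\<close> bounds the
  norms, \<open>\<Omega>\<close> produces at most s ln (C / s), and t ln t tends to 0 for t = s /
  C.\<close>

lemma tendsto_KP_map_zero:
  assumes b: "ell2_null b"
  shows "(\<lambda>n. KP_map (ell2_nth (b n)) i) \<longlonglongrightarrow> 0"
proof -
  obtain C where C: "0 < C" "\<And>n. norm (b n) \<le> C" using ell2_null_boundE[OF b] by blast
  have le: "norm (KP_map (ell2_nth (b n)) i) \<le> 2 * C * sqrt (norm (ell2_nth (b n) i) / C)" for n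
  proof (cases "ell2_nth (b n) i = 0")
    case False
    let ?s = "norm (ell2_nth (b n) i)"
    have s: "0 < ?s" "?s \<le> norm (b n)" using False norm_ell2_nth_le[of "b n" i] by auto
    have "norm (KP_map (ell2_nth (b n)) i) = ?s * \<bar>ln (norm (b n) / ?s)\<bar>"
      using False by (simp add: KP_map_def norm_mult l2_norm_ell2_nth)
    also have "\<bar>ln (norm (b n) / ?s)\<bar> \<le> \<bar>ln (?s / C)\<bar>"
    proof -
      have "0 \<le> ln (norm (b n) / ?s)" using s by (intro ln_ge_zero) simp
      moreover have "ln (norm (b n) / ?s) \<le> ln (C / ?s)"
        using s C(2)[of n] by (intro ln_mono divide_right_mono divide_pos_pos) auto
      moreover have "ln (C / ?s) = - ln (?s / C)" using s C(1) by (simp add: ln_divide_pos)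
      ultimately show ?thesis by linarith
    qed
    then have "?s * \<bar>ln (norm (b n) / ?s)\<bar> \<le> C * (?s / C * \<bar>ln (?s / C)\<bar>)"
      using s C by (simp add: mult_left_mono)
    also have "\<dots> \<le> C * (2 * sqrt (?s / C))"
      using s C order_trans[OF s(2) C(2)] by (intro mult_left_mono mult_ln_le_sqrt) auto
    finally show ?thesis by simp
  qed (use C in \<open>simp add: KP_map_def\<close>)
  have "(\<lambda>n. 2 * C * sqrt (norm (ell2_nth (b n) i) / C)) \<longlonglongrightarrow> 2 * C * sqrt (norm (0::'a) / C)"
    using b C unfolding ell2_null_def by (intro tendsto_intros) auto
  then have "(\<lambda>n. 2 * C * sqrt (norm (ell2_nth (b n) i) / C)) \<longlonglongrightarrow> 0" by simp
  then show ?thesis by (rule Lim_null_comparison[OF always_eventually[OF allI[OF le]]])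
qed

lemma kp_null_section:
  assumes b: "ell2_null b"
  shows "kp_null (\<lambda>n. kp_section (b n))"
proof -
  obtain C where C: "0 < C" "\<And>n. norm (b n) \<le> C" using ell2_null_boundE[OF b] by blast
  have "norm (kp_section (b n)) \<le> 2 * C" for n
    using norm_section_le[of "b n"] C(2)[of n] by linarith
  with b tendsto_KP_map_zero[OF b] show ?thesis
    unfolding kp_null_def ell2_null_def by (auto simp: kp_fst_section)
qed

lemma kp_null_defect:
  assumes u: "kp_null u"
  shows "ell2_null (\<lambda>n. kp_defect (u n))"
proof -
  obtain C where C: "0 < C" "\<And>n. norm (u n) \<le> C" using kp_null_boundE[OF u] by blast
  have "norm (kp_defect (u n)) \<le> 3 * C" for n
    using norm_defect_le[of "u n"] C(2)[of n] by linarith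
  moreover have "(\<lambda>n. ell2_nth (kp_defect (u n)) i) \<longlonglongrightarrow> 0" for i
  proof -
    have "(\<lambda>n. kp_fst (u n) i - KP_map (ell2_nth (kp_quot (u n))) i) \<longlonglongrightarrow> 0 - 0"
      using u by (intro tendsto_diff tendsto_KP_map_zero kp_null_quot) (simp_all add: kp_null_def)
    then show ?thesis by (simp add: kp_fst_eq)
  qed
  ultimately show ?thesis unfolding ell2_null_def by blast
qed

lemma tendsto_kp_scale_zero:
  assumes "c \<longlonglongrightarrow> 0"
  shows "(\<lambda>n. kp_scale (c n) v) \<longlonglongrightarrow> 0"
proof (rule tendsto_norm_zero_cancel)
  have "(\<lambda>n. norm (c n) * norm v) \<longlonglongrightarrow> norm (0::'a) * norm v"
    using assms by (intro tendsto_intros)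
  then show "(\<lambda>n. norm (kp_scale (c n) v)) \<longlonglongrightarrow> 0" by simp
qed

lemma kp_null_trunc:
  assumes "kp_null u"
  shows "(\<lambda>n. kp_trunc m (u n)) \<longlonglongrightarrow> 0"
  unfolding kp_trunc_def using assms unfolding kp_null_def
  by (auto intro!: tendsto_null_sum tendsto_add_zero tendsto_kp_scale_zero)

lemma kp_omega_trunc: "kp_omega u (kp_trunc m v) = kp_omega (kp_trunc m u) v"
  unfolding kp_omega_def by (intro suminf_cong) (simp add: kp_fst_trunc kp_snd_trunc)

text \<open>Null sequences are weakly null with respect to the form: up to a remainder of small norm
  \<open>w\<close> is a truncation, and a truncation sees only finitely many coordinates.\<close>

lemma kp_null_omega:
  assumes u: "kp_null u"
  shows "(\<lambda>n. kp_omega (u n) w) \<longlonglongrightarrow> 0"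
proof (rule LIMSEQ_I)
  fix e :: real assume e: "0 < e"
  obtain C where C: "0 < C" "\<And>n. norm (u n) \<le> C" using kp_null_boundE[OF u] by blast
  have "(\<lambda>m. 4 * C * norm (w - kp_trunc m w)) \<longlonglongrightarrow> 4 * C * norm (w - w)"
    by (intro tendsto_intros tendsto_kp_trunc)
  then have "eventually (\<lambda>m. 4 * C * norm (w - kp_trunc m w) < e / 2) sequentially"
    using e by (intro order_tendstoD) auto
  then obtain m where m: "4 * C * norm (w - kp_trunc m w) < e / 2"
    by (auto simp: eventually_sequentially)
  have "(\<lambda>n. kp_omega (kp_trunc m (u n)) w) \<longlonglongrightarrow> kp_omega 0 w"
    by (intro bounded_bilinear.tendsto[OF bounded_bilinear_kp_omega] kp_null_trunc u tendsto_const)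
  then have "(\<lambda>n. kp_omega (kp_trunc m (u n)) w) \<longlonglongrightarrow> 0" by simp
  from LIMSEQ_D[OF this, of "e / 2"] e
  obtain M where M: "\<And>n. n \<ge> M \<Longrightarrow> norm (kp_omega (kp_trunc m (u n)) w) < e / 2"
    by auto
  show "\<exists>M. \<forall>n\<ge>M. norm (kp_omega (u n) w - 0) < e"
  proof (intro exI[of _ M] allI impI)
    fix n assume n: "n \<ge> M"
    have "kp_omega (u n) w = kp_omega (kp_trunc m (u n)) w + kp_omega (u n) (w - kp_trunc m w)"
      by (simp add: kp_omega_diff_right kp_omega_trunc)
    then have "norm (kp_omega (u n) w) \<le> norm (kp_omega (kp_trunc m (u n)) w)
        + norm (kp_omega (u n) (w - kp_trunc m w))"
      by (metis norm_triangle_ineq)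
    also have "norm (kp_omega (u n) (w - kp_trunc m w)) \<le> 4 * norm (u n) * norm (w - kp_trunc m w)"
      by (rule norm_kp_omega_le4)
    also have "\<dots> \<le> 4 * C * norm (w - kp_trunc m w)"
      using C(2)[of n] by (intro mult_right_mono) auto
    finally show "norm (kp_omega (u n) w - 0) < e" using m M[OF n] by simp
  qed
qed

lemma kp_omega_incl_unit: "kp_omega v (kp_incl (ell2_unit i)) = - kp_snd v i"
  unfolding kp_omega_incl_right kp_snd_eq
  by (subst ell2_inner_commute) (simp add: ell2_inner_unit_left scalar_cnj_cnj)

lemma kp_omega_section_unit: "kp_omega v (kp_section (ell2_unit i)) = kp_fst v i"
proof -
  have "kp_omega v (kp_section (ell2_unit i)) = (\<Sum>n. if n = i then kp_fst v n else 0)"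
    unfolding kp_omega_def by (intro suminf_cong) (auto simp: ell2_nth_unit)
  also have "\<dots> = kp_fst v i"
    using sums_single[of i "kp_fst v"] by (simp add: sums_iff eq_commute)
  finally show ?thesis .
qed

text \<open>The coordinates of \<open>T (u n)\<close> are, up to sign, its pairings with fixed
  vectors; the adjoint moves \<open>T\<close> to those vectors, and weak nullity of \<open>u\<close>
  applies.\<close>

lemma kp_null_ops:
  assumes T: "T \<in> kp_ops" and u: "kp_null u"
  shows "kp_null (\<lambda>n. T (u n))"
  unfolding kp_null_def
proof (intro conjI allI)
  obtain C where C: "0 < C" "\<And>n. norm (u n) \<le> C" using kp_null_boundE[OF u] by blast
  obtain B where B: "0 < B" "\<And>u. norm (T u) \<le> B * norm u" using kp_ops_boundE[OF T] by blast
  have "norm (T (u n)) \<le> B * C" for n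
    using B(2)[of "u n"] mult_left_mono[OF C(2)[of n], of B] B(1) by linarith
  then show "\<exists>C. \<forall>n. norm (T (u n)) \<le> C" by blast
  fix i
  show "(\<lambda>n. kp_fst (T (u n)) i) \<longlonglongrightarrow> 0"
    using kp_null_omega[OF u, of "kp_adj T (kp_section (ell2_unit i))"]
    by (simp only: kp_omega_adj[OF T, symmetric] kp_omega_section_unit)
  show "(\<lambda>n. kp_snd (T (u n)) i) \<longlonglongrightarrow> 0"
    using tendsto_minus[OF kp_null_omega[OF u, of "kp_adj T (kp_incl (ell2_unit i))"]]
    by (simp only: kp_omega_adj[OF T, symmetric] kp_omega_incl_unit minus_minus minus_zero)
qed

lemma ell2_null_inner:
  assumes "ell2_null x"
  shows "(\<lambda>n. ell2_inner (x n) w) \<longlonglongrightarrow> 0"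
  using kp_null_omega[OF kp_null_incl[OF assms], of "kp_section w"] by (simp add: kp_omega_incl_left)

section \<open>Averages of disjoint and of almost disjoint vectors\<close>

lemma ell2_inner_disjoint:
  assumes "\<And>n. ell2_nth x n = 0 \<or> ell2_nth y n = 0"
  shows "ell2_inner x y = 0"
proof -
  have "ell2_nth x n * scalar_cnj (ell2_nth y n) = 0" for n
    using assms[of n] by auto
  then show ?thesis unfolding ell2_inner_eq by (simp only: suminf_zero)
qed

lemma power2_norm_sum_disjoint:
  assumes I: "finite I"
    and disj: "\<And>i j n. i \<in> I \<Longrightarrow> j \<in> I \<Longrightarrow> i \<noteq> j \<Longrightarrow> ell2_nth (d i) n = 0 \<or> ell2_nth (d j) n = 0"
  shows "(norm (\<Sum>i\<in>I. d i))\<^sup>2 = (\<Sum>i\<in>I. (norm (d i))\<^sup>2)"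
proof -
  have "(of_real ((norm (\<Sum>i\<in>I. d i))\<^sup>2) :: 'b) = (\<Sum>i\<in>I. \<Sum>j\<in>I. ell2_inner (d i) (d j))"
    unfolding ell2_inner_self[symmetric] ell2_inner_sum_right ell2_inner_sum_left by (rule sum.swap)
  also have "\<dots> = (\<Sum>i\<in>I. \<Sum>j\<in>I. if j = i then ell2_inner (d i) (d i) else 0)"
  proof (intro sum.cong refl)
    fix i j assume "i \<in> I" "j \<in> I"
    then show "ell2_inner (d i) (d j) = (if j = i then ell2_inner (d i) (d i) else 0)"
      using ell2_inner_disjoint[of "d i" "d j"] disj[of i j] by auto
  qed
  also have "\<dots> = (\<Sum>i\<in>I. of_real ((norm (d i))\<^sup>2))"
    using I by (intro sum.cong refl) (simp add: ell2_inner_self)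
  also have "\<dots> = of_real (\<Sum>i\<in>I. (norm (d i))\<^sup>2)" by simp
  finally show ?thesis by (simp only: of_real_eq_iff)
qed

lemma norm_average_disjoint_le:
  assumes I: "finite I" "I \<noteq> {}"
    and disj: "\<And>i j n. i \<in> I \<Longrightarrow> j \<in> I \<Longrightarrow> i \<noteq> j \<Longrightarrow> ell2_nth (d i) n = 0 \<or> ell2_nth (d j) n = 0"
    and le: "\<And>i. i \<in> I \<Longrightarrow> norm (d i) \<le> B"
  shows "norm ((1 / sqrt (card I)) *\<^sub>R (\<Sum>i\<in>I. d i)) \<le> B"
proof -
  have N: "0 < card I" using I by (simp add: card_gt_0_iff)
  obtain i where "i \<in> I" using I by blast
  then have B: "0 \<le> B" using le[of i] norm_ge_zero order_trans by blast
  have "(norm (\<Sum>i\<in>I. d i))\<^sup>2 = (\<Sum>i\<in>I. (norm (d i))\<^sup>2)"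
    by (rule power2_norm_sum_disjoint[OF I(1) disj])
  also have "\<dots> \<le> (\<Sum>i\<in>I. B\<^sup>2)"
    by (intro sum_mono power_mono le norm_ge_zero)
  also have "\<dots> = (sqrt (card I) * B)\<^sup>2" by (simp add: power_mult_distrib)
  finally have "norm (\<Sum>i\<in>I. d i) \<le> sqrt (card I) * B"
    by (rule power2_le_imp_le) (use B in simp)
  then show ?thesis using N by (simp add: field_simps)
qed

text \<open>
  The upper \<open>\<ell>\<^sub>2\<close>-estimate for disjoint vectors fails in the Kalton--Peck space exactly by the
  logarithmic term: for normalised averages of \<open>N\<close> disjoint vectors it is \<open>ln N / 2\<close> times the
  image in the quotient, placed in the kernel.
\<close>

lemma kp_average_disjoint_le:
  fixes p :: "nat \<Rightarrow> 'k::real_or_complex kalton_peck"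
  assumes I: "finite I" "I \<noteq> {}"
    and disj: "\<And>i j n. i \<in> I \<Longrightarrow> j \<in> I \<Longrightarrow> i \<noteq> j \<Longrightarrow>
      kp_fst (p i) n = 0 \<and> kp_snd (p i) n = 0 \<or> kp_fst (p j) n = 0 \<and> kp_snd (p j) n = 0"
    and le: "\<And>i. i \<in> I \<Longrightarrow> kp_qnorm (p i) \<le> 1"
  defines "v \<equiv> (1 / sqrt (card I)) *\<^sub>R (\<Sum>i\<in>I. p i)"
  shows "kp_qnorm (v + (ln (card I) / 2) *\<^sub>R kp_incl (kp_quot v)) \<le> 6"
proof -
  define c where "c = 1 / sqrt (card I)"
  define L where "L = ln (card I) / 2"
  define y where "y i = kp_quot (p i)" for i
  define Y where "Y = kp_quot v"
  define b where "b i = kp_defect (p i)" for i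
  have N: "0 < card I" using I by (simp add: card_gt_0_iff)
  have c: "0 < c" and lnc: "ln c = - L"
    using N by (simp_all add: c_def L_def ln_divide_pos ln_sqrt)
  have v: "v = c *\<^sub>R (\<Sum>i\<in>I. p i)" by (simp add: v_def c_def)
  have Y: "Y = c *\<^sub>R (\<Sum>i\<in>I. y i)"
    by (simp add: Y_def v y_def kp_quot_scaleR kp_quot_sum)
  have y1: "norm (y i) \<le> 1" and b1: "norm (b i) \<le> 1" if "i \<in> I" for i
    using le[OF that] norm_ge_zero[of "y i"] norm_ge_zero[of "b i"] unfolding kp_qnorm_eq y_def b_def
    by linarith+
  have ydisj: "ell2_nth (y i) n = 0 \<or> ell2_nth (y j) n = 0" if "i \<in> I" "j \<in> I" "i \<noteq> j" for i j n
    using disj[OF that, of n] by (auto simp: y_def kp_snd_eq)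
  have bz: "ell2_nth (b i) n = 0" if "kp_fst (p i) n = 0" "kp_snd (p i) n = 0" for i n
    using that kp_fst_eq[of "p i" n] unfolding b_def y_def kp_snd_eq by (simp add: KP_map_def)
  have bdisj: "ell2_nth (b i) n = 0 \<or> ell2_nth (b j) n = 0" if "i \<in> I" "j \<in> I" "i \<noteq> j" for i j n
    using disj[OF that, of n] bz by blast
  define z where "z = v + L *\<^sub>R kp_incl Y"
  have qz: "kp_quot z = Y"
    by (simp add: z_def kp_quot_add kp_quot_scaleR Y_def)
  \<comment> \<open>On the support of \<open>p j\<close> the average is \<open>c\<close> times
    \<open>p j\<close>, so \<open>\<Omega>\<close> of the average differs there by the logarithm of
    \<open>c\<close>, that is by \<open>L\<close>, which the correction cancels. What remains beside
    the averaged defects are vectors multiplied by the logarithm of their own norm.\<close>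
  have dz: "kp_defect z = c *\<^sub>R (\<Sum>i\<in>I. b i) + c *\<^sub>R (\<Sum>i\<in>I. ln (norm (y i)) *\<^sub>R y i) - ln (norm Y) *\<^sub>R Y"
    (is "_ = ?d")
  proof (rule ell2_eqI)
    fix n
    have l: "ell2_nth (kp_defect z) n =
        of_real c * (\<Sum>i\<in>I. kp_fst (p i) n) + of_real L * ell2_nth Y n - KP_map (ell2_nth Y) n"
      using kp_fst_eq[of z n] unfolding qz by (simp add: z_def v kp_fst_sum algebra_simps)
    have r: "ell2_nth ?d n = of_real c * (\<Sum>i\<in>I. ell2_nth (b i) n)
        + of_real c * (\<Sum>i\<in>I. of_real (ln (norm (y i))) * ell2_nth (y i) n) - of_real (ln (norm Y)) * ell2_nth Y n"
      by (simp add: ell2_nth_sum)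
    have Yn: "ell2_nth Y n = of_real c * (\<Sum>i\<in>I. ell2_nth (y i) n)"
      by (simp add: Y ell2_nth_sum)
    show "ell2_nth (kp_defect z) n = ell2_nth ?d n"
    proof (cases "\<exists>j\<in>I. kp_fst (p j) n \<noteq> 0 \<or> kp_snd (p j) n \<noteq> 0")
      case False
      then have 1: "(\<Sum>i\<in>I. kp_fst (p i) n) = 0" "(\<Sum>i\<in>I. ell2_nth (y i) n) = 0"
        "(\<Sum>i\<in>I. of_real (ln (norm (y i))) * ell2_nth (y i) n) = 0"
        by (auto intro!: sum.neutral simp: y_def kp_snd_eq)
      have 2: "(\<Sum>i\<in>I. ell2_nth (b i) n) = 0"
        using False by (intro sum.neutral ballI bz) auto
      show ?thesis unfolding l r Yn 1 2 by (simp add: KP_map_def Yn 1)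
    next
      case True
      then obtain j where j: "j \<in> I" "kp_fst (p j) n \<noteq> 0 \<or> kp_snd (p j) n \<noteq> 0" by blast
      then have o: "kp_fst (p i) n = 0" "kp_snd (p i) n = 0" if "i \<in> I - {j}" for i
        using disj[of i j n] that by auto
      have single: "(\<Sum>i\<in>I. f i) = f j" if "\<And>i. i \<in> I - {j} \<Longrightarrow> f i = 0" for f :: "nat \<Rightarrow> 'k"
        using j(1) I(1) that by (simp add: sum.remove[of I j f])
      have oy: "ell2_nth (y i) n = 0" if "i \<in> I - {j}" for i
        using o(2)[OF that] by (simp add: y_def kp_snd_eq)
      have ob: "ell2_nth (b i) n = 0" if "i \<in> I - {j}" for i
        by (rule bz[OF o[OF that]])
      have s: "(\<Sum>i\<in>I. kp_fst (p i) n) = kp_fst (p j) n" "(\<Sum>i\<in>I. ell2_nth (y i) n) = ell2_nth (y j) n"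
        "(\<Sum>i\<in>I. of_real (ln (norm (y i))) * ell2_nth (y i) n) = of_real (ln (norm (y j))) * ell2_nth (y j) n"
        "(\<Sum>i\<in>I. ell2_nth (b i) n) = ell2_nth (b j) n"
        by (rule single; simp add: o oy ob)+
      have f: "kp_fst (p j) n = ell2_nth (b j) n + KP_map (ell2_nth (y j)) n"
        by (simp add: kp_fst_eq b_def y_def)
      show ?thesis
      proof (cases "ell2_nth (y j) n = 0")
        case True
        then show ?thesis unfolding l r Yn s f by (simp add: KP_map_def Yn s)
      next
        case False
        have "ln (norm (ell2_nth Y n)) = ln (norm (ell2_nth (y j) n)) - L"
          using False c unfolding Yn s norm_mult norm_of_real by (simp add: ln_mult_pos lnc)
        then have KY: "KP_map (ell2_nth Y) n =
            ell2_nth Y n * of_real (ln (norm Y)) - ell2_nth Y n * of_real (ln (norm (ell2_nth (y j) n)) - L)"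
          by (simp add: KP_map_eq l2_norm_ell2_nth)
        show ?thesis unfolding l r KY unfolding Yn s f
          by (simp add: KP_map_eq l2_norm_ell2_nth algebra_simps)
      qed
    qed
  qed
  have tln: "\<bar>ln (norm x)\<bar> * norm x \<le> 2" if "norm x \<le> 1" for x :: "'k ell2"
  proof -
    have "norm x * \<bar>ln (norm x)\<bar> \<le> 2 * sqrt (norm x)" using that by (intro mult_ln_le_sqrt) auto
    moreover have "sqrt (norm x) \<le> 1" using that by simp
    ultimately have "norm x * \<bar>ln (norm x)\<bar> \<le> 2" by linarith
    then show ?thesis by (simp only: mult.commute)
  qed
  have nY: "norm Y \<le> 1"
    unfolding Y c_def by (rule norm_average_disjoint_le[OF I ydisj y1])
  have "norm (kp_defect z) \<le> norm (c *\<^sub>R (\<Sum>i\<in>I. b i)) + norm (c *\<^sub>R (\<Sum>i\<in>I. ln (norm (y i)) *\<^sub>R y i)) + norm (ln (norm Y) *\<^sub>R Y)"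
    unfolding dz by (intro order_trans[OF norm_triangle_ineq4] add_mono order_refl norm_triangle_ineq)
  \<comment> \<open>Together with the bound 1 for \<open>norm Y\<close> this is the 6 of the
    statement; the twos bound t \<bar>ln t\<bar> for t at most 1.\<close>
  also have "\<dots> \<le> 1 + 2 + 2"
  proof (intro add_mono)
    show "norm (c *\<^sub>R (\<Sum>i\<in>I. b i)) \<le> 1"
      unfolding c_def by (rule norm_average_disjoint_le[OF I bdisj b1])
    show "norm (c *\<^sub>R (\<Sum>i\<in>I. ln (norm (y i)) *\<^sub>R y i)) \<le> 2"
      unfolding c_def using ydisj tln[OF y1] by (intro norm_average_disjoint_le[OF I]) auto
    show "norm (ln (norm Y) *\<^sub>R Y) \<le> 2"
      using tln[OF nY] by simp
  qed
  finally have "kp_qnorm z \<le> 6"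
    unfolding kp_qnorm_eq qz using nY by simp
  then show ?thesis by (simp add: z_def L_def Y_def)
qed

text \<open>The factor normalises in l2. The window is indexed by its start, so that for fixed N the
  averages again form a null sequence.\<close>

definition kp_average :: "nat \<Rightarrow> (nat \<Rightarrow> 'k::real_or_complex kalton_peck) \<Rightarrow> nat \<Rightarrow> 'k kalton_peck" where
  "kp_average N u K = (1 / sqrt N) *\<^sub>R (\<Sum>k\<in>{K..<K + N}. u k)"

text \<open>For an average of N almost disjoint vectors this is the part that stays bounded as N
  grows.\<close>

definition kp_log_corrected :: "nat \<Rightarrow> 'k::real_or_complex kalton_peck \<Rightarrow> 'k kalton_peck" where
  "kp_log_corrected N v = v + (ln N / 2) *\<^sub>R kp_incl (kp_quot v)"

text \<open>Gliding hump, with the same blocks for two null sequences.\<close>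

lemma kp_null_blocks:
  fixes u s :: "nat \<Rightarrow> 'k::real_or_complex kalton_peck"
  assumes u: "kp_null u" and s: "kp_null s" and e: "0 < e"
  obtains r c :: "nat \<Rightarrow> nat" where "strict_mono r" "mono c"
    "\<And>k. norm (u (r k) - (kp_trunc (c (Suc k)) (u (r k)) - kp_trunc (c k) (u (r k)))) < e"
    "\<And>k. norm (s (r k) - (kp_trunc (c (Suc k)) (s (r k)) - kp_trunc (c k) (s (r k)))) < e"
proof -
  have tail: "\<exists>M. \<forall>m\<ge>M. norm (v - kp_trunc m v) < e / 2" for v :: "'k kalton_peck"
  proof -
    have "(\<lambda>m. norm (v - kp_trunc m v)) \<longlonglongrightarrow> norm (v - v)"
      by (intro tendsto_intros tendsto_kp_trunc)
    then have "eventually (\<lambda>m. norm (v - kp_trunc m v) < e / 2) sequentially"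
      using e by (intro order_tendstoD) auto
    then show ?thesis by (simp add: eventually_sequentially)
  qed
  have "\<exists>M. \<forall>m\<ge>M. norm (u n - kp_trunc m (u n)) < e / 2 \<and> norm (s n - kp_trunc m (s n)) < e / 2" for n
  proof -
    obtain M1 M2 where "\<forall>m\<ge>M1. norm (u n - kp_trunc m (u n)) < e / 2"
      "\<forall>m\<ge>M2. norm (s n - kp_trunc m (s n)) < e / 2"
      using tail by meson
    then show ?thesis by (intro exI[of _ "max M1 M2"]) auto
  qed
  then obtain M where M: "\<And>n m. m \<ge> M n \<Longrightarrow> norm (u n - kp_trunc m (u n)) < e / 2"
    "\<And>n m. m \<ge> M n \<Longrightarrow> norm (s n - kp_trunc m (s n)) < e / 2"
    by metis
  have head: "\<exists>B. \<forall>n\<ge>B. norm (kp_trunc m (v n)) < e / 2" if "kp_null v" for m and v :: "nat \<Rightarrow> 'k kalton_peck"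
    using LIMSEQ_D[OF kp_null_trunc[OF that], of "e / 2" m] e by auto
  have "\<exists>B. \<forall>n\<ge>B. norm (kp_trunc m (u n)) < e / 2 \<and> norm (kp_trunc m (s n)) < e / 2" for m
  proof -
    obtain M1 M2 where "\<forall>n\<ge>M1. norm (kp_trunc m (u n)) < e / 2" "\<forall>n\<ge>M2. norm (kp_trunc m (s n)) < e / 2"
      using head[OF u] head[OF s] by meson
    then show ?thesis by (intro exI[of _ "max M1 M2"]) auto
  qed
  then obtain B where B: "\<And>m n. n \<ge> B m \<Longrightarrow> norm (kp_trunc m (u n)) < e / 2"
    "\<And>m n. n \<ge> B m \<Longrightarrow> norm (kp_trunc m (s n)) < e / 2"
    by metis
  \<comment> \<open>Sums turn the cutoffs \<open>M\<close> into a monotone sequence that dominates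
    them.\<close>
  define C where "C n = (\<Sum>k\<le>n. M k)" for n
  have CM: "M n \<le> C n" for n unfolding C_def by (rule member_le_sum) auto
  have Cmono: "C m \<le> C n" if "m \<le> n" for m n
    unfolding C_def using that by (intro sum_mono2) auto
  \<comment> \<open>The next index lies beyond the last one, and so far out that its vectors are
    small before the last cutoff.\<close>
  define r where "r = rec_nat 0 (\<lambda>_ a. max (Suc a) (B (C a)))"
  have r0: "r 0 = 0" and rS: "r (Suc k) = max (Suc (r k)) (B (C (r k)))" for k
    by (simp_all add: r_def)
  \<comment> \<open>Block k extends from the cutoff of the preceding index to the cutoff of its own;
    the shift lets the first block start at 0.\<close>
  define c where "c k = (case k of 0 \<Rightarrow> 0 | Suc j \<Rightarrow> C (r j))" for k
  have c0: "c 0 = 0" and cS: "c (Suc k) = C (r k)" for k by (simp_all add: c_def)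
  have "r k < r (Suc k)" for k by (simp add: rS less_max_iff_disj)
  then have sr: "strict_mono r" by (rule strict_mono_Suc_iff[THEN iffD2, OF allI])
  have "c k \<le> c (Suc k)" for k
  proof (cases k)
    case (Suc j)
    have "r j \<le> r (Suc j)" by (simp add: rS)
    then show ?thesis unfolding Suc cS by (rule Cmono)
  qed (simp add: c0)
  then have mc: "mono c" by (rule mono_iff_le_Suc[THEN iffD2, OF allI])
  have bound: "norm (v (r k) - (kp_trunc (c (Suc k)) (v (r k)) - kp_trunc (c k) (v (r k)))) < e"
    if tailv: "\<And>n m. m \<ge> M n \<Longrightarrow> norm (v n - kp_trunc m (v n)) < e / 2"
      and headv: "\<And>m n. n \<ge> B m \<Longrightarrow> norm (kp_trunc m (v n)) < e / 2"
    for k and v :: "nat \<Rightarrow> 'k kalton_peck"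
  proof -
    have h: "norm (kp_trunc (c k) (v (r k))) < e / 2"
    proof (cases k)
      case 0
      have "kp_trunc 0 w = 0" for w :: "'k kalton_peck" by (simp add: kp_trunc_def)
      then show ?thesis using e 0 by (simp add: c0)
    next
      case (Suc j)
      then show ?thesis by (simp only: cS) (rule headv, simp add: rS)
    qed
    have "v (r k) - (kp_trunc (c (Suc k)) (v (r k)) - kp_trunc (c k) (v (r k)))
        = (v (r k) - kp_trunc (c (Suc k)) (v (r k))) + kp_trunc (c k) (v (r k))" by simp
    then have "norm (v (r k) - (kp_trunc (c (Suc k)) (v (r k)) - kp_trunc (c k) (v (r k))))
        \<le> norm (v (r k) - kp_trunc (c (Suc k)) (v (r k))) + norm (kp_trunc (c k) (v (r k)))"
      by (metis norm_triangle_ineq)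
    also have "\<dots> < e / 2 + e / 2"
      using tailv[of "r k" "c (Suc k)"] CM h by (intro add_strict_mono) (auto simp: cS)
    finally show ?thesis by simp
  qed
  show ?thesis
    by (rule that[OF sr mc]) (intro bound M B; assumption)+
qed

text \<open>Passing to the blocks \<open>p\<close> makes the supports disjoint. The blocks have norm
  at most 2 C and quasi-norm at most 8 C; after division by 8 C the corrected average has quasi-norm
  at most 6, hence norm at most 12. This gives 96 C, and \<open>e\<close> is so small that the
  passage costs one further C in spite of the factor ln N. In the quotient Pythagoras applies
  without a logarithm; an error \<open>e\<close> arises for each vector and
  \<open>sqrt N * e\<close> for the average.\<close>

lemma kp_average_block_bounds:
  fixes u :: "nat \<Rightarrow> 'k::real_or_complex kalton_peck"
  assumes mc: "mono c" and N: "0 < N" and C: "0 < C" "\<And>k. norm (u k) \<le> C"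
    and e: "sqrt N * e * (1 + ln N) \<le> C" "e \<le> C"
    and near: "\<And>k. norm (u k - (kp_trunc (c (Suc k)) (u k) - kp_trunc (c k) (u k))) < e"
  shows "norm (kp_log_corrected N (kp_average N u K)) \<le> 97 * C"
    and "(\<And>k. d \<le> norm (kp_quot (u k))) \<Longrightarrow> e \<le> d \<Longrightarrow>
      d - (1 + sqrt N) * e \<le> norm (kp_quot (kp_average N u K))"
proof -
  define p where "p k = kp_trunc (c (Suc k)) (u k) - kp_trunc (c k) (u k)" for k
  let ?I = "{K..<K + N}"
  have e0: "0 < e" using near[of 0] norm_ge_zero order_le_less_trans by blast
  have I: "finite ?I" "?I \<noteq> {}" "card ?I = N" using N by auto
  have zero: "kp_fst (p i) n = 0 \<and> kp_snd (p i) n = 0" if "n < c i \<or> c (Suc i) \<le> n" for i n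
    using that monoD[OF mc, of i "Suc i"] by (auto simp: p_def kp_fst_trunc kp_snd_trunc)
  have disj: "kp_fst (p i) n = 0 \<and> kp_snd (p i) n = 0 \<or> kp_fst (p j) n = 0 \<and> kp_snd (p j) n = 0"
    if "i \<noteq> j" for i j n
  proof -
    have *: "kp_fst (p i) n = 0 \<and> kp_snd (p i) n = 0 \<or> kp_fst (p j) n = 0 \<and> kp_snd (p j) n = 0"
      if "i < j" for i j
    proof (cases "n < c j")
      case False
      then have "c (Suc i) \<le> n" using monoD[OF mc, of "Suc i" j] that by simp
      then show ?thesis using zero by blast
    qed (use zero in blast)
    show ?thesis using *[of i j] *[of j i] that by (cases "i < j") auto
  qed
  have pd: "norm (u k - p k) \<le> e" for k using near[of k] by (simp add: p_def)
  have pn: "norm (p k) \<le> 2 * C" for k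
    using norm_triangle_ineq2[of "p k" "u k"] pd[of k] C(2)[of k] e(2) by (simp add: norm_minus_commute)
  define v where "v = kp_average N u K"
  define w where "w = kp_average N p K"
  have "v - w = (1 / sqrt N) *\<^sub>R (\<Sum>k\<in>?I. u k - p k)"
    by (simp add: v_def w_def kp_average_def sum_subtractf scaleR_diff_right)
  moreover have "norm (\<Sum>k\<in>?I. u k - p k) \<le> N * e"
    using sum_norm_bound[of ?I "\<lambda>k. u k - p k" e] pd I(3) by simp
  ultimately have "norm (v - w) \<le> (1 / sqrt N) * (N * e)"
    using N by (simp add: divide_right_mono)
  also have "\<dots> = (N / sqrt N) * e" by simp
  also have "\<dots> = sqrt N * e" by (simp only: real_div_sqrt of_nat_0_le_iff)
  finally have vw: "norm (v - w) \<le> sqrt N * e" .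
  have L: "0 \<le> ln N" using N by (simp add: ln_ge_zero)
  have "kp_qnorm ((1 / (8 * C)) *\<^sub>R p k) \<le> 1" for k
  proof -
    have "kp_qnorm ((1 / (8 * C)) *\<^sub>R p k) = (1 / (8 * C)) * kp_qnorm (p k)"
      using C unfolding scaleR_kalton_peck_def kp_qnorm_scale norm_of_real by simp
    also have "\<dots> \<le> (1 / (8 * C)) * (4 * (2 * C))"
      using kp_qnorm_le[of "p k"] pn[of k] C by (intro mult_left_mono) auto
    finally show ?thesis using C by simp
  qed
  then have q6: "kp_qnorm ((1 / sqrt (card ?I)) *\<^sub>R (\<Sum>i\<in>?I. (1 / (8 * C)) *\<^sub>R p i) + (ln (card ?I) / 2) *\<^sub>R kp_incl (kp_quot ((1 / sqrt (card ?I)) *\<^sub>R (\<Sum>i\<in>?I. (1 / (8 * C)) *\<^sub>R p i)))) \<le> 6"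
    by (intro kp_average_disjoint_le[OF I(1,2)]) (use disj in auto)
  have eq: "(1 / sqrt (card ?I)) *\<^sub>R (\<Sum>i\<in>?I. (1 / (8 * C)) *\<^sub>R p i) = (1 / (8 * C)) *\<^sub>R w"
    unfolding w_def kp_average_def I(3) scaleR_sum_right[symmetric] by simp
  have "kp_qnorm ((1 / (8 * C)) *\<^sub>R kp_log_corrected N w) \<le> 6"
    using q6 unfolding eq unfolding I(3) kp_log_corrected_def kp_quot_scaleR kp_incl_scaleR
      scaleR_add_right scaleR_left_commute[of "ln (real N) / 2"] .
  then have "norm ((1 / (8 * C)) *\<^sub>R kp_log_corrected N w) \<le> 12"
    using norm_kp_le_qnorm[of "(1 / (8 * C)) *\<^sub>R kp_log_corrected N w"] by linarith
  then have bw: "norm (kp_log_corrected N w) \<le> 96 * C"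
    using C by (simp add: field_simps)
  have "kp_log_corrected N v = kp_log_corrected N w + ((v - w) + (ln N / 2) *\<^sub>R kp_incl (kp_quot (v - w)))"
    by (simp add: kp_log_corrected_def kp_quot_diff kp_incl_diff scaleR_diff_right)
  then have "norm (kp_log_corrected N v) \<le> norm (kp_log_corrected N w) + (norm (v - w) + norm ((ln N / 2) *\<^sub>R kp_incl (kp_quot (v - w))))"
    by (simp only:) (intro norm_triangle_le add_left_mono norm_triangle_ineq)
  also have "norm ((ln N / 2) *\<^sub>R kp_incl (kp_quot (v - w))) \<le> ln N * norm (v - w)"
  proof -
    have "norm (kp_incl (kp_quot (v - w))) \<le> 2 * norm (v - w)"
      using norm_incl_le[of "kp_quot (v - w)"] norm_quot_le[of "v - w"] by linarith
    then have "ln N / 2 * norm (kp_incl (kp_quot (v - w))) \<le> ln N / 2 * (2 * norm (v - w))"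
      using L by (intro mult_left_mono) auto
    then show ?thesis using L by simp
  qed
  also have "norm (v - w) + ln N * norm (v - w) = (1 + ln N) * norm (v - w)" by (simp add: algebra_simps)
  also have "\<dots> \<le> (1 + ln N) * (sqrt N * e)" using L vw by (intro mult_left_mono) auto
  also have "\<dots> \<le> C" using e(1) by (simp add: mult_ac)
  finally show "norm (kp_log_corrected N (kp_average N u K)) \<le> 97 * C"
    using bw by (simp add: v_def)
  assume d: "\<And>k. d \<le> norm (kp_quot (u k))" "e \<le> d"
  have qd: "d - e \<le> norm (kp_quot (p k))" for k
    using norm_triangle_ineq2[of "kp_quot (u k)" "kp_quot (p k)"] norm_quot_le[of "u k - p k"]
      pd[of k] d(1)[of k] by (simp add: kp_quot_diff)
  have "N * (d - e)\<^sup>2 \<le> (\<Sum>k\<in>?I. (norm (kp_quot (p k)))\<^sup>2)"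
    using sum_bounded_below[of ?I "(d - e)\<^sup>2" "\<lambda>k. (norm (kp_quot (p k)))\<^sup>2"] qd d(2) I(3)
    by (simp add: power_mono)
  also have "\<dots> = (norm (\<Sum>k\<in>?I. kp_quot (p k)))\<^sup>2"
    by (rule power2_norm_sum_disjoint[symmetric]) (use disj in \<open>auto simp flip: kp_snd_eq\<close>)
  also have "(\<Sum>k\<in>?I. kp_quot (p k)) = sqrt N *\<^sub>R kp_quot w"
    using N by (simp add: w_def kp_average_def kp_quot_scaleR kp_quot_sum)
  also have "(norm (sqrt N *\<^sub>R kp_quot w))\<^sup>2 = N * (norm (kp_quot w))\<^sup>2"
    by (simp add: power_mult_distrib)
  finally have "(d - e)\<^sup>2 \<le> (norm (kp_quot w))\<^sup>2" using N by simp
  then have "d - e \<le> norm (kp_quot w)" by (rule power2_le_imp_le) simp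
  moreover have "norm (kp_quot w) \<le> norm (kp_quot v) + norm (kp_quot (v - w))"
    using norm_triangle_ineq3[of "kp_quot w" "kp_quot v"] by (simp add: kp_quot_diff norm_minus_commute)
  moreover have "norm (kp_quot (v - w)) \<le> sqrt N * e"
    using norm_quot_le[of "v - w"] vw by linarith
  ultimately show "d - (1 + sqrt N) * e \<le> norm (kp_quot (kp_average N u K))"
    by (simp add: v_def algebra_simps)
qed

lemma kp_null_average:
  assumes "kp_null u"
  shows "kp_null (kp_average N u)"
proof -
  obtain C where C: "0 < C" "\<And>n. norm (u n) \<le> C" using kp_null_boundE[OF assms] by blast
  have eq: "kp_average N u K = (1 / sqrt N) *\<^sub>R (\<Sum>k<N. u (K + k))" for K
    unfolding kp_average_def
    using sum.shift_bounds_nat_ivl[of u 0 K N]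
    by (simp add: atLeast0LessThan add.commute[of K])
  have "norm (kp_average N u K) \<le> 1 / sqrt N * (N * C)" for K
  proof -
    have "norm (\<Sum>k<N. u (K + k)) \<le> N * C"
      using sum_norm_bound[of "{..<N}" "\<lambda>k. u (K + k)" C] C by simp
    then show ?thesis unfolding eq by (simp add: divide_right_mono)
  qed
  moreover have lim: "(\<lambda>K. of_real (1 / sqrt N) * (\<Sum>k<N. f (K + k))) \<longlonglongrightarrow> 0" if "f \<longlonglongrightarrow> 0" for f :: "nat \<Rightarrow> 'a"
    by (intro tendsto_mult_right_zero tendsto_null_sum LIMSEQ_ignore_initial_segment that)
  have "(\<lambda>K. kp_fst (kp_average N u K) i) \<longlonglongrightarrow> 0" "(\<lambda>K. kp_snd (kp_average N u K) i) \<longlonglongrightarrow> 0" for i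
    using assms lim[of "\<lambda>n. kp_fst (u n) i"] lim[of "\<lambda>n. kp_snd (u n) i"]
    unfolding eq kp_null_def kp_fst_scaleR kp_snd_scaleR kp_fst_sum kp_snd_sum by blast+
  ultimately show ?thesis unfolding kp_null_def by blast
qed

text \<open>
  In the lemma below \<open>s\<close> may be the image of \<open>u\<close> under an operator, which commutes with averaging.
\<close>

lemma kp_null_averages:
  fixes u s :: "nat \<Rightarrow> 'k::real_or_complex kalton_peck"
  assumes u: "kp_null u" and s: "kp_null s" and N: "0 < N"
    and C: "0 < C" "\<And>k. norm (u k) \<le> C" "\<And>k. norm (s k) \<le> C"
    and d: "0 < d" "\<And>k. d \<le> norm (kp_quot (s k))"
  obtains r where "strict_mono r"
    "\<And>K. norm (kp_log_corrected N (kp_average N (u \<circ> r) K)) \<le> 97 * C"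
    "\<And>K. norm (kp_log_corrected N (kp_average N (s \<circ> r) K)) \<le> 97 * C"
    "\<And>K. d / 2 \<le> norm (kp_quot (kp_average N (s \<circ> r) K))"
proof -
  have L: "0 \<le> ln N" using N by (simp add: ln_ge_zero)
  have sN: "0 < sqrt N" using N by simp
  \<comment> \<open>\<open>D\<close> dominates the factors 1, 1 + sqrt N and sqrt N (1 + ln N), so
    that one \<open>e\<close> meets all requirements of the block estimates.\<close>
  define D where "D = (1 + sqrt N) * (1 + ln N)"
  have D1: "1 \<le> D" "1 + sqrt N \<le> D" "sqrt N * (1 + ln N) \<le> D"
    using L sN unfolding D_def by (simp_all add: algebra_simps)
  define e where "e = min C (d / 2) / D"
  have m: "0 < min C (d / 2)" using C d by simp
  have e0: "0 < e" unfolding e_def using m D1 by (intro divide_pos_pos) auto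
  have eD: "D * e = min C (d / 2)" using D1 by (simp add: e_def)
  have eC: "sqrt N * e * (1 + ln N) \<le> C" "e \<le> C" "e \<le> d" "(1 + sqrt N) * e \<le> d / 2"
    using mult_right_mono[OF D1(1), of e] mult_right_mono[OF D1(2), of e] mult_right_mono[OF D1(3), of e]
      e0 eD d(1) by (simp_all add: mult_ac)
  obtain r c where r: "strict_mono r" "mono c"
    "\<And>k. norm (u (r k) - (kp_trunc (c (Suc k)) (u (r k)) - kp_trunc (c k) (u (r k)))) < e"
    "\<And>k. norm (s (r k) - (kp_trunc (c (Suc k)) (s (r k)) - kp_trunc (c k) (s (r k)))) < e"
    using kp_null_blocks[OF u s e0] by blast
  show ?thesis
  proof (rule that[OF r(1)])
    fix K
    show "norm (kp_log_corrected N (kp_average N (u \<circ> r) K)) \<le> 97 * C"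
      by (rule kp_average_block_bounds(1)[OF r(2) N C(1) _ eC(1,2)]) (use C r in auto)
    show "norm (kp_log_corrected N (kp_average N (s \<circ> r) K)) \<le> 97 * C"
      by (rule kp_average_block_bounds(1)[OF r(2) N C(1) _ eC(1,2)]) (use C r in auto)
    have "d - (1 + sqrt N) * e \<le> norm (kp_quot (kp_average N (s \<circ> r) K))"
      by (rule kp_average_block_bounds(2)[OF r(2) N C(1) _ eC(1,2) _ _ eC(3)]) (use C d r in auto)
    then show "d / 2 \<le> norm (kp_quot (kp_average N (s \<circ> r) K))"
      using eC(4) by linarith
  qed
qed

section \<open>Strictly singular operators\<close>

text \<open>On a Hilbert space compactness means mapping weakly null sequences to norm null ones.
  Here this is required of the restriction to the kernel; below, its dual concerns the composition
  with the quotient map.\<close>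

definition compact_on_kernel :: "('k::real_or_complex kalton_peck \<Rightarrow> 'k kalton_peck) \<Rightarrow> bool" where
  "compact_on_kernel S \<longleftrightarrow> (\<forall>x. ell2_null x \<longrightarrow> (\<lambda>n. S (kp_incl (x n))) \<longlonglongrightarrow> 0)"

definition compact_into_quotient :: "('k::real_or_complex kalton_peck \<Rightarrow> 'k kalton_peck) \<Rightarrow> bool" where
  "compact_into_quotient S \<longleftrightarrow> (\<forall>u. kp_null u \<longrightarrow> (\<lambda>n. kp_quot (S (u n))) \<longlonglongrightarrow> 0)"

lemma not_tendsto_zero_subseq:
  fixes f :: "nat \<Rightarrow> 'a::real_normed_vector"
  assumes "\<not> f \<longlonglongrightarrow> 0"
  obtains e and r :: "nat \<Rightarrow> nat" where "0 < e" "strict_mono r" "\<And>n. e \<le> norm (f (r n))"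
proof -
  obtain e where e: "0 < e" "\<forall>M. \<exists>n\<ge>M. e \<le> norm (f n)"
    using assms by (auto simp: LIMSEQ_iff not_less)
  then have "infinite {n. e \<le> norm (f n)}"
    unfolding infinite_nat_iff_unbounded_le by simp
  then obtain r :: "nat \<Rightarrow> nat" where "strict_mono r" "\<And>n. r n \<in> {n. e \<le> norm (f n)}"
    using infinite_enumerate[of "{n. e \<le> norm (f n)}"] by blast
  with e(1) that show ?thesis by auto
qed

lemma kp_ops_average:
  assumes "S \<in> kp_ops"
  shows "S (kp_average N u K) = kp_average N (\<lambda>k. S (u k)) K"
  unfolding kp_average_def
    linear_scale[OF bounded_linear.linear[OF kp_ops_bounded_linear[OF assms]]]
    linear_sum[OF bounded_linear.linear[OF kp_ops_bounded_linear[OF assms]]] ..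

text \<open>
  The averages are far from bounded, but up to a bounded error they lie in the kernel of the
  quotient map, where \<open>S\<close> is small.
\<close>

lemma eventually_norm_ops_average_le:
  assumes S: "S \<in> kp_ops" and K: "compact_on_kernel S" and v: "kp_null v"
    and B: "0 < B" "\<And>u. norm (S u) \<le> B * norm u"
    and C: "0 < C" "\<And>K. norm (kp_log_corrected N (v K)) \<le> C"
  shows "eventually (\<lambda>K. norm (S (v K)) \<le> B * C + 1) sequentially"
proof -
  let ?L = "ln N / 2"
  have l: "bounded_linear S" by (rule kp_ops_bounded_linear[OF S])
  have "(\<lambda>K. S (kp_incl (kp_quot (v K)))) \<longlonglongrightarrow> 0"
    using K kp_null_quot[OF v] unfolding compact_on_kernel_def by blast
  then have "(\<lambda>K. norm (?L *\<^sub>R S (kp_incl (kp_quot (v K))))) \<longlonglongrightarrow> norm (?L *\<^sub>R (0 :: 'a kalton_peck))"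
    by (intro tendsto_intros)
  then have "(\<lambda>K. norm (?L *\<^sub>R S (kp_incl (kp_quot (v K))))) \<longlonglongrightarrow> 0"
    by (simp only: scaleR_zero_right norm_zero)
  then have "eventually (\<lambda>K. norm (?L *\<^sub>R S (kp_incl (kp_quot (v K)))) < 1) sequentially"
    by (rule order_tendstoD) simp
  then show ?thesis
  proof eventually_elim
    case (elim K)
    have "v K = kp_log_corrected N (v K) - ?L *\<^sub>R kp_incl (kp_quot (v K))"
      by (simp add: kp_log_corrected_def)
    then have "S (v K) = S (kp_log_corrected N (v K)) - ?L *\<^sub>R S (kp_incl (kp_quot (v K)))"
      using l by (metis bounded_linear.linear linear_diff linear_scale)
    then have "norm (S (v K)) \<le> norm (S (kp_log_corrected N (v K))) + norm (?L *\<^sub>R S (kp_incl (kp_quot (v K))))"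
      by (metis norm_triangle_ineq4)
    moreover have "norm (S (kp_log_corrected N (v K))) \<le> B * C"
      using B(2)[of "kp_log_corrected N (v K)"] mult_left_mono[OF C(2)[of K], of B] B(1) by linarith
    ultimately show ?case using elim by linarith
  qed
qed

text \<open>\<open>kp_incl\<close> shrinks norms by a factor of at most 4, so the term added by the
  correction has norm at least (ln N / 2) (d / 8), whereas its sum with \<open>v\<close> is bounded
  by C.\<close>

lemma norm_average_ge:
  assumes "norm (kp_log_corrected N v) \<le> C" "d / 2 \<le> norm (kp_quot v)" "0 < N"
  shows "ln N * d / 16 - C \<le> norm v"
proof -
  let ?L = "ln N / 2"
  have L: "0 \<le> ?L" using assms(3) by (simp add: ln_ge_zero)
  have "?L * (d / 8) \<le> ?L * norm (kp_incl (kp_quot v))"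
    using assms(2) norm_le_norm_incl[of "kp_quot v"] L by (intro mult_left_mono) auto
  also have "\<dots> = norm (?L *\<^sub>R kp_incl (kp_quot v))" using L by simp
  also have "?L *\<^sub>R kp_incl (kp_quot v) = kp_log_corrected N v - v"
    by (simp add: kp_log_corrected_def)
  also have "norm (kp_log_corrected N v - v) \<le> C + norm v"
    using norm_triangle_ineq4[of "kp_log_corrected N v" v] assms(1) by linarith
  finally show ?thesis by simp
qed

lemma ex_ln_ge: "\<exists>N>0. x \<le> ln (real N)"
proof -
  obtain N :: nat where N: "exp x \<le> N" using real_arch_simple by blast
  then have "0 < N" using exp_gt_zero[of x] by (metis gr0I not_le of_nat_0)
  moreover from this N have "x \<le> ln (real N)"
    by (metis ln_exp ln_mono exp_gt_zero)
  ultimately show ?thesis by blast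
qed

text \<open>If the quotients of the images stayed above d, averages of N images would have norm of
  order ln N. By compactness on the kernel, however, the images of averages far out are bounded
  independently of N.\<close>

lemma compact_into_quotientI:
  fixes S :: "'k::real_or_complex kalton_peck \<Rightarrow> 'k kalton_peck"
  assumes S: "S \<in> kp_ops" and K: "compact_on_kernel S"
  shows "compact_into_quotient S"
  unfolding compact_into_quotient_def
proof (intro allI impI, rule ccontr)
  fix v :: "nat \<Rightarrow> 'k kalton_peck"
  assume v: "kp_null v" and n: "\<not> (\<lambda>n. kp_quot (S (v n))) \<longlonglongrightarrow> 0"
  obtain d and q :: "nat \<Rightarrow> nat" where d: "0 < d" and q: "strict_mono q" and dq: "\<And>n. d \<le> norm (kp_quot (S (v (q n))))"
    by (rule not_tendsto_zero_subseq[OF n]) blast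
  define u where "u n = v (q n)" for n :: nat
  have u: "kp_null u"
    unfolding u_def by (rule kp_null_filterlim[OF v filterlim_subseq[OF q]])
  have s: "kp_null (\<lambda>n. S (u n))" by (rule kp_null_ops[OF S u])
  obtain B where B: "0 < B" "\<And>u. norm (S u) \<le> B * norm u" using kp_ops_boundE[OF S] by blast
  obtain C1 C2 where "0 < C1" "\<And>n. norm (u n) \<le> C1" "0 < C2" "\<And>n. norm (S (u n)) \<le> C2"
    using kp_null_boundE[OF u] kp_null_boundE[OF s] by metis
  then have C: "0 < max C1 C2" "\<And>n. norm (u n) \<le> max C1 C2" "\<And>n. norm (S (u n)) \<le> max C1 C2"
    by (auto simp: le_max_iff_disj)
  define C where "C = 97 * max C1 C2"
  have C0: "0 < C" using C(1) by (simp add: C_def)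
  \<comment> \<open>After the loss of C in \<open>norm_average_ge\<close> this leaves B C + 2, one
    more than the upper bound for the images.\<close>
  obtain N where N: "0 < N" "(B * C + C + 2) * 16 / d \<le> ln (real N)"
    using ex_ln_ge by blast
  obtain r where r: "strict_mono r"
    "\<And>K. norm (kp_log_corrected N (kp_average N (u \<circ> r) K)) \<le> C"
    "\<And>K. norm (kp_log_corrected N (kp_average N ((\<lambda>n. S (u n)) \<circ> r) K)) \<le> C"
    "\<And>K. d / 2 \<le> norm (kp_quot (kp_average N ((\<lambda>n. S (u n)) \<circ> r) K))"
    unfolding C_def by (rule kp_null_averages[OF u s N(1) C d, unfolded u_def, OF dq, folded u_def]) blast
  have "kp_null (u \<circ> r)"
    unfolding comp_def by (rule kp_null_filterlim[OF u filterlim_subseq[OF r(1)]])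
  from eventually_norm_ops_average_le[OF S K kp_null_average[OF this] B C0 r(2)]
  obtain K where "norm (S (kp_average N (u \<circ> r) K)) \<le> B * C + 1"
    by (auto simp: eventually_sequentially)
  moreover have "ln N * d / 16 - C \<le> norm (S (kp_average N (u \<circ> r) K))"
    using norm_average_ge[OF r(3,4) N(1), of K] by (simp add: kp_ops_average[OF S] comp_def)
  moreover have "B * C + C + 2 \<le> ln N * d / 16"
    using N(2) d by (simp add: field_simps)
  ultimately show False by linarith
qed

text \<open>The pairing of \<open>w n\<close> with a null sequence \<open>t\<close> equals that of
  \<open>x n\<close> with the quotients of \<open>S (t n)\<close>, which tend to 0. Suitable
  \<open>t\<close> can be made from \<open>w\<close> itself: \<open>kp_incl (kp_quot (w n))\<close>
  and \<open>kp_section (kp_defect (w n))\<close> recover both components of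
  \<open>w n\<close>.\<close>

lemma compact_on_kernel_adj:
  fixes S :: "'k::real_or_complex kalton_peck \<Rightarrow> 'k kalton_peck"
  assumes S: "S \<in> kp_ops" and Q: "compact_into_quotient S"
  shows "compact_on_kernel (kp_adj S)"
  unfolding compact_on_kernel_def
proof (intro allI impI)
  fix x :: "nat \<Rightarrow> 'k ell2"
  assume x: "ell2_null x"
  obtain C where C: "0 < C" "\<And>n. norm (x n) \<le> C" using ell2_null_boundE[OF x] by blast
  define w where "w n = kp_adj S (kp_incl (x n))" for n
  have w: "kp_null w"
    unfolding w_def by (rule kp_null_ops[OF kp_adj_ops[OF S] kp_null_incl[OF x]])
  have small: "(\<lambda>n. norm (kp_omega (w n) (t n))) \<longlonglongrightarrow> 0" if t: "kp_null t" for t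
  proof -
    have "norm (kp_omega (w n) (t n)) \<le> C * norm (kp_quot (S (t n)))" for n
    proof -
      have "norm (kp_omega (w n) (t n)) = norm (ell2_inner (x n) (kp_quot (S (t n))))"
        unfolding w_def kp_omega_adj'[OF S] kp_omega_incl_left ..
      also have "\<dots> \<le> norm (x n) * norm (kp_quot (S (t n)))" by (rule norm_ell2_inner_le)
      also have "\<dots> \<le> C * norm (kp_quot (S (t n)))" using C(2) by (intro mult_right_mono) auto
      finally show ?thesis .
    qed
    then have "eventually (\<lambda>n. norm (norm (kp_omega (w n) (t n))) \<le> C * norm (kp_quot (S (t n)))) sequentially"
      by simp
    moreover have "(\<lambda>n. C * norm (kp_quot (S (t n)))) \<longlonglongrightarrow> C * norm (0 :: 'k ell2)"
      using Q t unfolding compact_into_quotient_def by (intro tendsto_intros) auto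
    then have "(\<lambda>n. C * norm (kp_quot (S (t n)))) \<longlonglongrightarrow> 0" by simp
    ultimately show ?thesis by (rule Lim_null_comparison)
  qed
  have sq: "f \<longlonglongrightarrow> 0" if "(\<lambda>n. (f n)\<^sup>2) \<longlonglongrightarrow> 0" for f :: "nat \<Rightarrow> real"
  proof -
    have "(\<lambda>n. sqrt ((f n)\<^sup>2)) \<longlonglongrightarrow> sqrt 0" using that by (intro tendsto_real_sqrt)
    then show ?thesis by (simp add: tendsto_rabs_zero_iff)
  qed
  have y: "(\<lambda>n. norm (kp_quot (w n))) \<longlonglongrightarrow> 0"
  proof (rule sq, rule Lim_null_comparison)
    show "(\<lambda>n. norm (kp_omega (w n) (kp_incl (kp_quot (w n))))) \<longlonglongrightarrow> 0"
      by (rule small[OF kp_null_incl[OF kp_null_quot[OF w]]])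
  qed (simp add: power2_norm_quot_le)
  obtain D where D: "0 < D" "\<And>n. norm (kp_defect (w n)) \<le> D"
    using ell2_null_boundE[OF kp_null_defect[OF w]] by blast
  have b: "(\<lambda>n. norm (kp_defect (w n))) \<longlonglongrightarrow> 0"
  proof (rule sq, rule Lim_null_comparison)
    have "(\<lambda>n. norm (kp_omega (w n) (kp_section (kp_defect (w n)))) + 2 * norm (kp_quot (w n)) * D) \<longlonglongrightarrow> 0 + 2 * 0 * D"
      by (intro tendsto_intros small[OF kp_null_section[OF kp_null_defect[OF w]]] y)
    then show "(\<lambda>n. norm (kp_omega (w n) (kp_section (kp_defect (w n)))) + 2 * norm (kp_quot (w n)) * D) \<longlonglongrightarrow> 0"
      by simp
    show "eventually (\<lambda>n. norm ((norm (kp_defect (w n)))\<^sup>2) \<le> norm (kp_omega (w n) (kp_section (kp_defect (w n)))) + 2 * norm (kp_quot (w n)) * D) sequentially"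
    proof (intro always_eventually allI)
      fix n
      have "2 * norm (kp_quot (w n)) * norm (kp_defect (w n)) \<le> 2 * norm (kp_quot (w n)) * D"
        using D(2) by (intro mult_left_mono) auto
      then show "norm ((norm (kp_defect (w n)))\<^sup>2) \<le> norm (kp_omega (w n) (kp_section (kp_defect (w n)))) + 2 * norm (kp_quot (w n)) * D"
        using power2_norm_defect_le[of "w n"] by simp
    qed
  qed
  have "(\<lambda>n. 2 * (norm (kp_defect (w n)) + norm (kp_quot (w n)))) \<longlonglongrightarrow> 2 * (0 + 0)"
    by (intro tendsto_intros b y)
  then have "(\<lambda>n. 2 * kp_qnorm (w n)) \<longlonglongrightarrow> 0" by (simp add: kp_qnorm_eq)
  then have "w \<longlonglongrightarrow> 0"
    by (rule Lim_null_comparison[rotated]) (simp add: norm_kp_le_qnorm)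
  then show "(\<lambda>n. kp_adj S (kp_incl (x n))) \<longlonglongrightarrow> 0" by (simp add: w_def[abs_def])
qed

interpretation kp: vector_space kp_scale
  by (rule vector_space_kp_scale)

section \<open>The ideal of the operators that are compact on the kernel\<close>

lemma compact_on_kernel_adjI:
  "S \<in> kp_ops \<Longrightarrow> compact_on_kernel S \<Longrightarrow> compact_on_kernel (kp_adj S)"
  by (intro compact_on_kernel_adj compact_into_quotientI)

lemma compact_on_kernel_plus:
  "compact_on_kernel S \<Longrightarrow> compact_on_kernel T \<Longrightarrow> compact_on_kernel (\<lambda>u. S u + T u)"
  unfolding compact_on_kernel_def by (simp add: tendsto_add_zero)

lemma compact_on_kernel_smult:
  assumes "compact_on_kernel S"
  shows "compact_on_kernel (\<lambda>u. kp_scale c (S u))"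
  unfolding compact_on_kernel_def
proof (intro allI impI)
  fix x :: "nat \<Rightarrow> 'a ell2" assume "ell2_null x"
  then have "(\<lambda>n. S (kp_incl (x n))) \<longlonglongrightarrow> 0"
    using assms unfolding compact_on_kernel_def by blast
  then have "(\<lambda>n. norm c * norm (S (kp_incl (x n)))) \<longlonglongrightarrow> norm c * norm (0 :: 'a kalton_peck)"
    by (intro tendsto_intros)
  then have "(\<lambda>n. norm (kp_scale c (S (kp_incl (x n))))) \<longlonglongrightarrow> 0" by simp
  then show "(\<lambda>n. kp_scale c (S (kp_incl (x n)))) \<longlonglongrightarrow> 0" by (rule tendsto_norm_zero_cancel)
qed

lemma compact_on_kernel_comp_left:
  assumes "T \<in> kp_ops" "compact_on_kernel S"
  shows "compact_on_kernel (T \<circ> S)"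
  unfolding compact_on_kernel_def
proof (intro allI impI)
  fix x :: "nat \<Rightarrow> 'a ell2" assume "ell2_null x"
  then have "(\<lambda>n. S (kp_incl (x n))) \<longlonglongrightarrow> 0"
    using assms unfolding compact_on_kernel_def by blast
  then have "(\<lambda>n. T (S (kp_incl (x n)))) \<longlonglongrightarrow> T 0"
    by (rule bounded_linear.tendsto[OF kp_ops_bounded_linear[OF assms(1)]])
  then show "(\<lambda>n. (T \<circ> S) (kp_incl (x n))) \<longlonglongrightarrow> 0"
    using bounded_linear.linear[OF kp_ops_bounded_linear[OF assms(1)]] by (simp add: linear_0)
qed

text \<open>\<open>T\<close> need not preserve the kernel. Adjoints turn composition on the right
  into composition on the left, where nothing of this kind is asked.\<close>

lemma compact_on_kernel_comp_right:
  assumes S: "S \<in> kp_ops" "compact_on_kernel S" and T: "T \<in> kp_ops"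
  shows "compact_on_kernel (S \<circ> T)"
proof -
  have "compact_on_kernel (kp_adj (kp_adj T \<circ> kp_adj S))"
    by (intro compact_on_kernel_adjI compact_on_kernel_comp_left kp_ops_comp kp_adj_ops S T)
  moreover have "kp_adj (kp_adj T \<circ> kp_adj S) = S \<circ> T"
    by (simp add: kp_adj_comp kp_adj_ops kp_adj_adj S T)
  ultimately show ?thesis by simp
qed

section \<open>Operators compact on the kernel are strictly singular\<close>

abbreviation kp_infinite_dim :: "'k::real_or_complex kalton_peck set \<Rightarrow> bool" where
  "kp_infinite_dim M \<equiv> \<nexists>B. finite B \<and> kp.span B = M"

text \<open>Truncation has its range in the span of 2 m vectors, so it is not injective on an
  infinite-dimensional subspace; a nonzero vector that it annihilates is then normalised.\<close>

lemma kp_infinite_dim_trunc: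
  assumes M: "kp.subspace M" and inf: "kp_infinite_dim M"
  shows "\<exists>u\<in>M. norm u = 1 \<and> kp_trunc m u = 0"
proof (rule ccontr)
  assume neg: "\<not> (\<exists>u\<in>M. norm u = 1 \<and> kp_trunc m u = 0)"
  have tl: "Vector_Spaces.linear kp_scale kp_scale (kp_trunc m)"
    unfolding Vector_Spaces.linear_iff
    by (auto simp: vector_space_kp_scale kp_fst_trunc kp_snd_trunc intro!: kp_eqI)
  interpret t: Vector_Spaces.linear kp_scale kp_scale "kp_trunc m" by (rule tl)
  have ker: "u = 0" if "u \<in> M" "kp_trunc m u = 0" for u
  proof (rule ccontr)
    assume "u \<noteq> 0"
    then have n: "0 < norm u" by simp
    have 1: "kp_scale (of_real (1 / norm u)) u \<in> M"
      using M that(1) by (rule kp.subspace_scale)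
    have 2: "norm (kp_scale (of_real (1 / norm u)) u) = 1"
      using n unfolding norm_kp_scale norm_of_real by simp
    have 3: "kp_trunc m (kp_scale (of_real (1 / norm u)) u) = 0"
      unfolding t.scale that(2) by simp
    show False using neg 1 2 3 by blast
  qed
  obtain B where B: "B \<subseteq> M" "kp.independent B" "M \<subseteq> kp.span B"
    using kp.maximal_independent_subset[of M] by metis
  have sp: "kp.span B = M"
    using B M kp.span_minimal[of B M] by blast
  then have infB: "infinite B" using inf by blast
  have inj: "inj_on (kp_trunc m) M"
  proof (rule inj_onI)
    fix u v assume uv: "u \<in> M" "v \<in> M" "kp_trunc m u = kp_trunc m v"
    then have "kp_trunc m (u - v) = 0" by (simp add: t.diff)
    moreover have "u - v \<in> M" using M uv kp.subspace_diff by blast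
    ultimately show "u = v" using ker[of "u - v"] by simp
  qed
  let ?E = "(\<lambda>i. kp_incl (ell2_unit i)) ` {..<m} \<union> (\<lambda>i. kp_section (ell2_unit i)) ` {..<m}"
  have "kp_trunc m u \<in> kp.span ?E" for u :: "'a kalton_peck"
    unfolding kp_trunc_def by (intro kp.span_sum kp.span_add kp.span_scale kp.span_base) auto
  then have "kp_trunc m ` B \<subseteq> kp.span ?E" by blast
  moreover have "kp.independent (kp_trunc m ` B)"
    using B(2) inj unfolding sp[symmetric] by (rule t.independent_injective_image)
  ultimately have "finite (kp_trunc m ` B)"
    using kp.independent_span_bound[of ?E] by blast
  then show False
    using infB inj_on_subset[OF inj B(1)] by (simp add: finite_image_iff)
qed

text \<open>Unit vectors of \<open>M\<close> with ever more vanishing coordinates form a null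
  sequence. If their quotients tend to 0, they approach the kernel, where \<open>S\<close> makes
  them small. Otherwise averages inside \<open>M\<close> reach norms of order ln N while their
  images stay bounded.\<close>

lemma compact_on_kernel_not_bounded_below:
  assumes S: "S \<in> kp_ops" and K: "compact_on_kernel S"
    and M: "kp.subspace M" and inf: "kp_infinite_dim M" and a: "0 < a"
  shows "\<exists>u\<in>M. norm (S u) < a * norm u"
proof (rule ccontr)
  assume "\<not> (\<exists>u\<in>M. norm (S u) < a * norm u)"
  then have below: "a * norm u \<le> norm (S u)" if "u \<in> M" for u using that by (auto simp: not_less)
  obtain u where u: "\<And>m. u m \<in> M" "\<And>m. norm (u m) = 1" "\<And>m. kp_trunc m (u m) = 0"
    using kp_infinite_dim_trunc[OF M inf] by metis
  have z: "kp_fst (u m) i = 0" "kp_snd (u m) i = 0" if "i < m" for i m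
    using u(3)[of m] kp_fst_trunc[of m "u m" i] kp_snd_trunc[of m "u m" i] that by simp_all
  have null: "kp_null u"
    unfolding kp_null_def
  proof (intro conjI allI)
    show "\<exists>C. \<forall>n. norm (u n) \<le> C" using u(2) by (intro exI[of _ 1]) simp
    fix i
    have "eventually (\<lambda>n. kp_fst (u n) i = 0) sequentially" "eventually (\<lambda>n. kp_snd (u n) i = 0) sequentially"
      using z[of i] by (auto simp: eventually_sequentially intro!: exI[of _ "Suc i"])
    then show "(\<lambda>n. kp_fst (u n) i) \<longlonglongrightarrow> 0" "(\<lambda>n. kp_snd (u n) i) \<longlonglongrightarrow> 0"
      by (auto intro: tendsto_eventually)
  qed
  obtain B where B: "0 < B" "\<And>u. norm (S u) \<le> B * norm u" using kp_ops_boundE[OF S] by blast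
  show False
  proof (cases "(\<lambda>n. kp_quot (u n)) \<longlonglongrightarrow> 0")
    case True
    then have "(\<lambda>n. 2 * norm (kp_quot (u n))) \<longlonglongrightarrow> 2 * norm (0 :: 'a ell2)"
      by (intro tendsto_intros)
    then have "(\<lambda>n. 2 * norm (kp_quot (u n))) \<longlonglongrightarrow> 0" by simp
    then have "(\<lambda>n. kp_section (kp_quot (u n))) \<longlonglongrightarrow> 0"
      by (rule Lim_null_comparison[rotated]) (simp add: norm_section_le)
    then have "(\<lambda>n. S (kp_section (kp_quot (u n)))) \<longlonglongrightarrow> S 0"
      by (rule bounded_linear.tendsto[OF kp_ops_bounded_linear[OF S]])
    moreover have "(\<lambda>n. S (kp_incl (kp_defect (u n)))) \<longlonglongrightarrow> 0"
      using K kp_null_defect[OF null] unfolding compact_on_kernel_def by blast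
    ultimately have "(\<lambda>n. S (kp_incl (kp_defect (u n))) + S (kp_section (kp_quot (u n)))) \<longlonglongrightarrow> 0 + S 0"
      by (intro tendsto_add)
    then have "(\<lambda>n. S (u n)) \<longlonglongrightarrow> 0"
      unfolding kp_ops_add[OF S, symmetric] kp_decompose[symmetric]
      using linear_0[OF bounded_linear.linear[OF kp_ops_bounded_linear[OF S]]] by simp
    then have "(\<lambda>n. norm (S (u n))) \<longlonglongrightarrow> 0" by (rule tendsto_norm_zero)
    then have "eventually (\<lambda>n. norm (S (u n)) < a) sequentially"
      using a by (rule order_tendstoD)
    then obtain n where "norm (S (u n)) < a" by (auto simp: eventually_sequentially)
    then show False using below[OF u(1), of n] u(2)[of n] by simp
  next
    case False
    obtain d and q :: "nat \<Rightarrow> nat" where d: "0 < d" and q: "strict_mono q"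
      and dq: "\<And>n. d \<le> norm (kp_quot (u (q n)))"
      by (rule not_tendsto_zero_subseq[OF False]) blast
    define v where "v n = u (q n)" for n
    have v: "kp_null v" unfolding v_def by (rule kp_null_filterlim[OF null filterlim_subseq[OF q]])
    have v1: "norm (v n) \<le> 1" and dv: "d \<le> norm (kp_quot (v n))" for n
      using u(2) dq by (simp_all add: v_def)
    \<comment> \<open>Images of averages stay below B * 97 + 1, while the averages reach ln N d / 16
      - 97; this N is too large for the lower bound \<open>a\<close>.\<close>
    obtain N where N: "0 < N" "((B * 97 + 2) / a + 97) * 16 / d \<le> ln (real N)"
      using ex_ln_ge by blast
    obtain r :: "nat \<Rightarrow> nat" where r: "strict_mono r"
      "\<And>K. norm (kp_log_corrected N (kp_average N (v \<circ> r) K)) \<le> 97 * 1"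
      "\<And>K. d / 2 \<le> norm (kp_quot (kp_average N (v \<circ> r) K))"
      by (rule kp_null_averages[OF v v N(1) zero_less_one v1 v1 d dv]) blast
    have "kp_null (v \<circ> r)"
      unfolding comp_def by (rule kp_null_filterlim[OF v filterlim_subseq[OF r(1)]])
    from eventually_norm_ops_average_le[OF S K kp_null_average[OF this] B _ r(2)]
    obtain K where le: "norm (S (kp_average N (v \<circ> r) K)) \<le> B * 97 + 1"
      by (auto simp: eventually_sequentially)
    have "kp_average N (v \<circ> r) K \<in> M"
      unfolding kp_average_def scaleR_kalton_peck_def
      using M u(1) by (intro kp.subspace_scale kp.subspace_sum) (simp_all add: v_def)
    then have "a * norm (kp_average N (v \<circ> r) K) \<le> B * 97 + 1"
      using below le by fastforce
    moreover have "ln N * d / 16 - 97 \<le> norm (kp_average N (v \<circ> r) K)"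
      using norm_average_ge[OF r(2,3) N(1), of K] by simp
    moreover have "(B * 97 + 2) / a + 97 \<le> ln N * d / 16"
      using N(2) d by (simp add: field_simps)
    ultimately have "(B * 97 + 2) / a \<le> norm (kp_average N (v \<circ> r) K)" by linarith
    then have "B * 97 + 2 \<le> a * norm (kp_average N (v \<circ> r) K)" using a by (simp add: field_simps)
    then show False using \<open>a * norm (kp_average N (v \<circ> r) K) \<le> B * 97 + 1\<close> by linarith
  qed
qed

lemma bounded_below_homeomorphic_map:
  assumes S: "S \<in> kp_ops" and M: "kp.subspace M" and a: "0 < a"
    and below: "\<And>u. u \<in> M \<Longrightarrow> a * norm u \<le> norm (S u)"
  shows "homeomorphic_map (top_of_set M) (top_of_set (S ` M)) S"
proof -
  have diff: "S u - S v = S (u - v)" for u v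
    using bounded_linear.linear[OF kp_ops_bounded_linear[OF S]] by (simp add: linear_diff)
  have lip: "a * norm (u - v) \<le> norm (S u - S v)" if "u \<in> M" "v \<in> M" for u v
    unfolding diff using that M by (intro below kp.subspace_diff)
  have inj: "inj_on S M"
  proof (rule inj_onI)
    fix u v assume uv: "u \<in> M" "v \<in> M" "S u = S v"
    then have "a * norm (u - v) \<le> 0" using lip[of u v] by simp
    then show "u = v" using a by (simp add: mult_le_0_iff)
  qed
  define g where "g = inv_into M S"
  have g: "g (S u) = u" if "u \<in> M" for u unfolding g_def using inj that by (rule inv_into_f_f)
  have "continuous_on (S ` M) g"
    unfolding continuous_on_iff
  proof (intro ballI allI impI)
    fix x and e :: real assume x: "x \<in> S ` M" and e: "0 < e"
    show "\<exists>d>0. \<forall>y\<in>S ` M. dist y x < d \<longrightarrow> dist (g y) (g x) < e"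
    proof (intro exI[of _ "a * e"] conjI ballI impI)
      show "0 < a * e" using a e by simp
      fix y assume y: "y \<in> S ` M" "dist y x < a * e"
      obtain u v where "u \<in> M" "x = S u" "v \<in> M" "y = S v" using x y(1) by blast
      then have "a * dist (g y) (g x) \<le> dist y x"
        using lip[of v u] by (simp add: dist_norm g)
      also have "\<dots> < a * e" by (rule y(2))
      finally show "dist (g y) (g x) < e" using a by simp
    qed
  qed
  moreover have "continuous_on M S"
    using bounded_linear.continuous_on[OF kp_ops_bounded_linear[OF S] continuous_on_id] by simp
  ultimately have "homeomorphic_maps (top_of_set M) (top_of_set (S ` M)) S g"
    unfolding homeomorphic_maps_def by (auto simp: continuous_map_in_subtopology g)
  then show ?thesis using homeomorphic_map_maps by blast
qed

text \<open>Continuity of the inverse at 0 suffices: \<open>u\<close> is rescaled so that its image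
  has norm d / 2, within the range where the inverse stays below 1.\<close>

lemma homeomorphic_map_bounded_below:
  assumes S: "S \<in> kp_ops" and M: "kp.subspace M"
    and h: "homeomorphic_map (top_of_set M) (top_of_set (S ` M)) S"
  shows "\<exists>a>0. \<forall>u\<in>M. a * norm u \<le> norm (S u)"
proof -
  have S0: "S 0 = 0"
    using bounded_linear.linear[OF kp_ops_bounded_linear[OF S]] by (rule linear_0)
  have M0: "0 \<in> M" using M by (rule kp.subspace_0)
  obtain g where "homeomorphic_maps (top_of_set M) (top_of_set (S ` M)) S g"
    using h homeomorphic_map_maps by blast
  then have g: "continuous_on (S ` M) g" "\<And>u. u \<in> M \<Longrightarrow> g (S u) = u"
    unfolding homeomorphic_maps_def by (auto simp: continuous_map_in_subtopology)
  have "0 \<in> S ` M" using M0 S0 by force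
  then obtain d where d: "0 < d" "\<And>y. y \<in> S ` M \<Longrightarrow> dist y 0 < d \<Longrightarrow> dist (g y) (g 0) < 1"
    using g(1) unfolding continuous_on_iff by (metis zero_less_one)
  have g0: "g 0 = 0" using g(2)[OF M0] S0 by simp
  have "d / 2 * norm u \<le> norm (S u)" if u: "u \<in> M" for u
  proof (cases "S u = 0")
    case True
    then have "u = 0" using g(2)[OF u] g0 by simp
    then show ?thesis by simp
  next
    case False
    define c where "c = d / 2 / norm (S u)"
    have c: "0 < c" using d False by (simp add: c_def)
    have Sc: "S (kp_scale (of_real c) u) = kp_scale (of_real c) (S u)" by (rule kp_ops_scale[OF S])
    have cM: "kp_scale (of_real c) u \<in> M" using M u by (rule kp.subspace_scale)
    have "norm (S (kp_scale (of_real c) u)) = c * norm (S u)"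
      unfolding Sc norm_kp_scale norm_of_real using c by simp
    also have "\<dots> < d" using False d by (simp add: c_def)
    finally have "dist (g (S (kp_scale (of_real c) u))) (g 0) < 1"
      using cM by (intro d(2)) (auto simp: dist_norm)
    then have "norm (kp_scale (of_real c) u) < 1" using g(2)[OF cM] g0 by simp
    then have "c * norm u < 1" unfolding norm_kp_scale norm_of_real using c by simp
    then show ?thesis using False unfolding c_def by (simp add: field_simps)
  qed
  then show ?thesis using d(1) by (intro exI[of _ "d / 2"]) auto
qed

lemma kp_subspace_closure:
  assumes M: "kp.subspace M"
  shows "kp.subspace (closure M)"
  unfolding kp.subspace_def
proof (intro conjI allI impI ballI)
  show "0 \<in> closure M" using kp.subspace_0[OF M] closure_subset by blast
next
  fix u v assume "u \<in> closure M" "v \<in> closure M"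
  then obtain f g where "\<And>n. f n \<in> M" "f \<longlonglongrightarrow> u" "\<And>n. g n \<in> M" "g \<longlonglongrightarrow> v"
    unfolding closure_sequential by blast
  then have "\<forall>n. f n + g n \<in> M" "(\<lambda>n. f n + g n) \<longlonglongrightarrow> u + v"
    using kp.subspace_add[OF M] by (auto intro: tendsto_add)
  then show "u + v \<in> closure M"
    unfolding closure_sequential by (intro exI[of _ "\<lambda>n. f n + g n"] conjI)
next
  fix c u assume "u \<in> closure M"
  then obtain f where f: "\<And>n. f n \<in> M" "f \<longlonglongrightarrow> u" unfolding closure_sequential by blast
  have sm: "kp_scale c (f n) - kp_scale c u = kp_scale c (f n - u)" for n
    by (rule kp_eqI) (simp_all add: algebra_simps)
  have "(\<lambda>n. f n - u) \<longlonglongrightarrow> 0" using f(2) by (simp add: LIM_zero_iff)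
  then have "(\<lambda>n. norm c * norm (f n - u)) \<longlonglongrightarrow> norm c * norm (0 :: 'a kalton_peck)"
    by (intro tendsto_intros)
  then have "(\<lambda>n. norm (kp_scale c (f n) - kp_scale c u)) \<longlonglongrightarrow> 0" unfolding sm by simp
  then have "(\<lambda>n. kp_scale c (f n)) \<longlonglongrightarrow> kp_scale c u"
    by (simp add: tendsto_norm_zero_iff LIM_zero_iff)
  moreover have "kp_scale c (f n) \<in> M" for n using M f(1) by (rule kp.subspace_scale)
  ultimately show "kp_scale c u \<in> closure M"
    unfolding closure_sequential by (intro exI[of _ "\<lambda>n. kp_scale c (f n)"] conjI allI)
qed

lemma strictly_singular_iff:
  "S \<in> strictly_singular_ops kp_scale norm \<longleftrightarrow> S \<in> kp_ops \<and>
     (\<forall>M. kp.subspace M \<longrightarrow> closed M \<longrightarrow> kp_infinite_dim M \<longrightarrow>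
       \<not> homeomorphic_map (top_of_set M) (top_of_set (S ` M)) S)"
proof -
  have "norm_topology (norm :: 'a kalton_peck \<Rightarrow> real) = euclidean"
    by (rule norm_topology_eq_euclidean[of 1 _ 1]) auto
  then show ?thesis unfolding strictly_singular_ops_def by simp
qed

text \<open>A lower bound for \<open>S\<close> passes to the closure of \<open>M\<close>, to which
  strict singularity applies. Infinite dimension is stated as not lying in a finite-dimensional
  span, since this form is inherited by the closure.\<close>

lemma strictly_singular_not_bounded_below:
  assumes S: "S \<in> strictly_singular_ops kp_scale norm"
    and M: "kp.subspace M" and inf: "\<And>B. finite B \<Longrightarrow> \<not> M \<subseteq> kp.span B" and a: "0 < a"
  shows "\<exists>u\<in>M. norm (S u) < a * norm u"
proof (rule ccontr)
  assume "\<not> (\<exists>u\<in>M. norm (S u) < a * norm u)"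
  then have below: "M \<subseteq> {u. a * norm u \<le> norm (S u)}" by (auto simp: not_less)
  have S': "S \<in> kp_ops" using S by (simp add: strictly_singular_iff)
  have "continuous_on UNIV S"
    using bounded_linear.continuous_on[OF kp_ops_bounded_linear[OF S'] continuous_on_id] by simp
  then have "closed {u. a * norm u \<le> norm (S u)}"
    by (intro closed_Collect_le continuous_intros)
  then have "closure M \<subseteq> {u. a * norm u \<le> norm (S u)}" using below by (simp add: closure_minimal)
  then have "homeomorphic_map (top_of_set (closure M)) (top_of_set (S ` closure M)) S"
    by (intro bounded_below_homeomorphic_map[OF S' kp_subspace_closure[OF M] a]) auto
  moreover have "kp_infinite_dim (closure M)"
    using inf closure_subset by blast
  ultimately show False
    using S kp_subspace_closure[OF M] closed_closure unfolding strictly_singular_iff by blast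
qed

lemma compact_on_kernel_strictly_singular:
  assumes "S \<in> kp_ops" "compact_on_kernel S"
  shows "S \<in> strictly_singular_ops kp_scale norm"
  unfolding strictly_singular_iff
proof (intro conjI allI impI notI assms)
  fix M assume M: "kp.subspace M" "kp_infinite_dim M"
    and "homeomorphic_map (top_of_set M) (top_of_set (S ` M)) S"
  then obtain a where a: "0 < a" "\<forall>u\<in>M. a * norm u \<le> norm (S u)"
    using homeomorphic_map_bounded_below[OF assms(1) M(1)] by blast
  obtain u where "u \<in> M" "norm (S u) < a * norm u"
    using compact_on_kernel_not_bounded_below[OF assms M a(1)] by blast
  with a(2) show False by (meson not_le)
qed

section \<open>Strictly singular operators are compact on the kernel\<close>

lemma subsequence_selection:
  fixes Q :: "nat \<Rightarrow> nat \<Rightarrow> bool" and R :: "nat \<Rightarrow> nat \<Rightarrow> nat \<Rightarrow> nat \<Rightarrow> bool"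
  assumes Q: "\<And>k. eventually (Q k) sequentially"
    and R: "\<And>l m k. eventually (R l m k) sequentially"
  obtains r where "strict_mono r" "\<And>k. Q k (r k)" "\<And>l k. l < k \<Longrightarrow> R l (r l) k (r k)"
proof -
  \<comment> \<open>The recursion remembers only the last index \<open>m\<close>; asking for
    \<open>R\<close> at all smaller positions and indices covers every pair formed with an earlier
    choice.\<close>
  have "\<exists>n. m < n \<and> Q k n \<and> (\<forall>l\<in>{..k}. \<forall>m'\<in>{..m}. R l m' k n)" for k m
  proof -
    have "eventually (\<lambda>n. m < n \<and> Q k n \<and> (\<forall>l\<in>{..k}. \<forall>m'\<in>{..m}. R l m' k n)) sequentially"
      by (intro eventually_conj Q eventually_gt_at_top eventually_ball_finite finite_atMost ballI R)
    then show ?thesis by (auto simp: eventually_sequentially)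
  qed
  note ex = this
  define f where "f k m = (SOME n. m < n \<and> Q k n \<and> (\<forall>l\<in>{..k}. \<forall>m'\<in>{..m}. R l m' k n))" for k m
  have "m < f k m \<and> Q k (f k m) \<and> (\<forall>l\<in>{..k}. \<forall>m'\<in>{..m}. R l m' k (f k m))" for k m
    unfolding f_def by (rule someI_ex[OF ex])
  then have f: "\<And>k m. m < f k m" "\<And>k m. Q k (f k m)"
    "\<And>k m l m'. l \<le> k \<Longrightarrow> m' \<le> m \<Longrightarrow> R l m' k (f k m)"
    by auto
  define r where "r = rec_nat (f 0 0) (\<lambda>k a. f (Suc k) a)"
  have r0: "r 0 = f 0 0" and rS: "r (Suc k) = f (Suc k) (r k)" for k by (simp_all add: r_def)
  have sr: "strict_mono r"
    by (rule strict_mono_Suc_iff[THEN iffD2]) (simp add: rS f)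
  have "Q k (r k)" for k by (cases k) (simp_all add: r0 rS f)
  moreover have "R l (r l) k (r k)" if "l < k" for l k
  proof (cases k)
    case (Suc j)
    with that have "r l \<le> r j" using sr by (simp add: strict_mono_less_eq)
    with Suc that show ?thesis by (simp add: rS f)
  qed (use that in simp)
  ultimately show ?thesis using that[OF sr] by blast
qed

lemma sum_half_powers_le:
  assumes "finite F"
  shows "(\<Sum>k\<in>F. (1 / 2) ^ Suc k) \<le> (1 :: real)"
proof -
  have "(\<Sum>k\<in>F. (1 / 2) ^ Suc k) \<le> (\<Sum>k. (1 / 2) ^ Suc k :: real)"
    using assms by (intro sum_le_suminf sums_summable[OF power_half_series]) auto
  also have "\<dots> = 1" using power_half_series by (rule sums_unique[symmetric])
  finally show ?thesis .
qed

lemma sum_mult_half_powers_le: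
  assumes F: "finite F" and e: "0 \<le> e"
  shows "(\<Sum>k\<in>F. norm (a k) * (e * (1 / 2) ^ Suc k)) \<le> e * L2_set (\<lambda>k. norm (a k)) F"
proof -
  let ?A = "L2_set (\<lambda>k. norm (a k)) F"
  have "norm (a k) \<le> ?A" if "k \<in> F" for k by (rule member_le_L2_set[OF F that])
  then have "(\<Sum>k\<in>F. norm (a k) * (e * (1 / 2) ^ Suc k)) \<le> (\<Sum>k\<in>F. ?A * (e * (1 / 2) ^ Suc k))"
    using e by (intro sum_mono mult_right_mono) auto
  also have "\<dots> = ?A * e * (\<Sum>k\<in>F. (1 / 2) ^ Suc k)" by (simp add: sum_distrib_left mult.assoc)
  also have "\<dots> \<le> ?A * e * 1"
    using e by (intro mult_left_mono sum_half_powers_le F mult_nonneg_nonneg L2_set_nonneg)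
  finally show ?thesis by (simp add: mult.commute)
qed

text \<open>The bounds on the off-diagonal inner products have product form, so their double sum is
  a square whose root \<open>sum_mult_half_powers_le\<close> controls.\<close>

lemma norm_sum_near_orthogonal:
  fixes d :: "nat \<Rightarrow> 'k::real_or_complex ell2" and a :: "nat \<Rightarrow> 'k"
  assumes F: "finite F" and e: "0 \<le> e"
    and orth: "\<And>k l. k \<noteq> l \<Longrightarrow> norm (ell2_inner (d k) (d l)) \<le> (e * (1 / 2) ^ Suc k) * (e * (1 / 2) ^ Suc l)"
  shows "\<bar>(norm (\<Sum>k\<in>F. ell2_scale (a k) (d k)))\<^sup>2 - (\<Sum>k\<in>F. (norm (a k))\<^sup>2 * (norm (d k))\<^sup>2)\<bar>
      \<le> (e * L2_set (\<lambda>k. norm (a k)) F)\<^sup>2"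
proof -
  let ?v = "\<Sum>k\<in>F. ell2_scale (a k) (d k)" and ?e = "\<lambda>k. e * (1 / 2) ^ Suc k"
  define t where "t k l = a k * scalar_cnj (a l) * ell2_inner (d k) (d l)" for k l
  have diag: "t k k = of_real ((norm (a k))\<^sup>2 * (norm (d k))\<^sup>2)" for k
    unfolding t_def mult_scalar_cnj ell2_inner_self by simp
  have "(of_real ((norm ?v)\<^sup>2) :: 'k) = (\<Sum>k\<in>F. \<Sum>l\<in>F. t k l)"
    unfolding ell2_inner_self[symmetric] ell2_inner_sum_left ell2_inner_sum_right
      ell2_inner_scale_left ell2_inner_scale_right t_def
    by (simp add: sum_distrib_left mult_ac) (rule sum.swap)
  also have "\<dots> = (\<Sum>k\<in>F. t k k + (\<Sum>l\<in>F - {k}. t k l))"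
    using F by (intro sum.cong refl sum.remove)
  also have "\<dots> = of_real (\<Sum>k\<in>F. (norm (a k))\<^sup>2 * (norm (d k))\<^sup>2) + (\<Sum>k\<in>F. \<Sum>l\<in>F - {k}. t k l)"
    by (simp add: sum.distrib diag)
  finally have "(of_real ((norm ?v)\<^sup>2 - (\<Sum>k\<in>F. (norm (a k))\<^sup>2 * (norm (d k))\<^sup>2)) :: 'k)
      = (\<Sum>k\<in>F. \<Sum>l\<in>F - {k}. t k l)"
    by (simp only: of_real_diff) simp
  then have "\<bar>(norm ?v)\<^sup>2 - (\<Sum>k\<in>F. (norm (a k))\<^sup>2 * (norm (d k))\<^sup>2)\<bar> = norm (\<Sum>k\<in>F. \<Sum>l\<in>F - {k}. t k l)"
    unfolding norm_of_real[where 'a = 'k, symmetric] by simp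
  also have "\<dots> \<le> (\<Sum>k\<in>F. \<Sum>l\<in>F - {k}. norm (a k) * norm (a l) * (?e k * ?e l))"
  proof (intro sum_norm_le order_trans[OF norm_sum] sum_mono)
    fix k l assume "k \<in> F" "l \<in> F - {k}"
    then have "norm (ell2_inner (d k) (d l)) \<le> ?e k * ?e l" by (intro orth) auto
    then show "norm (t k l) \<le> norm (a k) * norm (a l) * (?e k * ?e l)"
      unfolding t_def norm_mult norm_scalar_cnj by (intro mult_left_mono) auto
  qed
  also have "\<dots> \<le> (\<Sum>k\<in>F. \<Sum>l\<in>F. norm (a k) * norm (a l) * (?e k * ?e l))"
    using F e by (intro sum_mono sum_mono2) auto
  also have "\<dots> = (\<Sum>k\<in>F. norm (a k) * ?e k)\<^sup>2"
    unfolding power2_eq_square sum_product by (intro sum.cong refl) (simp add: mult_ac)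
  also have "\<dots> \<le> (e * L2_set (\<lambda>k. norm (a k)) F)\<^sup>2"
    using e by (intro power_mono sum_mult_half_powers_le F e sum_nonneg) auto
  finally show ?thesis .
qed

text \<open>Both bounds are roots of the preceding one: C^2 + e^2 is at most (C + e)^2, and b^2 -
  e^2 is at least (b / 2)^2 if e is at most b / 2.\<close>

lemma
  fixes d :: "nat \<Rightarrow> 'k::real_or_complex ell2" and a :: "nat \<Rightarrow> 'k"
  assumes F: "finite F" and e: "0 \<le> e"
    and orth: "\<And>k l. k \<noteq> l \<Longrightarrow> norm (ell2_inner (d k) (d l)) \<le> (e * (1 / 2) ^ Suc k) * (e * (1 / 2) ^ Suc l)"
  shows norm_sum_near_orthogonal_le: "(\<And>k. norm (d k) \<le> C) \<Longrightarrow>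
      norm (\<Sum>k\<in>F. ell2_scale (a k) (d k)) \<le> (C + e) * L2_set (\<lambda>k. norm (a k)) F"
    and norm_sum_near_orthogonal_ge: "(\<And>k. b \<le> norm (d k)) \<Longrightarrow> 2 * e \<le> b \<Longrightarrow>
      b / 2 * L2_set (\<lambda>k. norm (a k)) F \<le> norm (\<Sum>k\<in>F. ell2_scale (a k) (d k))"
proof -
  let ?A = "L2_set (\<lambda>k. norm (a k)) F" and ?v = "\<Sum>k\<in>F. ell2_scale (a k) (d k)"
  have A: "0 \<le> ?A" "?A\<^sup>2 = (\<Sum>k\<in>F. (norm (a k))\<^sup>2)"
    by (simp_all add: L2_set_nonneg L2_set_def sum_nonneg)
  note o = norm_sum_near_orthogonal[OF assms, of a]
  {
    assume C: "\<And>k. norm (d k) \<le> C"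
    then have C0: "0 \<le> C" using norm_ge_zero order_trans by blast
    have "(\<Sum>k\<in>F. (norm (a k))\<^sup>2 * (norm (d k))\<^sup>2) \<le> (\<Sum>k\<in>F. (norm (a k))\<^sup>2 * C\<^sup>2)"
      using C by (intro sum_mono mult_left_mono power_mono) auto
    also have "\<dots> = C\<^sup>2 * ?A\<^sup>2" unfolding A(2) by (simp add: sum_distrib_left mult.commute)
    finally have "(norm ?v)\<^sup>2 \<le> C\<^sup>2 * ?A\<^sup>2 + (e * ?A)\<^sup>2" using o by linarith
    also have "\<dots> = (C\<^sup>2 + e\<^sup>2) * ?A\<^sup>2" by (simp add: power_mult_distrib algebra_simps)
    also have "\<dots> \<le> (C + e)\<^sup>2 * ?A\<^sup>2"
      using C0 e by (intro mult_right_mono) (auto simp: power2_sum)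
    also have "\<dots> = ((C + e) * ?A)\<^sup>2" by (simp add: power_mult_distrib)
    finally show "norm ?v \<le> (C + e) * ?A"
      by (rule power2_le_imp_le) (use C0 e A(1) in simp)
  next
    assume b: "\<And>k. b \<le> norm (d k)" "2 * e \<le> b"
    have "b\<^sup>2 * ?A\<^sup>2 = (\<Sum>k\<in>F. (norm (a k))\<^sup>2 * b\<^sup>2)"
      unfolding A(2) by (simp add: sum_distrib_left mult.commute)
    also have "\<dots> \<le> (\<Sum>k\<in>F. (norm (a k))\<^sup>2 * (norm (d k))\<^sup>2)"
      using b e by (intro sum_mono mult_left_mono power_mono) auto
    finally have "b\<^sup>2 * ?A\<^sup>2 - (e * ?A)\<^sup>2 \<le> (norm ?v)\<^sup>2" using o by linarith
    moreover have "(e * ?A)\<^sup>2 \<le> (b / 2 * ?A)\<^sup>2"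
      using b e A(1) by (intro power_mono mult_right_mono) auto
    moreover have "(b / 2 * ?A)\<^sup>2 = b\<^sup>2 * ?A\<^sup>2 / 4" by (simp add: power_mult_distrib power_divide)
    moreover have "0 \<le> b\<^sup>2 * ?A\<^sup>2" by simp
    ultimately have "(b / 2 * ?A)\<^sup>2 \<le> (norm ?v)\<^sup>2" by linarith
    then show "b / 2 * ?A \<le> norm ?v" by (rule power2_le_imp_le) simp
  }
qed

lemma kp_span_range:
  assumes "u \<in> kp.span (range w)"
  shows "\<exists>F a. finite F \<and> u = (\<Sum>k\<in>F. kp_scale (a k) (w (k :: nat)))"
  using assms
proof (induction rule: kp.span_induct_alt)
  case base
  show ?case by (rule exI[of _ "{}"]) simp
next
  case (step c x y)
  then obtain F a i where F: "finite F" "y = (\<Sum>k\<in>F. kp_scale (a k) (w k))" "x = w i" by blast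
  \<comment> \<open>\<open>i\<close> may already occur in \<open>F\<close>; extending the
    coefficients by 0 allows them to be added.\<close>
  define a' where "a' k = (if k \<in> F then a k else 0)" for k
  define b where "b k = a' k + (if k = i then c else 0)" for k
  have fin: "finite (insert i F)" using F(1) by simp
  have 1: "(\<Sum>k\<in>insert i F. kp_scale (a' k) (w k)) = y"
    unfolding F(2) by (rule sum.mono_neutral_cong_right[OF fin]) (auto simp: a'_def)
  have 2: "(\<Sum>k\<in>insert i F. kp_scale (if k = i then c else 0) (w k)) = kp_scale c x"
  proof -
    have "(\<Sum>k\<in>insert i F. kp_scale (if k = i then c else 0) (w k)) = (\<Sum>k\<in>{i}. kp_scale c (w k))"
      by (rule sum.mono_neutral_cong_right[OF fin]) auto
    then show ?thesis by (simp add: F(3))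
  qed
  have "kp_scale c x + y = (\<Sum>k\<in>insert i F. kp_scale (b k) (w k))"
    unfolding b_def kp.scale_left_distrib sum.distrib 1 2 by simp
  then show ?case using fin by blast
qed

text \<open>
  Along a subsequence both \<open>x\<close> and \<open>d\<close> are almost orthogonal, so that \<open>S\<close> is bounded below on the
  span of that subsequence of \<open>x\<close> in the kernel of the quotient map.
\<close>

lemma not_strictly_singular:
  fixes S :: "'k::real_or_complex kalton_peck \<Rightarrow> 'k kalton_peck"
  assumes S: "S \<in> kp_ops" and x: "ell2_null x" and d: "ell2_null d"
    and b: "0 < b" "\<And>n. b \<le> norm (d n)"
    and t: "(\<lambda>n. S (kp_incl (x n)) - t n) \<longlonglongrightarrow> 0"
    and dom: "\<And>F a r. finite F \<Longrightarrow> norm (\<Sum>k\<in>F. ell2_scale (a k) (d (r k)))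
        \<le> 4 * norm (\<Sum>k\<in>F. kp_scale (a k) (t (r (k :: nat))))"
  shows "S \<notin> strictly_singular_ops kp_scale norm"
proof
  assume SS: "S \<in> strictly_singular_ops kp_scale norm"
  obtain C where C: "0 < C" "\<And>n. norm (x n) \<le> C" using ell2_null_boundE[OF x] by blast
  \<comment> \<open>Thus b / 2 = 8 e. The factor 4 of \<open>dom\<close> turns the approximation
    error \<open>e\<close> into 4 e, and the remaining 4 e yield the lower bound \<open>e\<close>
    for \<open>S\<close>.\<close>
  define e where "e = b / 16"
  let ?e = "\<lambda>k::nat. e * (1 / 2) ^ Suc k"
  have e: "0 < e" "0 \<le> e" "2 * e \<le> b" using b by (simp_all add: e_def)
  have ek: "0 < ?e k" for k using e by simp
  have sym: "norm (ell2_inner y z) = norm (ell2_inner z y)" for y z :: "'k ell2"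
    by (subst ell2_inner_commute) simp
  have ev: "eventually (\<lambda>n. norm (ell2_inner (y m) (y n)) \<le> ?e l * ?e k) sequentially"
    if "ell2_null y" for y :: "nat \<Rightarrow> 'k ell2" and l m k
  proof -
    have "eventually (\<lambda>n. norm (ell2_inner (y n) (y m)) < ?e l * ?e k) sequentially"
      using tendsto_norm_zero[OF ell2_null_inner[OF that]] mult_pos_pos[OF ek ek] by (rule order_tendstoD)
    then show ?thesis by eventually_elim (simp only: sym[of "y m"] less_imp_le)
  qed
  have evt: "eventually (\<lambda>n. norm (S (kp_incl (x n)) - t n) \<le> ?e k) sequentially" for k
  proof -
    have "eventually (\<lambda>n. norm (S (kp_incl (x n)) - t n) < ?e k) sequentially"
      using tendsto_norm_zero[OF t] ek by (rule order_tendstoD)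
    then show ?thesis by eventually_elim (rule less_imp_le)
  qed
  obtain r where r: "strict_mono r" and rt: "\<And>k. norm (S (kp_incl (x (r k))) - t (r k)) \<le> ?e k"
    and ro: "\<And>l k. l < k \<Longrightarrow> norm (ell2_inner (x (r l)) (x (r k))) \<le> ?e l * ?e k \<and>
      norm (ell2_inner (d (r l)) (d (r k))) \<le> ?e l * ?e k"
    by (rule subsequence_selection[of "\<lambda>k n. norm (S (kp_incl (x n)) - t n) \<le> ?e k"
        "\<lambda>l m k n. norm (ell2_inner (x m) (x n)) \<le> ?e l * ?e k \<and>
          norm (ell2_inner (d m) (d n)) \<le> ?e l * ?e k"])
      (intro evt eventually_conj ev x d | blast)+
  have ox: "norm (ell2_inner (x (r k)) (x (r l))) \<le> ?e k * ?e l" if "k \<noteq> l" for k l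
    using ro[of k l] ro[of l k] that sym[of "x (r k)"]
    by (cases "k < l") (auto simp: mult.commute simp del: power_Suc)
  have od: "norm (ell2_inner (d (r k)) (d (r l))) \<le> ?e k * ?e l" if "k \<noteq> l" for k l
    using ro[of k l] ro[of l k] that sym[of "d (r k)"]
    by (cases "k < l") (auto simp: mult.commute simp del: power_Suc)
  define w where "w k = kp_incl (x (r k))" for k
  define comb where "comb F a = (\<Sum>k\<in>F. kp_scale (a k) (w k))" for F and a :: "nat \<Rightarrow> 'k"
  have lower: "e * L2_set (\<lambda>k. norm (a k)) F \<le> norm (S (comb F a))" if F: "finite F" for F a
  proof -
    let ?A = "L2_set (\<lambda>k. norm (a k)) F"
    have "S (comb F a) = (\<Sum>k\<in>F. kp_scale (a k) (S (w k)))"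
      unfolding comb_def linear_sum[OF bounded_linear.linear[OF kp_ops_bounded_linear[OF S]]]
        kp_ops_scale[OF S] ..
    also have "\<dots> = (\<Sum>k\<in>F. kp_scale (a k) (t (r k))) + (\<Sum>k\<in>F. kp_scale (a k) (S (w k) - t (r k)))"
      by (simp add: kp.scale_right_diff_distrib sum_subtractf)
    finally have eq: "(\<Sum>k\<in>F. kp_scale (a k) (t (r k))) = S (comb F a) - (\<Sum>k\<in>F. kp_scale (a k) (S (w k) - t (r k)))"
      by simp
    have "b / 2 * ?A \<le> norm (\<Sum>k\<in>F. ell2_scale (a k) (d (r k)))"
      by (rule norm_sum_near_orthogonal_ge[OF F e(2) od b(2) e(3)])
    also have "\<dots> \<le> 4 * norm (\<Sum>k\<in>F. kp_scale (a k) (t (r k)))"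
      by (rule dom[OF F])
    also have "norm (\<Sum>k\<in>F. kp_scale (a k) (t (r k))) \<le> norm (S (comb F a)) + norm (\<Sum>k\<in>F. kp_scale (a k) (S (w k) - t (r k)))"
      unfolding eq by (rule norm_triangle_ineq4)
    also have "norm (\<Sum>k\<in>F. kp_scale (a k) (S (w k) - t (r k))) \<le> (\<Sum>k\<in>F. norm (a k) * ?e k)"
      using rt by (intro sum_norm_le) (auto simp: w_def intro!: mult_left_mono simp del: power_Suc)
    also have "\<dots> \<le> e * ?A" by (rule sum_mult_half_powers_le[OF F e(2)])
    finally show ?thesis by (simp add: e_def)
  qed
  have upper: "norm (comb F a) \<le> 2 * ((C + e) * L2_set (\<lambda>k. norm (a k)) F)" if F: "finite F" for F a
  proof -
    have "comb F a = kp_incl (\<Sum>k\<in>F. ell2_scale (a k) (x (r k)))"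
      unfolding comb_def w_def kp_incl_sum kp_incl_scale ..
    then have "norm (comb F a) \<le> 2 * norm (\<Sum>k\<in>F. ell2_scale (a k) (x (r k)))"
      by (simp add: norm_incl_le)
    also have "norm (\<Sum>k\<in>F. ell2_scale (a k) (x (r k))) \<le> (C + e) * L2_set (\<lambda>k. norm (a k)) F"
      by (rule norm_sum_near_orthogonal_le[OF F e(2) ox C(2)])
    finally show ?thesis by simp
  qed
  have zero: "a k = 0" if "finite F" "comb F a = 0" "k \<in> F" for F a k
  proof -
    have "S 0 = 0" using linear_0[OF bounded_linear.linear[OF kp_ops_bounded_linear[OF S]]] .
    then have "e * L2_set (\<lambda>k. norm (a k)) F \<le> 0" using lower[OF that(1), of a] that(2) by simp
    then have "L2_set (\<lambda>k. norm (a k)) F \<le> 0" using e by (simp add: mult_le_0_iff)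
    moreover have "norm (a k) \<le> L2_set (\<lambda>k. norm (a k)) F" by (rule member_le_L2_set[OF that(1,3)])
    ultimately show ?thesis by (metis norm_le_zero_iff order_trans)
  qed
  have inj: "inj w"
  proof (rule injI, rule ccontr)
    fix k l assume kl: "w k = w l" "k \<noteq> l"
    let ?a = "\<lambda>i. if i = k then 1 else - 1 :: 'k"
    have "comb {k, l} ?a = 0" using kl by (simp add: comb_def)
    from zero[OF _ this, of k] show False by simp
  qed
  have ind: "kp.independent (range w)"
  proof
    assume "kp.dependent (range w)"
    then obtain T c where T: "finite T" "T \<subseteq> range w" "(\<Sum>v\<in>T. kp_scale (c v) v) = 0" "\<exists>v\<in>T. c v \<noteq> 0"
      unfolding kp.dependent_explicit by blast
    obtain F where F: "finite F" "T = w ` F" using finite_subset_image[OF T(1,2)] by blast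
    have "comb F (\<lambda>k. c (w k)) = (\<Sum>v\<in>T. kp_scale (c v) v)"
      unfolding comb_def F(2) using inj by (subst sum.reindex) (auto intro: inj_on_subset)
    then have "comb F (\<lambda>k. c (w k)) = 0" using T(3) by simp
    from zero[OF F(1) this] show False using T(4) F(2) by blast
  qed
  have "\<not> kp.span (range w) \<subseteq> kp.span B" if "finite B" for B
  proof
    assume "kp.span (range w) \<subseteq> kp.span B"
    then have "range w \<subseteq> kp.span B" using kp.span_superset by blast
    then have "finite (range w)" using kp.independent_span_bound[OF that ind] by blast
    then show False using inj by (simp add: finite_image_iff)
  qed
  moreover have "0 < e / (2 * (C + e))" using e C by simp
  ultimately obtain u where u: "u \<in> kp.span (range w)" "norm (S u) < e / (2 * (C + e)) * norm u"
    using strictly_singular_not_bounded_below[OF SS kp.subspace_span] by blast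
  obtain F a where F: "finite F" "u = comb F a"
    using kp_span_range[OF u(1)] unfolding comb_def by blast
  have "norm (S u) < e / (2 * (C + e)) * norm u" by (rule u(2))
  also have "\<dots> \<le> e / (2 * (C + e)) * (2 * ((C + e) * L2_set (\<lambda>k. norm (a k)) F))"
    unfolding F(2) using e C by (intro mult_left_mono upper F) auto
  also have "\<dots> = e * L2_set (\<lambda>k. norm (a k)) F"
  proof -
    have "e / (2 * D) * (2 * (D * t)) = e * t" if "0 < D" for D t :: real using that by simp
    from this[OF add_pos_pos[OF C(1) e(1)]] show ?thesis .
  qed
  also have "\<dots> \<le> norm (S u)" unfolding F(2) by (rule lower[OF F(1)])
  finally show False by simp
qed

text \<open>If \<open>S\<close> does not tend to 0 along a null sequence of the kernel, a part of
  the images bounds \<open>S\<close> from below on a subspace: their quotients if these are not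
  null, and otherwise their defects, the images then being close to the kernel.
  \<open>not_strictly_singular\<close> is applied with this part as \<open>d\<close>, and with the
  images themselves or the copies of \<open>d\<close> in the kernel as \<open>t\<close>.\<close>

lemma strictly_singular_compact_on_kernel:
  fixes S :: "'k::real_or_complex kalton_peck \<Rightarrow> 'k kalton_peck"
  assumes SS: "S \<in> strictly_singular_ops kp_scale norm"
  shows "compact_on_kernel S"
  unfolding compact_on_kernel_def
proof (intro allI impI, rule ccontr)
  fix x :: "nat \<Rightarrow> 'k ell2"
  assume x: "ell2_null x" and n: "\<not> (\<lambda>n. S (kp_incl (x n))) \<longlonglongrightarrow> 0"
  have S: "S \<in> kp_ops" using SS by (simp add: strictly_singular_iff)
  obtain c and q :: "nat \<Rightarrow> nat" where c: "0 < c" and q: "strict_mono q"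
    and cq: "\<And>n. c \<le> norm (S (kp_incl (x (q n))))"
    by (rule not_tendsto_zero_subseq[OF n]) blast
  define y where "y n = x (q n)" for n
  define s where "s n = S (kp_incl (y n))" for n
  have y: "ell2_null y" unfolding y_def by (rule ell2_null_filterlim[OF x filterlim_subseq[OF q]])
  have s: "kp_null s" unfolding s_def by (rule kp_null_ops[OF S kp_null_incl[OF y]])
  have quot4: "norm (kp_quot z) \<le> 4 * norm z" for z :: "'k kalton_peck"
    using norm_quot_le[of z] norm_ge_zero[of z] by linarith
  have cs: "c \<le> norm (s n)" for n unfolding s_def y_def by (rule cq)
  show False
  proof (cases "(\<lambda>n. kp_quot (s n)) \<longlonglongrightarrow> 0")
    case False
    obtain b and r :: "nat \<Rightarrow> nat" where b: "0 < b" and r: "strict_mono r"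
      and br: "\<And>n. b \<le> norm (kp_quot (s (r n)))"
      by (rule not_tendsto_zero_subseq[OF False]) blast
    have "S \<notin> strictly_singular_ops kp_scale norm"
    proof (rule not_strictly_singular[OF S _ _ b br])
      show "ell2_null (\<lambda>n. y (r n))" by (rule ell2_null_filterlim[OF y filterlim_subseq[OF r]])
      show "ell2_null (\<lambda>n. kp_quot (s (r n)))"
        by (rule kp_null_quot[OF kp_null_filterlim[OF s filterlim_subseq[OF r]]])
      show "(\<lambda>n. S (kp_incl (y (r n))) - s (r n)) \<longlonglongrightarrow> 0" by (simp add: s_def)
      fix F :: "nat set" and a :: "nat \<Rightarrow> 'k" and r'
      have "(\<Sum>k\<in>F. ell2_scale (a k) (kp_quot (s (r (r' k))))) = kp_quot (\<Sum>k\<in>F. kp_scale (a k) (s (r (r' k))))"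
        by (simp add: kp_quot_sum kp_quot_scale)
      then show "norm (\<Sum>k\<in>F. ell2_scale (a k) (kp_quot (s (r (r' k)))))
          \<le> 4 * norm (\<Sum>k\<in>F. kp_scale (a k) (s (r (r' k))))"
        by (simp only: quot4)
    qed
    with SS show False by blast
  next
    case True
    \<comment> \<open>As the norm is at most twice the quasi-norm, this leaves at least c / 2 - c /
      4 for the defect.\<close>
    then have "eventually (\<lambda>n. norm (kp_quot (s n)) < c / 4) sequentially"
      using c by (intro order_tendstoD(2)[OF tendsto_norm_zero]) auto
    then obtain M where M: "\<And>n. n \<ge> M \<Longrightarrow> norm (kp_quot (s n)) < c / 4"
      by (auto simp: eventually_sequentially)
    have shift: "filterlim (\<lambda>n. n + M) at_top sequentially" by (rule filterlim_add_const_nat_at_top)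
    have "S \<notin> strictly_singular_ops kp_scale norm"
    proof (rule not_strictly_singular[OF S])
      show "ell2_null (\<lambda>n. y (n + M))" by (rule ell2_null_filterlim[OF y shift])
      show "ell2_null (\<lambda>n. kp_defect (s (n + M)))"
        by (rule kp_null_defect[OF kp_null_filterlim[OF s shift]])
      show "0 < c / 4" using c by simp
      show "c / 4 \<le> norm (kp_defect (s (n + M)))" for n
        using norm_kp_le_qnorm[of "s (n + M)"] cs[of "n + M"] M[of "n + M"] by (simp add: kp_qnorm_eq)
      have "(\<lambda>n. kp_quot (s (n + M))) \<longlonglongrightarrow> 0" using True by (rule LIMSEQ_ignore_initial_segment)
      then have "(\<lambda>n. 2 * norm (kp_quot (s (n + M)))) \<longlonglongrightarrow> 2 * norm (0 :: 'k ell2)"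
        by (intro tendsto_intros)
      then have "(\<lambda>n. 2 * norm (kp_quot (s (n + M)))) \<longlonglongrightarrow> 0" by simp
      then have "(\<lambda>n. kp_section (kp_quot (s (n + M)))) \<longlonglongrightarrow> 0"
        by (rule Lim_null_comparison[rotated]) (simp add: norm_section_le)
      moreover have "kp_section (kp_quot (s m)) = S (kp_incl (y m)) - kp_incl (kp_defect (s m))" for m
        using kp_decompose[of "s m"] by (simp add: s_def algebra_simps)
      ultimately show "(\<lambda>n. S (kp_incl (y (n + M))) - kp_incl (kp_defect (s (n + M)))) \<longlonglongrightarrow> 0" by simp
      fix F :: "nat set" and a :: "nat \<Rightarrow> 'k" and r'
      have "(\<Sum>k\<in>F. kp_scale (a k) (kp_incl (kp_defect (s (r' k + M))))) = kp_incl (\<Sum>k\<in>F. ell2_scale (a k) (kp_defect (s (r' k + M))))"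
        by (simp add: kp_incl_sum kp_incl_scale)
      then show "norm (\<Sum>k\<in>F. ell2_scale (a k) (kp_defect (s (r' k + M))))
          \<le> 4 * norm (\<Sum>k\<in>F. kp_scale (a k) (kp_incl (kp_defect (s (r' k + M)))))"
        by (simp only: norm_le_norm_incl)
    qed
    with SS show False by blast
  qed
qed

lemma strictly_singular_ops_eq:
  "strictly_singular_ops kp_scale norm = {S \<in> kp_ops. compact_on_kernel S}"
proof -
  have "S \<in> kp_ops" if "S \<in> strictly_singular_ops kp_scale norm" for S :: "'a kalton_peck \<Rightarrow> 'a kalton_peck"
    using that by (simp add: strictly_singular_iff)
  then show ?thesis
    using strictly_singular_compact_on_kernel compact_on_kernel_strictly_singular by blast
qed

section \<open>Hadamard blocks\<close>

text \<open>Sylvester's construction on binary digits: each step consumes the last digit of both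
  indices and contributes their sign, and the Kronecker delta of the remaining higher digits makes
  the whole a direct sum of infinitely many blocks of size 2 ^ m.\<close>

fun hadamard :: "nat \<Rightarrow> nat \<Rightarrow> nat \<Rightarrow> real" where
  "hadamard 0 i j = (if i = j then 1 else 0)"
| "hadamard (Suc m) i j =
    (if odd i \<and> odd j then - 1 else 1) / sqrt 2 * hadamard m (i div 2) (j div 2)"

lemma hadamard_commute: "hadamard m i j = hadamard m j i"
proof (induction m arbitrary: i j)
  case (Suc m)
  show ?case using Suc[of "i div 2" "j div 2"] by simp
qed simp

lemma abs_hadamard:
  "\<bar>hadamard m i j\<bar> = (if i div 2 ^ m = j div 2 ^ m then 1 / sqrt (2 ^ m) else 0)"
proof (induction m arbitrary: i j)
  case (Suc m)
  have "\<bar>hadamard (Suc m) i j\<bar> = 1 / sqrt 2 * \<bar>hadamard m (i div 2) (j div 2)\<bar>"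
    by (simp add: abs_mult)
  then show ?case
    unfolding Suc by (simp add: div_mult2_eq real_sqrt_mult)
qed simp

lemma hadamard_eq_0: "i div 2 ^ m \<noteq> j div 2 ^ m \<Longrightarrow> hadamard m i j = 0"
  using abs_hadamard[of m i j] by simp

lemma sum_lessThan_double: "(\<Sum>l<2 * n. f l) = (\<Sum>l<n. f (2 * l) + f (Suc (2 * l)))"
  for f :: "nat \<Rightarrow> 'a::comm_monoid_add"
  by (induction n) (simp_all add: add.assoc)

text \<open>Splitting \<open>l\<close> by its last digit leaves the sum for the halved indices times
  the factor \<open>?c\<close>, which is 1 if \<open>i\<close> and \<open>j\<close> have the same
  parity and 0 otherwise.\<close>

lemma hadamard_orthogonal:
  assumes "i < 2 ^ m * M"
  shows "(\<Sum>l<2 ^ m * M. hadamard m i l * hadamard m l j) = (if i = j then 1 else 0)"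
  using assms
proof (induction m arbitrary: i j)
  case 0
  have "(\<Sum>l<M. hadamard 0 i l * hadamard 0 l j) = (\<Sum>l<M. if l = i then if i = j then 1 else 0 else 0)"
    by (intro sum.cong) auto
  with 0 show ?case by (simp del: hadamard.simps)
next
  case (Suc m)
  let ?s = "\<lambda>i l. if odd i \<and> odd l then - 1 else 1 :: real"
  let ?c = "(1 + (if odd i then - 1 else 1) * (if odd j then - 1 else 1)) / 2 :: real"
  have "(\<Sum>l<2 ^ Suc m * M. hadamard (Suc m) i l * hadamard (Suc m) l j)
      = (\<Sum>l<2 ^ m * M. hadamard (Suc m) i (2 * l) * hadamard (Suc m) (2 * l) j
          + hadamard (Suc m) i (Suc (2 * l)) * hadamard (Suc m) (Suc (2 * l)) j)"
    using sum_lessThan_double[of "\<lambda>l. hadamard (Suc m) i l * hadamard (Suc m) l j" "2 ^ m * M"]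
    by (simp only: power_Suc mult.assoc)
  also have "\<dots> = (\<Sum>l<2 ^ m * M. ?c * (hadamard m (i div 2) l * hadamard m l (j div 2)))"
    by (intro sum.cong refl) (simp add: field_simps)
  also have "\<dots> = ?c * (if i div 2 = j div 2 then 1 else 0)"
    unfolding sum_distrib_left[symmetric] using Suc by (subst Suc.IH) auto
  also have "\<dots> = (if i = j then 1 else 0)"
  proof (cases "odd i = odd j")
    case True
    then have "i = j \<longleftrightarrow> i div 2 = j div 2" by (metis div_mult_mod_eq odd_iff_mod_2_eq_one mod2_eq_if)
    with True show ?thesis by auto
  qed auto
  finally show ?case .
qed

definition dyadic_block :: "nat \<Rightarrow> nat \<Rightarrow> nat set" where
  "dyadic_block m q = {l. l div 2 ^ m = q}"

lemma dyadic_block_eq: "dyadic_block m q = (\<lambda>a. 2 ^ m * q + a) ` {..<2 ^ m}"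
proof (intro set_eqI iffI)
  fix l assume "l \<in> dyadic_block m q"
  then have "l = 2 ^ m * q + l mod 2 ^ m" by (auto simp: dyadic_block_def)
  then show "l \<in> (\<lambda>a. 2 ^ m * q + a) ` {..<2 ^ m}"
    by (rule image_eqI[of _ _ "l mod 2 ^ m"]) simp
qed (auto simp: dyadic_block_def)

lemma finite_dyadic_block [simp]: "finite (dyadic_block m q)"
  by (simp add: dyadic_block_eq)

lemma card_dyadic_block [simp]: "card (dyadic_block m q) = 2 ^ m"
  by (simp add: dyadic_block_eq card_image inj_on_def)

lemma hadamard_block_orthogonal:
  "(\<Sum>l\<in>dyadic_block m (i div 2 ^ m). hadamard m i l * hadamard m l j) = (if i = j then 1 else 0)"
proof -
  let ?M = "Suc (i div 2 ^ m)"
  have "2 ^ m * (i div 2 ^ m) + i mod 2 ^ m = i" "i mod 2 ^ m < 2 ^ m"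
    "2 ^ m * ?M = 2 ^ m * (i div 2 ^ m) + 2 ^ m" by simp_all
  then have i: "i < 2 ^ m * ?M" by linarith
  have "dyadic_block m (i div 2 ^ m) \<subseteq> {..<2 ^ m * ?M}"
    by (auto simp: dyadic_block_eq)
  then have "(\<Sum>l<2 ^ m * ?M. hadamard m i l * hadamard m l j)
      = (\<Sum>l\<in>dyadic_block m (i div 2 ^ m). hadamard m i l * hadamard m l j)"
    by (intro sum.mono_neutral_right) (auto simp: dyadic_block_def hadamard_eq_0)
  with hadamard_orthogonal[OF i, of j] show ?thesis by simp
qed

section \<open>Block matrices as sums of weighted permutations\<close>

lemma l2_permute:
  assumes "bij \<pi>" "l2 x"
  shows "l2 (\<lambda>n. x (\<pi> n))" "l2_norm (\<lambda>n. x (\<pi> n)) = l2_norm x"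
proof -
  have p: "inj \<pi>" "range \<pi> = UNIV" using assms(1) by (simp_all add: bij_def)
  have s: "summable (\<lambda>n. (norm (x n))\<^sup>2)" using assms(2) by (simp add: l2_def)
  show "l2 (\<lambda>n. x (\<pi> n))"
    using summable_reindex[OF s p(1)] by (simp add: l2_def comp_def)
  show "l2_norm (\<lambda>n. x (\<pi> n)) = l2_norm x"
    using suminf_reindex[OF s p(1)] p(2) by (simp add: l2_norm_def comp_def)
qed

text \<open>Because the weights have constant modulus, weighted permutations commute with \<open>\<Omega>\<close>.\<close>

lemma kp_weighted_permutation:
  fixes c :: "nat \<Rightarrow> 'k::real_or_complex"
  assumes \<pi>: "bij \<pi>" and c: "\<And>n. norm (c n) = \<rho>"
  shows "\<exists>W\<in>kp_ops. \<forall>u n. kp_fst (W u) n = c n * kp_fst u (\<pi> n) \<and> kp_snd (W u) n = c n * kp_snd u (\<pi> n)"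
proof -
  have \<rho>: "0 \<le> \<rho>" using c[of 0] norm_ge_zero[of "c 0"] by simp
  have l2: "l2 (\<lambda>n. c n * x (\<pi> n))" and nrm: "l2_norm (\<lambda>n. c n * x (\<pi> n)) = \<rho> * l2_norm x"
    if x: "l2 x" for x :: "nat \<Rightarrow> 'k"
  proof -
    show "l2 (\<lambda>n. c n * x (\<pi> n))"
      by (rule l2_bound[OF l2_permute(1)[OF \<pi> x], where C = \<rho>]) (simp add: norm_mult c)
    have "l2_norm (\<lambda>n. c n * x (\<pi> n)) = l2_norm (\<lambda>n. of_real \<rho> * x (\<pi> n))"
      using \<rho> by (simp add: l2_norm_def norm_mult c)
    then show "l2_norm (\<lambda>n. c n * x (\<pi> n)) = \<rho> * l2_norm x"
      using \<rho> by (simp add: l2_norm_scale[OF l2_permute(1)[OF \<pi> x]] l2_permute(2)[OF \<pi> x])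
  qed
  have KP: "KP_map (\<lambda>n. c n * y (\<pi> n)) n = c n * KP_map y (\<pi> n)" if "l2 y" for y n
  proof (cases "c n = 0")
    case False
    then have "\<rho> \<noteq> 0" using c[of n] by auto
    then show ?thesis using False by (simp add: KP_map_def nrm[OF that] norm_mult c)
  qed (simp add: KP_map_def)
  define W where "W u = Abs_kalton_peck (\<lambda>n. c n * kp_fst u (\<pi> n), \<lambda>n. c n * kp_snd u (\<pi> n))" for u
  have mem: "l2 (kp_snd u)" "l2 (\<lambda>n. kp_fst u n - KP_map (kp_snd u) n)" for u :: "'k kalton_peck"
    using Rep_kalton_peck[of u] by (simp_all add: kp_fst.rep_eq[symmetric] kp_snd.rep_eq[symmetric])
  have "l2 (\<lambda>n. c n * kp_fst u (\<pi> n) - KP_map (\<lambda>n. c n * kp_snd u (\<pi> n)) n)" for u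
    using l2[OF mem(2)[of u]] by (simp add: KP[OF mem(1)] right_diff_distrib)
  then have rep: "Rep_kalton_peck (W u) = (\<lambda>n. c n * kp_fst u (\<pi> n), \<lambda>n. c n * kp_snd u (\<pi> n))" for u
    unfolding W_def by (subst Abs_kalton_peck_inverse) (simp_all add: l2[OF mem(1)])
  have W: "kp_fst (W u) n = c n * kp_fst u (\<pi> n)" "kp_snd (W u) n = c n * kp_snd u (\<pi> n)" for u n
    by (simp_all add: kp_fst.rep_eq[of "W u"] kp_snd.rep_eq[of "W u"] rep)
  have "kp_qnorm (W u) = \<rho> * kp_qnorm u" for u
  proof -
    have 1: "kp_snd (W u) = (\<lambda>n. c n * kp_snd u (\<pi> n))"
      by (rule ext) (rule W(2))
    have "(\<lambda>n. kp_fst (W u) n - KP_map (kp_snd (W u)) n) = (\<lambda>n. c n * (kp_fst u (\<pi> n) - KP_map (kp_snd u) (\<pi> n)))"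
      unfolding 1 KP[OF mem(1)] W(1) right_diff_distrib ..
    with 1 show ?thesis
      unfolding kp_qnorm_def by (simp only: nrm[OF mem(1)] nrm[OF mem(2)] distrib_left)
  qed
  then have bound: "norm (W u) \<le> (8 * \<rho>) * norm u" for u
    using norm_kp_le_qnorm[of "W u"] mult_left_mono[OF kp_qnorm_le[of u] \<rho>] by simp
  have "W \<in> kp_ops"
  proof (rule kp_opsI[OF _ _ bound])
    show "W (u + v) = W u + W v" for u v by (rule kp_eqI) (simp_all add: W distrib_left)
    show "W (kp_scale d u) = kp_scale d (W u)" for d u by (rule kp_eqI) (simp_all add: W)
  qed
  with W show ?thesis by blast
qed

lemma kp_ops_sum:
  assumes "finite I" "\<And>i. i \<in> I \<Longrightarrow> W i \<in> kp_ops"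
  shows "(\<lambda>u. \<Sum>i\<in>I. W i u) \<in> kp_ops"
  using assms
proof (induction I)
  case empty
  show ?case by (rule kp_opsI[where C = 0]) auto
next
  case (insert i I)
  then show ?case using kp_ops_plus[of "W i" "\<lambda>u. \<Sum>i\<in>I. W i u"] by simp
qed

lemma xor_div_power: "t < 2 ^ m \<Longrightarrow> (xor n t) div 2 ^ m = n div (2 ^ m :: nat)"
  by (simp add: drop_bit_eq_div[symmetric] drop_bit_xor) (simp add: drop_bit_eq_div)

lemma bij_xor: "bij (\<lambda>n :: nat. xor n t)"
  by (rule o_bij[of "\<lambda>n. xor n t"]) (simp_all add: fun_eq_iff xor.assoc)

lemma bij_betw_xor: "bij_betw (\<lambda>t. xor n t) {..<2 ^ m} (dyadic_block m (n div 2 ^ m))"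
proof (rule bij_betwI[of _ _ _ "\<lambda>t. xor n t"])
  show "(\<lambda>t. xor n t) \<in> {..<2 ^ m} \<rightarrow> dyadic_block m (n div 2 ^ m)"
    by (auto simp: dyadic_block_def xor_div_power)
  show "(\<lambda>t. xor n t) \<in> dyadic_block m (n div 2 ^ m) \<rightarrow> {..<2 ^ m}"
  proof
    fix l assume "l \<in> dyadic_block m (n div 2 ^ m)"
    then have "drop_bit m l = drop_bit m n"
      by (simp add: dyadic_block_def drop_bit_eq_div)
    then have "drop_bit m (xor n l) = 0"
      by (simp add: drop_bit_xor)
    then show "xor n l \<in> {..<2 ^ m}"
      by (simp add: drop_bit_eq_div div_eq_0_iff)
  qed
qed (simp_all flip: xor.assoc)

text \<open>For fixed \<open>t < 2 ^ m\<close> the map from \<open>n\<close> to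
  \<open>xor n t\<close> is a permutation preserving the blocks, along which the entries have
  constant modulus; for fixed \<open>n\<close> the values \<open>xor n t\<close> run through the
  block of \<open>n\<close>. The matrix is therefore a sum of 2 ^ m weighted permutations, each of
  which commutes with \<open>\<Omega>\<close>.\<close>

lemma hadamard_op_exists:
  "\<exists>T\<in>kp_ops :: ('k::real_or_complex kalton_peck \<Rightarrow> _) set. \<forall>u n.
     kp_fst (T u) n = (\<Sum>l\<in>dyadic_block m (n div 2 ^ m). of_real (hadamard m n l) * kp_fst u l) \<and>
     kp_snd (T u) n = (\<Sum>l\<in>dyadic_block m (n div 2 ^ m). of_real (hadamard m n l) * kp_snd u l)"
proof -
  have "\<exists>W\<in>kp_ops. \<forall>(u :: 'k kalton_peck) n.
      kp_fst (W u) n = of_real (hadamard m n (xor n t)) * kp_fst u (xor n t) \<and>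
      kp_snd (W u) n = of_real (hadamard m n (xor n t)) * kp_snd u (xor n t)" if "t < 2 ^ m" for t
    by (rule kp_weighted_permutation[OF bij_xor, where \<rho> = "1 / sqrt (2 ^ m)"])
      (simp add: abs_hadamard xor_div_power[OF that])
  then obtain W where W: "\<And>t. t < 2 ^ m \<Longrightarrow> W t \<in> kp_ops"
    "\<And>t (u :: 'k kalton_peck) n. t < 2 ^ m \<Longrightarrow> kp_fst (W t u) n = of_real (hadamard m n (xor n t)) * kp_fst u (xor n t)"
    "\<And>t (u :: 'k kalton_peck) n. t < 2 ^ m \<Longrightarrow> kp_snd (W t u) n = of_real (hadamard m n (xor n t)) * kp_snd u (xor n t)"
    by metis
  define T where "T u = (\<Sum>t\<in>{..<2 ^ m}. W t u)" for u
  have "T \<in> kp_ops" unfolding T_def[abs_def] by (rule kp_ops_sum) (use W(1) in auto)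
  moreover have "kp_fst (T u) n = (\<Sum>l\<in>dyadic_block m (n div 2 ^ m). of_real (hadamard m n l) * kp_fst u l)" for u n
    unfolding T_def kp_fst_sum sum.reindex_bij_betw[OF bij_betw_xor, symmetric]
    by (intro sum.cong refl) (simp add: W)
  moreover have "kp_snd (T u) n = (\<Sum>l\<in>dyadic_block m (n div 2 ^ m). of_real (hadamard m n l) * kp_snd u l)" for u n
    unfolding T_def kp_snd_sum sum.reindex_bij_betw[OF bij_betw_xor, symmetric]
    by (intro sum.cong refl) (simp add: W)
  ultimately show ?thesis by blast
qed

definition hadamard_op :: "nat \<Rightarrow> 'k::real_or_complex kalton_peck \<Rightarrow> 'k kalton_peck" where
  "hadamard_op m = (SOME T. T \<in> kp_ops \<and> (\<forall>u n.
     kp_fst (T u) n = (\<Sum>l\<in>dyadic_block m (n div 2 ^ m). of_real (hadamard m n l) * kp_fst u l) \<and>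
     kp_snd (T u) n = (\<Sum>l\<in>dyadic_block m (n div 2 ^ m). of_real (hadamard m n l) * kp_snd u l)))"

lemma
  shows hadamard_op_ops: "hadamard_op m \<in> (kp_ops :: ('a::real_or_complex kalton_peck \<Rightarrow> _) set)"
    and kp_fst_hadamard_op: "kp_fst (hadamard_op m u :: 'a kalton_peck) n =
      (\<Sum>l\<in>dyadic_block m (n div 2 ^ m). of_real (hadamard m n l) * kp_fst u l)"
    and kp_snd_hadamard_op: "kp_snd (hadamard_op m u :: 'a kalton_peck) n =
      (\<Sum>l\<in>dyadic_block m (n div 2 ^ m). of_real (hadamard m n l) * kp_snd u l)"
proof -
  let ?P = "\<lambda>T :: 'a kalton_peck \<Rightarrow> 'a kalton_peck. T \<in> kp_ops \<and> (\<forall>u n.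
     kp_fst (T u) n = (\<Sum>l\<in>dyadic_block m (n div 2 ^ m). of_real (hadamard m n l) * kp_fst u l) \<and>
     kp_snd (T u) n = (\<Sum>l\<in>dyadic_block m (n div 2 ^ m). of_real (hadamard m n l) * kp_snd u l))"
  have "?P (hadamard_op m)"
    unfolding hadamard_op_def by (rule someI_ex[of ?P]) (use hadamard_op_exists in blast)
  then show "hadamard_op m \<in> (kp_ops :: ('a kalton_peck \<Rightarrow> _) set)"
    "kp_fst (hadamard_op m u) n = (\<Sum>l\<in>dyadic_block m (n div 2 ^ m). of_real (hadamard m n l) * kp_fst u l)"
    "kp_snd (hadamard_op m u) n = (\<Sum>l\<in>dyadic_block m (n div 2 ^ m). of_real (hadamard m n l) * kp_snd u l)"
    for u :: "'a kalton_peck" and n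
    by blast+
qed

lemma hadamard_op_involution: "hadamard_op m (hadamard_op m u) = u"
proof -
  have *: "(\<Sum>l\<in>dyadic_block m (n div 2 ^ m). of_real (hadamard m n l) *
      (\<Sum>k\<in>dyadic_block m (l div 2 ^ m). of_real (hadamard m l k) * f k)) = f n"
    for n and f :: "nat \<Rightarrow> 'a"
  proof -
    let ?B = "dyadic_block m (n div 2 ^ m)"
    have "(\<Sum>l\<in>?B. of_real (hadamard m n l) * (\<Sum>k\<in>dyadic_block m (l div 2 ^ m). of_real (hadamard m l k) * f k))
        = (\<Sum>l\<in>?B. \<Sum>k\<in>?B. of_real (hadamard m n l * hadamard m l k) * f k)"
      by (intro sum.cong refl) (simp add: dyadic_block_def sum_distrib_left mult.assoc)
    also have "\<dots> = (\<Sum>k\<in>?B. of_real (\<Sum>l\<in>?B. hadamard m n l * hadamard m l k) * f k)"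
      by (subst sum.swap) (simp add: sum_distrib_right)
    also have "\<dots> = (\<Sum>k\<in>?B. if k = n then f k else 0)"
      unfolding hadamard_block_orthogonal by (intro sum.cong refl) auto
    also have "\<dots> = (if n \<in> ?B then f n else 0)" by simp
    also have "\<dots> = f n" by (simp add: dyadic_block_def)
    finally show ?thesis .
  qed
  show ?thesis
    by (rule kp_eqI) (simp_all only: kp_fst_hadamard_op kp_snd_hadamard_op *)
qed

definition hadamard_vector :: "nat \<Rightarrow> nat \<Rightarrow> 'k::real_or_complex ell2" where
  "hadamard_vector m j = (\<Sum>i\<in>dyadic_block m (j div 2 ^ m). ell2_scale (of_real (hadamard m i j)) (ell2_unit i))"

lemma ell2_nth_hadamard_vector: "ell2_nth (hadamard_vector m j) n = of_real (hadamard m n j)"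
proof -
  have "ell2_nth (hadamard_vector m j) n =
      (\<Sum>i\<in>dyadic_block m (j div 2 ^ m). if i = n then of_real (hadamard m n j) else 0)"
    unfolding hadamard_vector_def ell2_nth_sum by (intro sum.cong refl) (simp add: ell2_nth_unit)
  also have "\<dots> = (if n \<in> dyadic_block m (j div 2 ^ m) then of_real (hadamard m n j) else 0)"
    by simp
  also have "\<dots> = of_real (hadamard m n j)"
    by (auto simp: dyadic_block_def hadamard_eq_0)
  finally show ?thesis .
qed

lemma norm_hadamard_vector: "norm (hadamard_vector m j :: 'k::real_or_complex ell2) = 1"
proof -
  let ?B = "dyadic_block m (j div 2 ^ m)"
  have "(norm (hadamard_vector m j :: 'k ell2))\<^sup>2 = (\<Sum>i\<in>?B. (norm (ell2_scale (of_real (hadamard m i j)) (ell2_unit i) :: 'k ell2))\<^sup>2)"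
    unfolding hadamard_vector_def by (rule power2_norm_sum_disjoint) (auto simp: ell2_nth_unit)
  also have "\<dots> = (\<Sum>i\<in>?B. 1 / 2 ^ m)"
    by (intro sum.cong refl) (auto simp: abs_hadamard dyadic_block_def power_divide)
  also have "\<dots> = 1" by simp
  finally show ?thesis by (simp add: power2_eq_1_iff) (smt (verit) norm_ge_zero)
qed

lemma hadamard_op_incl: "hadamard_op m (kp_incl (ell2_unit j)) = kp_incl (hadamard_vector m j)"
proof (rule kp_eqI)
  fix n
  have "(\<Sum>l\<in>dyadic_block m (n div 2 ^ m). of_real (hadamard m n l) * ell2_nth (ell2_unit j) l) =
      (\<Sum>l\<in>dyadic_block m (n div 2 ^ m). if l = j then of_real (hadamard m n j) else 0 :: 'a)"
    by (intro sum.cong refl) (auto simp: ell2_nth_unit)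
  also have "\<dots> = (if j \<in> dyadic_block m (n div 2 ^ m) then of_real (hadamard m n j) else 0)"
    by simp
  also have "\<dots> = of_real (hadamard m n j)"
    using hadamard_eq_0[of n m j] by (auto simp: dyadic_block_def)
  finally show "kp_fst (hadamard_op m (kp_incl (ell2_unit j))) n = kp_fst (kp_incl (hadamard_vector m j) :: 'a kalton_peck) n"
    by (simp add: kp_fst_hadamard_op ell2_nth_hadamard_vector)
qed (simp add: kp_snd_hadamard_op)

lemma hadamard_op_section:
  "hadamard_op m (kp_section (ell2_unit j)) =
    (\<Sum>i\<in>dyadic_block m (j div 2 ^ m). kp_scale (of_real (hadamard m i j)) (kp_section (ell2_unit i)))"
  (is "?l = ?r")
proof (rule kp_eqI)
  fix n
  show "kp_fst ?l n = kp_fst ?r n" by (simp add: kp_fst_hadamard_op kp_fst_sum)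
  have "(\<Sum>l\<in>dyadic_block m (n div 2 ^ m). of_real (hadamard m n l) * ell2_nth (ell2_unit j) l) =
      (\<Sum>l\<in>dyadic_block m (n div 2 ^ m). if l = j then of_real (hadamard m n j) else 0 :: 'a)"
    by (intro sum.cong refl) (auto simp: ell2_nth_unit)
  also have "\<dots> = (if j \<in> dyadic_block m (n div 2 ^ m) then of_real (hadamard m n j) else 0)"
    by simp
  also have "\<dots> = of_real (hadamard m n j)"
    using hadamard_eq_0[of n m j] by (auto simp: dyadic_block_def)
  also have "\<dots> = (\<Sum>i\<in>dyadic_block m (j div 2 ^ m). of_real (hadamard m i j) * ell2_nth (ell2_unit i) n)"
  proof -
    have "of_real (hadamard m n j) = ell2_nth (hadamard_vector m j :: 'a ell2) n"
      by (rule ell2_nth_hadamard_vector[symmetric])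
    then show ?thesis by (simp only: hadamard_vector_def ell2_nth_sum ell2_nth_scale)
  qed
  finally show "kp_snd ?l n = kp_snd ?r n"
    by (simp add: kp_snd_hadamard_op kp_snd_sum)
qed

text \<open>The entries of a Hadamard vector have equal moduli, so \<open>\<Omega>\<close> multiplies it by a constant.\<close>

lemma kp_section_hadamard_vector:
  "kp_section (hadamard_vector m j) =
     kp_scale (of_real (m * ln 2 / 2)) (kp_incl (hadamard_vector m j)) + hadamard_op m (kp_section (ell2_unit j))"
  (is "?l = ?r")
proof (rule kp_eqI)
  fix n
  have "ln (sqrt (2 ^ m)) = m * ln 2 / 2" by (simp add: ln_sqrt ln_realpow)
  then have "KP_map (ell2_nth (hadamard_vector m j :: 'a ell2)) n = of_real (hadamard m n j) * of_real (m * ln 2 / 2)"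
  proof (cases "hadamard m n j = 0")
    case False
    then have "\<bar>hadamard m n j\<bar> = 1 / sqrt (2 ^ m)"
      using hadamard_eq_0[of n m j] by (auto simp: abs_hadamard)
    then have "ln (1 / norm (of_real (hadamard m n j) :: 'a)) = m * ln 2 / 2"
      using \<open>ln (sqrt (2 ^ m)) = m * ln 2 / 2\<close> by simp
    moreover have "KP_map (ell2_nth (hadamard_vector m j :: 'a ell2)) n =
        of_real (hadamard m n j) * of_real (ln (1 / norm (of_real (hadamard m n j) :: 'a)))"
      using False by (simp add: KP_map_def l2_norm_ell2_nth norm_hadamard_vector ell2_nth_hadamard_vector)
    ultimately show ?thesis by (simp only:)
  qed (simp add: KP_map_def ell2_nth_hadamard_vector)
  then show "kp_fst ?l n = kp_fst ?r n"
    by (simp add: kp_fst_section KP_map_unit ell2_nth_hadamard_vector hadamard_op_section kp_fst_sum)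
  show "kp_snd ?l n = kp_snd ?r n"
    by (simp add: hadamard_vector_def hadamard_op_section kp_snd_sum ell2_nth_sum)
qed

lemma kp_omega_incl_unit_left: "kp_omega (kp_incl (ell2_unit i)) v = scalar_cnj (kp_snd v i)"
  unfolding kp_omega_commute[of "kp_incl (ell2_unit i)"] kp_omega_incl_unit by (simp add: scalar_cnj_minus)

lemma kp_omega_section_unit_left: "kp_omega (kp_section (ell2_unit i)) v = - scalar_cnj (kp_fst v i)"
  unfolding kp_omega_commute[of "kp_section (ell2_unit i)"] kp_omega_section_unit ..

text \<open>The matrix is real and symmetric and acts alike on both components; pairing with the
  unit vectors of the kernel and of the section isolates the coordinates. With
  \<open>hadamard_op_involution\<close> this makes the operator an isometry in the sense of the
  involution.\<close>

lemma kp_adj_hadamard_op: "kp_adj (hadamard_op m) = (hadamard_op m :: 'k::real_or_complex kalton_peck \<Rightarrow> _)"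
proof (rule ext, rule kp_eqI)
  fix v :: "'k kalton_peck" and n
  let ?T = "hadamard_op m :: 'k kalton_peck \<Rightarrow> _" and ?B = "dyadic_block m (n div 2 ^ m)"
  have "scalar_cnj (kp_snd (kp_adj ?T v) n) = kp_omega (?T (kp_incl (ell2_unit n))) v"
    unfolding kp_omega_adj[OF hadamard_op_ops] kp_omega_incl_unit_left ..
  also have "?T (kp_incl (ell2_unit n)) = (\<Sum>i\<in>?B. kp_scale (of_real (hadamard m i n)) (kp_incl (ell2_unit i)))"
    unfolding hadamard_op_incl hadamard_vector_def kp_incl_sum kp_incl_scale ..
  also have "kp_omega \<dots> v = (\<Sum>i\<in>?B. of_real (hadamard m i n) * scalar_cnj (kp_snd v i))"
    unfolding kp_omega_sum_left kp_omega_scale_left kp_omega_incl_unit_left ..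
  also have "\<dots> = scalar_cnj (kp_snd (?T v) n)"
    unfolding kp_snd_hadamard_op scalar_cnj_sum scalar_cnj_mult scalar_cnj_of_real hadamard_commute[of m n] ..
  finally show "kp_snd (kp_adj ?T v) n = kp_snd (?T v) n" by (metis scalar_cnj_cnj)
  have "- scalar_cnj (kp_fst (kp_adj ?T v) n) = kp_omega (?T (kp_section (ell2_unit n))) v"
    unfolding kp_omega_adj[OF hadamard_op_ops] kp_omega_section_unit_left ..
  also have "\<dots> = (\<Sum>i\<in>?B. of_real (hadamard m i n) * (- scalar_cnj (kp_fst v i)))"
    unfolding hadamard_op_section kp_omega_sum_left kp_omega_scale_left kp_omega_section_unit_left ..
  also have "\<dots> = - scalar_cnj (kp_fst (?T v) n)"
    unfolding kp_fst_hadamard_op scalar_cnj_sum scalar_cnj_mult scalar_cnj_of_real hadamard_commute[of m n]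
    by (simp add: sum_negf)
  finally show "kp_fst (kp_adj ?T v) n = kp_fst (?T v) n" by (metis scalar_cnj_cnj neg_equal_iff_equal)
qed

text \<open>The position \<open>a\<close> inside the block is fixed while the block moves to
  infinity, so finitely many such sequences control a whole block.\<close>

lemma ell2_null_hadamard_vector: "ell2_null (\<lambda>q. hadamard_vector m (2 ^ m * q + a))"
  unfolding ell2_null_def
proof (intro conjI allI)
  show "\<exists>C. \<forall>n. norm (hadamard_vector m (2 ^ m * n + a) :: 'a ell2) \<le> C"
    by (intro exI[of _ 1]) (simp add: norm_hadamard_vector)
  fix i
  have "eventually (\<lambda>q. ell2_nth (hadamard_vector m (2 ^ m * q + a)) i = (0 :: 'a)) sequentially"
    unfolding eventually_sequentially
  proof (intro exI[of _ "Suc i"] allI impI)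
    fix q assume q: "Suc i \<le> q"
    have "i div 2 ^ m \<le> i" by (rule div_le_dividend)
    also have "i < q" using q by simp
    also have "q \<le> (2 ^ m * q + a) div 2 ^ m" by simp
    finally show "ell2_nth (hadamard_vector m (2 ^ m * q + a)) i = (0 :: 'a)"
      by (simp add: ell2_nth_hadamard_vector hadamard_eq_0)
  qed
  then show "(\<lambda>q. ell2_nth (hadamard_vector m (2 ^ m * q + a)) i) \<longlonglongrightarrow> (0 :: 'a)"
    by (rule tendsto_eventually)
qed

text \<open>
  On the unit vectors \<open>e\<close> of a block and on their images \<open>f\<close> the map \<open>\<Omega>\<close> takes the values \<open>0\<close>
  and \<open>L f\<close> with \<open>L = m ln 2 / 2\<close>. Hence the trace over the block of the corner of \<open>S\<close> from the
  quotient to the kernel, twisted with the Hadamard matrix, is close to \<open>L\<close> per dimension if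
  computed in the basis \<open>e\<close>, and to \<open>- L\<close> if computed in the basis \<open>f\<close>.
\<close>

lemma hadamard_op_essential_norm:
  fixes S :: "'k::real_or_complex kalton_peck \<Rightarrow> 'k kalton_peck"
  assumes S: "S \<in> kp_ops" and K: "compact_on_kernel S"
    and C: "\<And>u. norm (hadamard_op m u + S u) \<le> C * norm u"
  shows "m * ln 2 / 2 \<le> 32 * C"
proof -
  define T where "T = (hadamard_op m :: 'k kalton_peck \<Rightarrow> _)"
  define R where "R u = T u + S u" for u
  define L where "L = m * ln 2 / 2"
  have L: "0 \<le> L" by (simp add: L_def)
  have T: "T \<in> kp_ops" and TT: "T (T u) = u" for u
    by (simp_all add: T_def hadamard_op_ops hadamard_op_involution)
  have R: "norm (R u) \<le> C * norm u" and Seq: "S u = R u - T u" for u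
    using C[of u] by (simp_all add: R_def T_def)
  define E where "E j = (kp_section (ell2_unit j) :: 'k kalton_peck)" for j
  define I where "I j = (kp_incl (ell2_unit j) :: 'k kalton_peck)" for j
  define F where "F j = (kp_incl (hadamard_vector m j) :: 'k kalton_peck)" for j
  define G where "G j = (kp_section (hadamard_vector m j) :: 'k kalton_peck)" for j
  have G: "G j = kp_scale (of_real L) (F j) + T (E j)" for j
    unfolding G_def F_def T_def E_def L_def by (rule kp_section_hadamard_vector)
  have TI: "T (I j) = F j" for j unfolding T_def I_def F_def by (rule hadamard_op_incl)
  have TF: "T (F j) = I j" for j unfolding TI[symmetric] TT ..
  have TG: "T (G j) = kp_scale (of_real L) (I j) + E j" for j
    unfolding G kp_ops_add[OF T] kp_ops_scale[OF T] TF TT ..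
  have nE: "norm (E j) \<le> 2" and nG: "norm (G j) \<le> 2" for j
    unfolding E_def G_def using norm_section_le[of "ell2_unit j :: 'k ell2"]
      norm_section_le[of "hadamard_vector m j :: 'k ell2"] by (simp_all add: norm_hadamard_vector)
  have C0: "0 \<le> C"
  proof -
    have "E 0 \<noteq> 0" unfolding E_def by (metis kp_qnorm_section kp_qnorm_zero norm_ell2_unit zero_neq_one)
    then show ?thesis using order_trans[OF norm_ge_zero R[of "E 0"]] by (simp add: zero_le_mult_iff)
  qed
  \<comment> \<open>The 16 consists of the constant 4 of \<open>norm_kp_omega_le4\<close> and the
    two norms, each at most 2.\<close>
  have RC: "norm (kp_omega (R u) v) \<le> 16 * C" if "norm u \<le> 2" "norm v \<le> 2" for u v
  proof -
    have "norm (kp_omega (R u) v) \<le> 4 * norm (R u) * norm v" by (rule norm_kp_omega_le4)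
    also have "\<dots> \<le> 4 * (C * 2) * 2"
      using R[of u] mult_left_mono[OF that(1) C0] that(2) C0 by (intro mult_mono) auto
    finally show ?thesis by simp
  qed
  have EE: "kp_omega (E i) (E j) = 0" for i j
    unfolding E_def kp_omega_section_unit by simp
  have TEE: "kp_omega (T (E i)) (T (E j)) = 0" for i j
    unfolding T_def E_def hadamard_op_section
    by (simp add: kp_omega_sum_left kp_omega_sum_right kp_omega_scale_left kp_omega_scale_right
        EE[unfolded E_def])
  have TEF: "kp_omega (T (E j)) (F j) = - 1" for j
  proof -
    have "kp_quot (T (E j)) = kp_quot (G j)"
      unfolding G kp_quot_add kp_quot_scale F_def by (simp add: ell2_eqI)
    then show ?thesis unfolding F_def kp_omega_incl_right
      by (simp add: G_def ell2_inner_self norm_hadamard_vector)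
  qed
  have TGE: "kp_omega (T (G j)) (E j) = of_real L" for j
    unfolding TG kp_omega_add_left kp_omega_scale_left EE unfolding I_def kp_omega_incl_unit_left
    by (simp add: E_def ell2_nth_unit)
  \<comment> \<open>\<open>T (E j)\<close> is \<open>G j\<close> minus \<open>L\<close> times
    \<open>F j\<close>. Against the bounded vector \<open>G j\<close> the operator \<open>R\<close>
    is harmless; the \<open>L\<close> stems from the pairing of \<open>T (E j)\<close> with
    \<open>F j\<close>, which is -1.\<close>
  have 1: "norm (kp_omega (S (E j)) (T (E j)) - of_real L) \<le> 16 * C + L * norm (kp_omega (S (E j)) (F j))" for j
  proof -
    have TE: "T (E j) = G j - kp_scale (of_real L) (F j)" by (simp add: G)
    have "kp_omega (S (E j)) (T (E j)) = kp_omega (R (E j)) (T (E j)) - kp_omega (T (E j)) (T (E j))"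
      by (simp add: Seq kp_omega_diff_left)
    also have "\<dots> = kp_omega (R (E j)) (G j) - of_real L * kp_omega (R (E j)) (F j)"
      unfolding TEE by (simp add: TE kp_omega_diff_right kp_omega_scale_right)
    also have "kp_omega (R (E j)) (F j) = kp_omega (S (E j)) (F j) - 1"
      unfolding R_def kp_omega_add_left TEF by simp
    finally have "kp_omega (S (E j)) (T (E j)) - of_real L
        = kp_omega (R (E j)) (G j) - of_real L * kp_omega (S (E j)) (F j)"
      by (simp add: algebra_simps)
    then have "norm (kp_omega (S (E j)) (T (E j)) - of_real L)
        \<le> norm (kp_omega (R (E j)) (G j)) + norm (of_real L * kp_omega (S (E j)) (F j))"
      by (metis norm_triangle_ineq4)
    moreover have "norm (of_real L * kp_omega (S (E j)) (F j)) = L * norm (kp_omega (S (E j)) (F j))"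
      using L by (simp add: norm_mult)
    ultimately show ?thesis using RC[OF nE nG, of j j] by linarith
  qed
  \<comment> \<open>The same in the other basis: now the \<open>L\<close> stems from the kernel part
    \<open>L\<close> times \<open>I j\<close> of \<open>T (G j)\<close>, and it appears with the
    opposite sign.\<close>
  have 2: "norm (kp_omega (S (T (E j))) (E j) + of_real L) \<le> 16 * C + L * norm (kp_omega (S (F j)) (E j))" for j
  proof -
    have lin: "S (u - v) = S u - S v" for u v
      using bounded_linear.linear[OF kp_ops_bounded_linear[OF S]] by (rule linear_diff)
    have "T (E j) = G j - kp_scale (of_real L) (F j)" by (simp add: G)
    then have "kp_omega (S (T (E j))) (E j) = kp_omega (S (G j)) (E j) - of_real L * kp_omega (S (F j)) (E j)"
      by (simp add: lin kp_ops_scale[OF S] kp_omega_diff_left kp_omega_scale_left)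
    also have "kp_omega (S (G j)) (E j) = kp_omega (R (G j)) (E j) - of_real L"
      by (simp add: Seq kp_omega_diff_left TGE)
    finally have "kp_omega (S (T (E j))) (E j) + of_real L
        = kp_omega (R (G j)) (E j) - of_real L * kp_omega (S (F j)) (E j)"
      by (simp add: algebra_simps)
    then have "norm (kp_omega (S (T (E j))) (E j) + of_real L)
        \<le> norm (kp_omega (R (G j)) (E j)) + norm (of_real L * kp_omega (S (F j)) (E j))"
      by (metis norm_triangle_ineq4)
    moreover have "norm (of_real L * kp_omega (S (F j)) (E j)) = L * norm (kp_omega (S (F j)) (E j))"
      using L by (simp add: norm_mult)
    ultimately show ?thesis using RC[OF nG nE, of j j] by linarith
  qed
  \<comment> \<open>\<open>F j\<close> lies in the kernel, so both pairings vanish far out: the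
    first directly, the second after moving \<open>S\<close> to \<open>F j\<close> as its
    adjoint.\<close>
  have small: "eventually (\<lambda>q. norm (kp_omega (S (F (2 ^ m * q + a))) (E (2 ^ m * q + a))) +
      norm (kp_omega (S (E (2 ^ m * q + a))) (F (2 ^ m * q + a))) < 1) sequentially" for a
  proof -
    let ?j = "\<lambda>q. 2 ^ m * q + a"
    have "(\<lambda>q. S (F (?j q))) \<longlonglongrightarrow> 0" "(\<lambda>q. kp_adj S (F (?j q))) \<longlonglongrightarrow> 0"
      using K compact_on_kernel_adjI[OF S K] ell2_null_hadamard_vector[of m a]
      unfolding compact_on_kernel_def F_def by blast+
    then have "(\<lambda>q. 8 * norm (S (F (?j q))) + 8 * norm (kp_adj S (F (?j q)))) \<longlonglongrightarrow>
        8 * norm (0 :: 'k kalton_peck) + 8 * norm (0 :: 'k kalton_peck)"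
      by (intro tendsto_intros)
    then have "(\<lambda>q. 8 * norm (S (F (?j q))) + 8 * norm (kp_adj S (F (?j q)))) \<longlonglongrightarrow> 0" by simp
    then have "eventually (\<lambda>q. 8 * norm (S (F (?j q))) + 8 * norm (kp_adj S (F (?j q))) < 1) sequentially"
      by (rule order_tendstoD) simp
    then show ?thesis
    proof eventually_elim
      case (elim q)
      have le: "norm (kp_omega v (E j)) \<le> 8 * norm v" "norm (kp_omega (E j) v) \<le> 8 * norm v" for v j
      proof -
        show "norm (kp_omega v (E j)) \<le> 8 * norm v"
          using norm_kp_omega_le4[of v "E j"] mult_left_mono[OF nE[of j], of "4 * norm v"] by simp
        then show "norm (kp_omega (E j) v) \<le> 8 * norm v"
          by (simp only: norm_kp_omega_commute[of "E j"])
      qed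
      have "kp_omega (S (E (?j q))) (F (?j q)) = kp_omega (E (?j q)) (kp_adj S (F (?j q)))"
        by (rule kp_omega_adj[OF S])
      with elim le(1)[of "S (F (?j q))" "?j q"] le(2)[of "?j q" "kp_adj S (F (?j q))"]
      show ?case by simp
    qed
  qed
  have "eventually (\<lambda>q. \<forall>a\<in>{..<2 ^ m}. norm (kp_omega (S (F (2 ^ m * q + a))) (E (2 ^ m * q + a))) +
      norm (kp_omega (S (E (2 ^ m * q + a))) (F (2 ^ m * q + a))) < 1) sequentially"
    by (intro eventually_ball_finite ballI small) simp
  then obtain q where q: "\<And>j. j \<in> dyadic_block m q \<Longrightarrow>
      norm (kp_omega (S (F j)) (E j)) + norm (kp_omega (S (E j)) (F j)) < 1"
    unfolding dyadic_block_eq by (auto simp: eventually_sequentially)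
  let ?B = "dyadic_block m q"
  have TE: "T (E j) = (\<Sum>i\<in>?B. kp_scale (of_real (hadamard m i j)) (E i))" if "j \<in> ?B" for j
    using that unfolding T_def E_def hadamard_op_section by (simp add: dyadic_block_def)
  have Slin: "S (\<Sum>i\<in>A. f i) = (\<Sum>i\<in>A. S (f i))" for A :: "nat set" and f
    using bounded_linear.linear[OF kp_ops_bounded_linear[OF S]] by (rule linear_sum)
  \<comment> \<open>Both sides are the trace of the corner of \<open>S\<close> times the Hadamard
    matrix of the block; the symmetry of that matrix permits the exchange of \<open>i\<close> and
    \<open>j\<close>.\<close>
  have "(\<Sum>j\<in>?B. kp_omega (S (E j)) (T (E j))) = (\<Sum>j\<in>?B. \<Sum>i\<in>?B. of_real (hadamard m i j) * kp_omega (S (E j)) (E i))"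
    by (intro sum.cong refl) (simp add: TE kp_omega_sum_right kp_omega_scale_right)
  also have "\<dots> = (\<Sum>i\<in>?B. \<Sum>j\<in>?B. of_real (hadamard m i j) * kp_omega (S (E j)) (E i))"
    by (rule sum.swap)
  also have "\<dots> = (\<Sum>j\<in>?B. kp_omega (S (T (E j))) (E j))"
    by (intro sum.cong refl)
      (simp add: TE Slin kp_ops_scale[OF S] kp_omega_sum_left kp_omega_scale_left hadamard_commute[of m _])
  finally have tr: "(\<Sum>j\<in>?B. kp_omega (S (E j)) (T (E j))) = (\<Sum>j\<in>?B. kp_omega (S (T (E j))) (E j))" .
  \<comment> \<open>In the difference of the two estimates the traces cancel. Each index contributes
    2 L, against an error of at most 32 C + L because the small pairings add up to less than
    1.\<close>
  have "of_real (2 ^ m * (2 * L)) = (\<Sum>j\<in>?B. of_real (2 * L) :: 'k)" by simp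
  also have "\<dots> = (\<Sum>j\<in>?B. (kp_omega (S (T (E j))) (E j) + of_real L) - (kp_omega (S (E j)) (T (E j)) - of_real L))"
    unfolding sum_subtractf sum.distrib tr by (simp add: sum_subtractf sum.distrib algebra_simps)
  finally have "norm (of_real (2 ^ m * (2 * L)) :: 'k) \<le> (\<Sum>j\<in>?B. 32 * C + L * 1)"
  proof (simp only:, intro sum_norm_le)
    fix j assume "j \<in> ?B"
    have "norm ((kp_omega (S (T (E j))) (E j) + of_real L) - (kp_omega (S (E j)) (T (E j)) - of_real L))
        \<le> norm (kp_omega (S (T (E j))) (E j) + of_real L) + norm (kp_omega (S (E j)) (T (E j)) - of_real L)"
      by (rule norm_triangle_ineq4)
    also have "\<dots> \<le> 32 * C + L * (norm (kp_omega (S (F j)) (E j)) + norm (kp_omega (S (E j)) (F j)))"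
      using 1[of j] 2[of j] by (simp add: distrib_left)
    also have "\<dots> \<le> 32 * C + L * 1"
      using q[OF \<open>j \<in> ?B\<close>] L by (intro add_left_mono mult_left_mono) auto
    finally show "norm ((kp_omega (S (T (E j))) (E j) + of_real L) - (kp_omega (S (E j)) (T (E j)) - of_real L)) \<le> 32 * C + L * 1" .
  qed
  then have "2 ^ m * (2 * L) \<le> 2 ^ m * (32 * C + L)"
    using L unfolding norm_of_real by simp
  then have "2 * L \<le> 32 * C + L" by simp
  then show ?thesis by (simp add: L_def)
qed

section \<open>Adjoints on Hilbert spaces\<close>

context hilbert_space
begin

lemma ip_zero_left: "ip 0 x = 0"
  using ip_add_left[of 0 0 x] by simp

lemma ip_minus_left: "ip (- x) y = - ip x y"
  using ip_add_left[of x "- x" y] by (simp add: ip_zero_left eq_neg_iff_add_eq_0 add.commute)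

lemma ip_diff_left: "ip (x - y) z = ip x z - ip y z"
  using ip_add_left[of x "- y" z] by (simp add: ip_minus_left)

lemma ip_add_right: "ip x (y + z) = ip x y + ip x z"
  unfolding ip_cnj[of x] by (simp add: ip_add_left scalar_cnj_add)

lemma ip_diff_right: "ip x (y - z) = ip x y - ip x z"
  unfolding ip_cnj[of x] by (simp add: ip_diff_left scalar_cnj_diff)

lemma ip_scale_right: "ip x (s c y) = scalar_cnj c * ip x y"
  unfolding ip_cnj[of x] by (simp add: ip_scale_left scalar_cnj_mult)

lemma ip_self: "ip x x = of_real ((ip_norm ip x)\<^sup>2)"
proof (cases "x = 0")
  case True
  then show ?thesis by (simp add: ip_zero_left ip_norm_def)
next
  case False
  then obtain r where "r > 0" "ip x x = of_real r" using ip_pos by blast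
  then show ?thesis by (simp add: ip_norm_def)
qed

lemma norm_ip_self: "norm (ip x x) = (ip_norm ip x)\<^sup>2"
  by (simp add: ip_norm_def)

lemma ip_norm_nonneg: "0 \<le> ip_norm ip x"
  by (simp add: ip_norm_def)

lemma ip_norm_eq_0_iff: "ip_norm ip x = 0 \<longleftrightarrow> x = 0"
proof
  assume "ip_norm ip x = 0"
  then have "ip x x = 0" by (simp add: ip_self)
  then show "x = 0" using ip_pos[of x] by fastforce
qed (simp add: ip_norm_def ip_zero_left)

lemma ip_norm_scale: "ip_norm ip (s c x) = norm c * ip_norm ip x"
  by (simp add: ip_norm_def ip_scale_left ip_scale_right norm_mult real_sqrt_mult)

text \<open>Pythagoras with the exact gain. Its nonnegativity gives the Cauchy--Schwarz inequality,
  and minimality of a vector forces the gain to be 0.\<close>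

lemma ip_norm_minus_projection:
  assumes "y \<noteq> 0"
  shows "(ip_norm ip (x - s (ip x y / ip y y) y))\<^sup>2 = (ip_norm ip x)\<^sup>2 - (norm (ip x y))\<^sup>2 / (ip_norm ip y)\<^sup>2"
proof -
  define t where "t = (ip_norm ip y)\<^sup>2"
  have t: "t \<noteq> 0" using assms by (simp add: t_def ip_norm_eq_0_iff)
  have yy: "ip y y = of_real t" by (simp add: ip_self t_def)
  define a where "a = ip x y"
  have yx: "ip y x = scalar_cnj a" unfolding a_def by (rule ip_cnj)
  have cc: "scalar_cnj (a / of_real t) = scalar_cnj a / of_real t"
  proof -
    have "scalar_cnj (a / of_real t) = scalar_cnj (a * of_real (1 / t))" by simp
    also have "\<dots> = scalar_cnj a / of_real t" unfolding scalar_cnj_mult scalar_cnj_of_real by simp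
    finally show ?thesis .
  qed
  have "(of_real ((ip_norm ip (x - s (a / of_real t) y))\<^sup>2) :: 'k) = ip x x - a * scalar_cnj a / of_real t"
    unfolding ip_self[symmetric] using t
    by (simp add: ip_diff_left ip_diff_right ip_scale_left ip_scale_right yy yx cc a_def[symmetric] field_simps)
  also have "\<dots> = of_real ((ip_norm ip x)\<^sup>2 - (norm a)\<^sup>2 / t)"
    unfolding mult_scalar_cnj ip_self by simp
  finally show ?thesis unfolding of_real_eq_iff by (simp add: a_def t_def yy)
qed

lemma norm_ip_le: "norm (ip x y) \<le> ip_norm ip x * ip_norm ip y"
proof (cases "y = 0")
  case True
  then have "ip x y = 0" using ip_cnj[of x y] by (simp add: ip_zero_left)
  then show ?thesis by (simp add: ip_norm_nonneg)
next
  case False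
  then have y: "0 < (ip_norm ip y)\<^sup>2" by (simp add: ip_norm_eq_0_iff)
  have "0 \<le> (ip_norm ip x)\<^sup>2 - (norm (ip x y))\<^sup>2 / (ip_norm ip y)\<^sup>2"
    unfolding ip_norm_minus_projection[OF False, symmetric] by simp
  then have "(norm (ip x y))\<^sup>2 \<le> (ip_norm ip x * ip_norm ip y)\<^sup>2"
    using y by (simp add: field_simps power_mult_distrib)
  then show ?thesis by (rule power2_le_imp_le) (simp add: ip_norm_nonneg)
qed

lemma ip_norm_triangle: "ip_norm ip (x + y) \<le> ip_norm ip x + ip_norm ip y"
proof -
  have "(ip_norm ip (x + y))\<^sup>2 = norm (ip (x + y) (x + y))" by (simp add: ip_norm_def)
  also have "ip (x + y) (x + y) = (ip x x + ip y y) + (ip x y + ip y x)"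
    by (simp add: ip_add_left ip_add_right)
  also have "norm \<dots> \<le> (norm (ip x x) + norm (ip y y)) + (norm (ip x y) + norm (ip y x))"
    by (intro norm_triangle_mono norm_triangle_ineq)
  also have "\<dots> \<le> ((ip_norm ip x)\<^sup>2 + (ip_norm ip y)\<^sup>2) + (ip_norm ip x * ip_norm ip y + ip_norm ip y * ip_norm ip x)"
    by (intro add_mono norm_ip_le) (simp_all add: norm_ip_self)
  also have "\<dots> = (ip_norm ip x + ip_norm ip y)\<^sup>2" by (simp add: power2_sum)
  finally show ?thesis by (rule power2_le_imp_le) (simp add: ip_norm_nonneg)
qed

lemma ip_norm_parallelogram:
  "(ip_norm ip (x + y))\<^sup>2 + (ip_norm ip (x - y))\<^sup>2 = 2 * (ip_norm ip x)\<^sup>2 + 2 * (ip_norm ip y)\<^sup>2"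
proof -
  have "(of_real ((ip_norm ip (x + y))\<^sup>2 + (ip_norm ip (x - y))\<^sup>2) :: 'k) = ip (x + y) (x + y) + ip (x - y) (x - y)"
    by (simp add: ip_self)
  also have "\<dots> = 2 * ip x x + 2 * ip y y"
    by (simp add: ip_add_left ip_add_right ip_diff_left ip_diff_right)
  also have "\<dots> = of_real (2 * (ip_norm ip x)\<^sup>2 + 2 * (ip_norm ip y)\<^sup>2)"
    by (simp add: ip_self)
  finally show ?thesis by (simp only: of_real_eq_iff)
qed

text \<open>Midpoints stay in the hyperplane \<open>f = 1\<close>, so the parallelogram identity
  makes a minimising sequence Cauchy; boundedness of \<open>f\<close> keeps its limit in the
  hyperplane.\<close>

lemma ip_norm_attained:
  assumes add: "\<And>x y. f (x + y) = f x + f y" and scale: "\<And>c x. f (s c x) = c * f x"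
    and bound: "\<And>x. norm (f x) \<le> C * ip_norm ip x" and x1: "f x1 = (1 :: 'k)"
  shows "\<exists>l. f l = 1 \<and> (\<forall>x. f x = 1 \<longrightarrow> ip_norm ip l \<le> ip_norm ip x)"
proof -
  let ?N = "ip_norm ip"
  define A where "A = {x. f x = 1}"
  define d where "d = (INF x\<in>A. ?N x)"
  have A: "A \<noteq> {}" using x1 by (auto simp: A_def)
  have bdd: "bdd_below (?N ` A)" by (rule bdd_belowI2[of _ 0]) (rule ip_norm_nonneg)
  have d0: "0 \<le> d" unfolding d_def by (rule cINF_greatest[OF A]) (rule ip_norm_nonneg)
  have dle: "d \<le> ?N x" if "f x = 1" for x
    unfolding d_def by (rule cINF_lower[OF bdd]) (use that in \<open>simp add: A_def\<close>)
  have "\<exists>x. f x = 1 \<and> ?N x < d + 1 / real (Suc n)" for n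
  proof -
    have "Inf (?N ` A) < d + 1 / real (Suc n)" by (simp add: d_def)
    from cInf_lessD[OF _ this] A show ?thesis by (auto simp: A_def)
  qed
  then obtain X where X: "\<And>n. f (X n) = 1" "\<And>n. ?N (X n) < d + 1 / real (Suc n)" by metis
  have close: "(?N (X m - X n))\<^sup>2 \<le> 4 * (2 * d + 1) / real (Suc M)" if "M \<le> m" "M \<le> n" for m n M
  proof -
    define h where "h = 1 / real (Suc M)"
    have h: "0 < h" "h \<le> 1" by (simp_all add: h_def)
    have Xh: "?N (X k) \<le> d + h" if "M \<le> k" for k
    proof -
      have "1 / real (Suc k) \<le> h" using that by (simp add: h_def frac_le)
      then show ?thesis using X(2)[of k] by linarith
    qed
    have "f (s (1 / 2) (X m + X n)) = 1" by (simp add: scale add X)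
    then have "d \<le> ?N (s (1 / 2) (X m + X n))" by (rule dle)
    then have "2 * d \<le> ?N (X m + X n)" by (simp add: ip_norm_scale norm_divide)
    then have "(2 * d)\<^sup>2 \<le> (?N (X m + X n))\<^sup>2" using d0 by (intro power_mono) auto
    moreover have "(?N (X m))\<^sup>2 \<le> (d + h)\<^sup>2" "(?N (X n))\<^sup>2 \<le> (d + h)\<^sup>2"
      using Xh that by (auto intro!: power_mono ip_norm_nonneg)
    ultimately have "(?N (X m - X n))\<^sup>2 \<le> 4 * (d + h)\<^sup>2 - (2 * d)\<^sup>2"
      using ip_norm_parallelogram[of "X m" "X n"] by linarith
    also have "\<dots> = 4 * (2 * d + h) * h" by (simp add: power2_eq_square algebra_simps)
    also have "\<dots> \<le> 4 * (2 * d + 1) * h" using h d0 by (intro mult_right_mono) auto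
    finally show ?thesis by (simp add: h_def)
  qed
  have "\<exists>l. (\<lambda>n. ?N (X n - l)) \<longlonglongrightarrow> 0"
  proof (rule complete)
    fix e :: real assume e: "0 < e"
    obtain M :: nat where M: "4 * (2 * d + 1) / e\<^sup>2 < M" using reals_Archimedean2 by blast
    have "?N (X m - X n) < e" if "M \<le> m" "M \<le> n" for m n
    proof -
      have "4 * (2 * d + 1) < real M * e\<^sup>2"
        using M e by (simp add: pos_divide_less_eq)
      also have "\<dots> \<le> e\<^sup>2 * real (Suc M)" by (simp add: algebra_simps)
      finally have "4 * (2 * d + 1) < e\<^sup>2 * real (Suc M)" .
      then have "4 * (2 * d + 1) / real (Suc M) < e\<^sup>2" by (simp add: pos_divide_less_eq)
      then have "(?N (X m - X n))\<^sup>2 < e\<^sup>2" using close[OF that] by linarith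
      then show ?thesis by (rule power2_less_imp_less) (use e in simp)
    qed
    then show "\<exists>M. \<forall>m\<ge>M. \<forall>n\<ge>M. ?N (X m - X n) < e" by blast
  qed
  then obtain l where l: "(\<lambda>n. ?N (X n - l)) \<longlonglongrightarrow> 0" by blast
  have "norm (1 - f l) \<le> C * 0"
  proof (rule LIMSEQ_le_const)
    show "(\<lambda>n. C * ?N (X n - l)) \<longlonglongrightarrow> C * 0" by (intro tendsto_intros l)
    have "f (X n) = f (X n - l) + f l" for n using add[of "X n - l" l] by simp
    then have "1 - f l = f (X n - l)" for n by (simp add: X(1) algebra_simps)
    then show "\<exists>N. \<forall>n\<ge>N. norm (1 - f l) \<le> C * ?N (X n - l)" using bound by metis
  qed
  then have fl: "f l = 1" by simp
  have "?N l \<le> d + 0 + 0"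
  proof (rule LIMSEQ_le_const)
    have "(\<lambda>n. 1 / real (Suc n)) \<longlonglongrightarrow> 0" using LIMSEQ_inverse_real_of_nat by (simp add: inverse_eq_divide)
    then show "(\<lambda>n. d + 1 / real (Suc n) + ?N (X n - l)) \<longlonglongrightarrow> d + 0 + 0" by (intro tendsto_intros l)
    have "?N l \<le> d + 1 / real (Suc n) + ?N (X n - l)" for n
    proof -
      have "?N (l - X n) = ?N (X n - l)" using ip_norm_scale[of "- 1" "X n - l"] by simp
      then show ?thesis using ip_norm_triangle[of "X n" "l - X n"] X(2)[of n] by simp
    qed
    then show "\<exists>N. \<forall>n\<ge>N. ?N l \<le> d + 1 / real (Suc n) + ?N (X n - l)" by blast
  qed
  then show ?thesis using fl dle by (intro exI[of _ l]) force
qed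

text \<open>Subtracting from the minimal vector its projection onto an element of the kernel of
  \<open>f\<close> stays in the hyperplane and cannot shorten it, so the minimal vector is
  orthogonal to that kernel. A multiple of it represents \<open>f\<close>.\<close>

lemma ip_rep:
  assumes add: "\<And>x y. f (x + y) = f x + f y" and scale: "\<And>c x. f (s c x) = c * f x"
    and bound: "\<And>x. norm (f x :: 'k) \<le> C * ip_norm ip x"
  shows "\<exists>w. \<forall>x. f x = ip x w"
proof (cases "\<exists>x. f x \<noteq> 0")
  case False
  then show ?thesis using ip_zero_left ip_cnj[of _ 0] by (intro exI[of _ 0]) auto
next
  case True
  then obtain x0 where x0: "f x0 \<noteq> 0" by blast
  then have "f (s (1 / f x0) x0) = 1" by (simp add: scale)
  from ip_norm_attained[OF add scale bound this]
  obtain l where l: "f l = 1" "\<And>x. f x = 1 \<Longrightarrow> ip_norm ip l \<le> ip_norm ip x" by blast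
  have f0: "f 0 = 0" using add[of 0 0] by simp
  have fdiff: "f (x - y) = f x - f y" for x y using add[of "x - y" y] by simp
  have l0: "l \<noteq> 0" using l(1) f0 by auto
  have orth: "ip z l = 0" if z: "f z = 0" for z
  proof (cases "z = 0")
    case False
    have "f (l - s (ip l z / ip z z) z) = 1" by (simp add: fdiff scale z l)
    then have "ip_norm ip l \<le> ip_norm ip (l - s (ip l z / ip z z) z)" by (rule l(2))
    then have "(ip_norm ip l)\<^sup>2 \<le> (ip_norm ip (l - s (ip l z / ip z z) z))\<^sup>2"
      by (intro power_mono ip_norm_nonneg)
    then have "(norm (ip l z))\<^sup>2 / (ip_norm ip z)\<^sup>2 \<le> 0"
      unfolding ip_norm_minus_projection[OF False] by simp
    moreover have "0 < (ip_norm ip z)\<^sup>2" using False by (simp add: ip_norm_eq_0_iff)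
    ultimately have "(norm (ip l z))\<^sup>2 \<le> 0" by (simp add: divide_le_0_iff)
    then have "ip l z = 0" by simp
    then show ?thesis using ip_cnj[of z l] by simp
  qed (simp add: ip_zero_left)
  have "f x = ip x (s (of_real (1 / (ip_norm ip l)\<^sup>2)) l)" for x
  proof -
    have "ip (x - s (f x) l) l = 0" by (rule orth) (simp add: fdiff scale l)
    then have "ip x l = f x * ip l l" by (simp add: ip_diff_left ip_scale_left)
    then show ?thesis using l0 unfolding ip_scale_right scalar_cnj_of_real
      by (simp add: ip_self ip_norm_eq_0_iff)
  qed
  then show ?thesis by blast
qed

lemma ip_eqI:
  assumes "\<And>u. ip u v = ip u w"
  shows "v = w"
proof -
  have "ip (v - w) (v - w) = 0" by (simp add: ip_diff_right assms)
  then show ?thesis by (simp add: ip_self ip_norm_eq_0_iff)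
qed

lemma ip_form_adjoint:
  assumes T: "T \<in> bounded_ops s (ip_norm ip)"
  shows "ip (T u) v = ip u (form_adjoint s (ip_norm ip) ip T v)"
proof -
  have add: "T (x + y) = T x + T y" and scale: "T (s c x) = s c (T x)" for x y c
    using T unfolding bounded_ops_def Vector_Spaces.linear_iff by auto
  obtain C where C: "\<And>u. ip_norm ip (T u) \<le> C * ip_norm ip u"
    using T unfolding bounded_ops_def by blast
  have "\<exists>w. \<forall>u. ip (T u) v = ip u w" for v
  proof (rule ip_rep)
    show "norm (ip (T u) v) \<le> (C * ip_norm ip v) * ip_norm ip u" for u
      using norm_ip_le[of "T u" v] mult_right_mono[OF C[of u] ip_norm_nonneg[of v]] by (simp add: mult_ac)
  qed (simp_all add: add scale ip_add_left ip_scale_left)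
  then obtain R where R: "\<And>u v. ip (T u) v = ip u (R v)" by metis
  have "R \<in> bounded_ops s (ip_norm ip)"
    unfolding bounded_ops_def Vector_Spaces.linear_iff
  proof (intro CollectI conjI allI exI)
    show "vector_space s" by (rule vector_space_axioms)
    then show "vector_space s" .
    show "R (u + v) = R u + R v" for u v by (rule ip_eqI) (simp add: ip_add_right flip: R)
    show "R (s c u) = s c (R u)" for c u by (rule ip_eqI) (simp add: ip_scale_right flip: R)
    show "ip_norm ip (R v) \<le> C * ip_norm ip v" for v
    proof (cases "ip_norm ip (R v) = 0")
      case True
      show ?thesis
      proof (cases "v = 0")
        case False
        have "0 \<le> C * ip_norm ip v" using order_trans[OF ip_norm_nonneg C] .
        then show ?thesis using True by simp
      qed (use True in \<open>simp add: ip_norm_eq_0_iff[THEN iffD2]\<close>)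
    next
      case False
      have "(ip_norm ip (R v))\<^sup>2 = norm (ip (R v) (R v))" by (simp add: norm_ip_self)
      also have "\<dots> = norm (ip (T (R v)) v)" by (simp add: R)
      also have "\<dots> \<le> ip_norm ip (T (R v)) * ip_norm ip v" by (rule norm_ip_le)
      also have "\<dots> \<le> C * ip_norm ip (R v) * ip_norm ip v"
        by (intro mult_right_mono C ip_norm_nonneg)
      finally have "ip_norm ip (R v) * ip_norm ip (R v) \<le> (C * ip_norm ip v) * ip_norm ip (R v)"
        by (simp add: power2_eq_square mult_ac)
      then show ?thesis using False ip_norm_nonneg[of "R v"] by (simp add: mult_le_cancel_right)
    qed
  qed
  then have "form_adjoint s (ip_norm ip) ip T = R"
    unfolding form_adjoint_def using R by (intro the_equality) (auto intro!: ext ip_eqI)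
  then show ?thesis by (simp add: R)
qed

text \<open>A unit of the C*-algebra may act as a proper projection \<open>E\<close> of the Hilbert
  space, so \<open>V\<close> is only a partial isometry. Its squared norm at \<open>x\<close> is the
  inner product of \<open>x\<close> and \<open>E x\<close>; the same computation for
  \<open>E\<close> shows first that \<open>E\<close> is a contraction.\<close>

lemma partial_isometry_contraction:
  assumes V: "V \<in> bounded_ops s (ip_norm ip)" and E: "E \<in> bounded_ops s (ip_norm ip)"
    and VV: "form_adjoint s (ip_norm ip) ip V \<circ> V = E" and EE: "form_adjoint s (ip_norm ip) ip E \<circ> E = E"
  shows "ip_norm ip (V x) \<le> ip_norm ip x"
proof -
  have *: "(ip_norm ip (W x))\<^sup>2 \<le> ip_norm ip x * ip_norm ip (E x)"
    if "W \<in> bounded_ops s (ip_norm ip)" "form_adjoint s (ip_norm ip) ip W \<circ> W = E" for W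
  proof -
    have "(ip_norm ip (W x))\<^sup>2 = norm (ip (W x) (W x))" by (simp add: norm_ip_self)
    also have "ip (W x) (W x) = ip x (E x)"
      using ip_form_adjoint[OF that(1), of x "W x"] that(2) by (metis comp_apply)
    also have "norm \<dots> \<le> ip_norm ip x * ip_norm ip (E x)" by (rule norm_ip_le)
    finally show ?thesis .
  qed
  have "ip_norm ip (E x) * ip_norm ip (E x) \<le> ip_norm ip x * ip_norm ip (E x)"
    using *[OF E EE] by (simp add: power2_eq_square)
  then have Ex: "ip_norm ip (E x) \<le> ip_norm ip x"
    using ip_norm_nonneg[of "E x"] ip_norm_nonneg[of x]
    by (cases "ip_norm ip (E x) = 0") (auto simp: mult_le_cancel_right)
  have "(ip_norm ip (V x))\<^sup>2 \<le> ip_norm ip x * ip_norm ip (E x)" by (rule *[OF V VV])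
  also have "\<dots> \<le> (ip_norm ip x)\<^sup>2"
    using Ex ip_norm_nonneg[of x] by (simp add: power2_eq_square mult_left_mono)
  finally show ?thesis by (rule power2_le_imp_le) (rule ip_norm_nonneg)
qed

end

section \<open>The quotient algebra\<close>

lemma equivalent_kp_qnormE:
  assumes "equivalent_kp_qnorm N"
  obtains a b where "0 < a" "0 < b" "\<And>u. a * norm u \<le> N u" "\<And>u. N u \<le> b * norm u"
proof -
  obtain a b where ab: "0 < a" "0 < b" "\<And>u. a * kp_qnorm u \<le> N u \<and> N u \<le> b * kp_qnorm u"
    using assms unfolding equivalent_kp_qnorm_def by blast
  have "a / 2 * norm u \<le> N u" for u
  proof -
    have "a / 2 * norm u = a * (1 / 2 * norm u)" by simp
    also have "\<dots> \<le> a * kp_qnorm u" using ab(1) by (intro mult_left_mono kp_qnorm_equiv) simp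
    finally show ?thesis using ab(3)[of u] by linarith
  qed
  moreover have "N u \<le> 4 * b * norm u" for u
  proof -
    have "b * kp_qnorm u \<le> b * (4 * norm u)" using ab(2) by (intro mult_left_mono kp_qnorm_equiv) simp
    also have "\<dots> = 4 * b * norm u" by simp
    finally show ?thesis using ab(3)[of u] by linarith
  qed
  ultimately show ?thesis using that[of "a / 2" "4 * b"] ab by simp
qed

lemma bounded_ops_equivalent:
  assumes "equivalent_kp_qnorm N"
  shows "bounded_ops kp_scale N = kp_ops"
proof -
  obtain a b where ab: "0 < a" "0 < b" "\<And>u. a * norm u \<le> N u" "\<And>u. N u \<le> b * norm u"
    using equivalent_kp_qnormE[OF assms] by blast
  have 1: "\<exists>C. \<forall>u. norm (T u) \<le> C * norm u" if C: "\<And>u. N (T u) \<le> C * N u" for T C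
  proof (intro exI allI)
    fix u
    have "a * norm (T u) \<le> \<bar>C\<bar> * N u"
      using ab(3)[of "T u"] C[of u] order_trans[OF mult_nonneg_nonneg[OF less_imp_le[OF ab(1)] norm_ge_zero[of u]] ab(3)]
        mult_right_mono[of C "\<bar>C\<bar>" "N u"] by linarith
    also have "\<dots> \<le> \<bar>C\<bar> * (b * norm u)" by (intro mult_left_mono ab(4)) simp
    finally show "norm (T u) \<le> (\<bar>C\<bar> * b / a) * norm u" using ab(1) by (simp add: field_simps)
  qed
  have 2: "\<exists>C. \<forall>u. N (T u) \<le> C * N u" if C: "\<And>u. norm (T u) \<le> C * norm u" for T C
  proof (intro exI allI)
    fix u
    have "N (T u) \<le> b * norm (T u)" by (rule ab(4))
    also have "\<dots> \<le> b * (\<bar>C\<bar> * norm u)"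
      using order_trans[OF C mult_right_mono[of C "\<bar>C\<bar>"]] ab(2) by (intro mult_left_mono) auto
    also have "\<dots> = (b * \<bar>C\<bar> / a) * (a * norm u)" using ab(1) by simp
    also have "\<dots> \<le> (b * \<bar>C\<bar> / a) * N u" using ab by (intro mult_left_mono) auto
    finally show "N (T u) \<le> (b * \<bar>C\<bar> / a) * N u" .
  qed
  show ?thesis unfolding bounded_ops_def using 1 2 by blast
qed

lemma strictly_singular_ops_equivalent:
  assumes "equivalent_kp_qnorm N"
  shows "strictly_singular_ops kp_scale N = {S \<in> kp_ops. compact_on_kernel S}"
proof -
  obtain a b where ab: "0 < a" "0 < b" "\<And>u. a * norm u \<le> N u" "\<And>u. N u \<le> b * norm u"
    using equivalent_kp_qnormE[OF assms] by blast
  have "norm_topology N = norm_topology norm"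
    unfolding norm_topology_eq_euclidean[OF ab(1,3,4)]
    by (rule norm_topology_eq_euclidean[of 1 _ 1, symmetric]) auto
  then have "strictly_singular_ops kp_scale N = strictly_singular_ops kp_scale norm"
    unfolding strictly_singular_ops_def bounded_ops_equivalent[OF assms] by simp
  then show ?thesis by (simp only: strictly_singular_ops_eq)
qed

lemma form_adjoint_equivalent:
  assumes "equivalent_kp_qnorm N"
  shows "form_adjoint kp_scale N kp_form = kp_adj"
  unfolding kp_adj_def kp_form_eq_omega form_adjoint_def bounded_ops_equivalent[OF assms] ..

text \<open>Cosets described without \<open>N\<close>; bounded and strictly singular operators are
  the same for all equivalent quasi-norms.\<close>

definition kp_coset :: "('k::real_or_complex kalton_peck \<Rightarrow> 'k kalton_peck) \<Rightarrow> ('k kalton_peck \<Rightarrow> 'k kalton_peck) set" where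
  "kp_coset T = {R. \<exists>S\<in>kp_ops. compact_on_kernel S \<and> R = (\<lambda>u. T u + S u)}"

lemma alg_coset_eq:
  assumes "equivalent_kp_qnorm N"
  shows "alg_coset (op_algebra kp_scale N kp_form) (strictly_singular_ops kp_scale N) = kp_coset"
  unfolding alg_coset_def op_algebra_def kp_coset_def strictly_singular_ops_equivalent[OF assms]
  by (auto simp: fun_eq_iff)

lemma kp_zero_ops: "(\<lambda>u. 0) \<in> kp_ops" and compact_on_kernel_zero: "compact_on_kernel (\<lambda>u. 0)"
  by (rule kp_opsI[where C = 0]) (auto simp: compact_on_kernel_def)

lemma kp_coset_self: "T \<in> kp_coset T"
  unfolding kp_coset_def using kp_zero_ops compact_on_kernel_zero by force

lemma kp_coset_ops: "T \<in> kp_ops \<Longrightarrow> R \<in> kp_coset T \<Longrightarrow> R \<in> kp_ops"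
  unfolding kp_coset_def by (auto intro: kp_ops_plus)

lemma kp_coset_eqI:
  assumes "S \<in> kp_ops" "compact_on_kernel S" "\<And>u. R u = T u + S u"
  shows "kp_coset R = kp_coset T"
proof -
  have sub: "kp_coset R \<subseteq> kp_coset T"
    if S: "S \<in> kp_ops" "compact_on_kernel S" and eq: "\<And>u. R u = T u + S u" for R T S :: "'a kalton_peck \<Rightarrow> 'a kalton_peck"
  proof
    fix X assume "X \<in> kp_coset R"
    then obtain S' where S': "S' \<in> kp_ops" "compact_on_kernel S'" "X = (\<lambda>u. R u + S' u)"
      unfolding kp_coset_def by blast
    then show "X \<in> kp_coset T" unfolding kp_coset_def
      using kp_ops_plus[OF S(1) S'(1)] compact_on_kernel_plus[OF S(2) S'(2)]
      by (intro CollectI bexI[of _ "\<lambda>u. S u + S' u"]) (auto simp: eq add.assoc)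
  qed
  have neg: "kp_scale (- 1) v = - v" for v :: "'a kalton_peck" by (rule kp_eqI) simp_all
  have "kp_coset T \<subseteq> kp_coset R"
    by (rule sub[OF kp_ops_smult[OF assms(1), of "- 1"] compact_on_kernel_smult[OF assms(2), of "- 1"]])
      (simp add: assms(3) neg)
  with sub[OF assms] show ?thesis by blast
qed

lemma UN_const: "a \<in> X \<Longrightarrow> (\<And>x. x \<in> X \<Longrightarrow> f x = c) \<Longrightarrow> (\<Union>x\<in>X. f x) = c"
  by auto

text \<open>Each union collapses as soon as all representatives give the same coset. Products
  require a two-sided ideal, the involution requires its stability under adjoints.\<close>

lemma
  assumes N: "equivalent_kp_qnorm (N :: 'k::real_or_complex kalton_peck \<Rightarrow> real)"
  shows carrier_quotient: "carrier (kp_quotient_algebra N) = kp_coset ` kp_ops"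
    and add_quotient: "S \<in> kp_ops \<Longrightarrow> T \<in> kp_ops \<Longrightarrow>
      add (kp_quotient_algebra N) (kp_coset S) (kp_coset T) = kp_coset (\<lambda>u. S u + T u)"
    and mult_quotient: "S \<in> kp_ops \<Longrightarrow> T \<in> kp_ops \<Longrightarrow>
      mult (kp_quotient_algebra N) (kp_coset S) (kp_coset T) = kp_coset (S \<circ> T)"
    and smult_quotient: "T \<in> kp_ops \<Longrightarrow>
      smult (kp_quotient_algebra N) c (kp_coset T) = kp_coset (\<lambda>u. kp_scale c (T u))"
    and star_quotient: "T \<in> kp_ops \<Longrightarrow> star (kp_quotient_algebra N) (kp_coset T) = kp_coset (kp_adj T)"
    and nrm_quotient: "nrm (kp_quotient_algebra N) X = (INF R\<in>X. op_norm N R)"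
proof -
  note alg = kp_quotient_algebra_def quotient_algebra_def alg_coset_eq[OF N]
  show "carrier (kp_quotient_algebra N) = kp_coset ` kp_ops"
    unfolding alg by (simp add: op_algebra_def bounded_ops_equivalent[OF N])
  show "nrm (kp_quotient_algebra N) X = (INF R\<in>X. op_norm N R)"
    unfolding alg by (simp add: op_algebra_def)
  show "add (kp_quotient_algebra N) (kp_coset S) (kp_coset T) = kp_coset (\<lambda>u. S u + T u)"
    if "S \<in> kp_ops" "T \<in> kp_ops" for S T :: "'k kalton_peck \<Rightarrow> 'k kalton_peck"
  proof -
    have "kp_coset (\<lambda>u. x u + y u) = kp_coset (\<lambda>u. S u + T u)" if x: "x \<in> kp_coset S" and y: "y \<in> kp_coset T" for x y
    proof -
      obtain s t where s: "s \<in> kp_ops" "compact_on_kernel s" "x = (\<lambda>u. S u + s u)"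
        and t: "t \<in> kp_ops" "compact_on_kernel t" "y = (\<lambda>u. T u + t u)"
        using x y unfolding kp_coset_def by blast
      show ?thesis
        by (rule kp_coset_eqI[OF kp_ops_plus[OF s(1) t(1)] compact_on_kernel_plus[OF s(2) t(2)]])
          (simp add: s t algebra_simps)
    qed
    then show ?thesis
      unfolding alg unfolding op_algebra_def star_algebra.select_convs
      by (intro UN_const[OF kp_coset_self])
  qed
  show "mult (kp_quotient_algebra N) (kp_coset S) (kp_coset T) = kp_coset (S \<circ> T)"
    if S: "S \<in> kp_ops" and T: "T \<in> kp_ops" for S T :: "'k kalton_peck \<Rightarrow> 'k kalton_peck"
  proof -
    have "kp_coset (x \<circ> y) = kp_coset (S \<circ> T)" if x: "x \<in> kp_coset S" and y: "y \<in> kp_coset T" for x y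
    proof -
      obtain s t where s: "s \<in> kp_ops" "compact_on_kernel s" "x = (\<lambda>u. S u + s u)"
        and t: "t \<in> kp_ops" "compact_on_kernel t" "y = (\<lambda>u. T u + t u)"
        using x y unfolding kp_coset_def by blast
      \<comment> \<open>The product of \<open>S + s\<close> with \<open>y\<close> differs from that
        of \<open>S\<close> with \<open>T\<close> by \<open>S \<circ> t\<close> and
        \<open>s \<circ> y\<close>; the last term keeps the full representative
        \<open>y\<close>.\<close>
      have yo: "y \<in> kp_ops" by (rule kp_coset_ops[OF T y])
      show ?thesis
        by (rule kp_coset_eqI[OF kp_ops_plus[OF kp_ops_comp[OF S t(1)] kp_ops_comp[OF s(1) yo]]
              compact_on_kernel_plus[OF compact_on_kernel_comp_left[OF S t(2)]
                compact_on_kernel_comp_right[OF s(1,2) yo]]])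
          (simp add: s(3) t(3) kp_ops_add[OF S])
    qed
    then show ?thesis
      unfolding alg unfolding op_algebra_def star_algebra.select_convs
      by (intro UN_const[OF kp_coset_self])
  qed
  show "smult (kp_quotient_algebra N) c (kp_coset T) = kp_coset (\<lambda>u. kp_scale c (T u))"
    if T: "T \<in> kp_ops" for T :: "'k kalton_peck \<Rightarrow> 'k kalton_peck"
  proof -
    have "kp_coset (\<lambda>u. kp_scale c (x u)) = kp_coset (\<lambda>u. kp_scale c (T u))" if x: "x \<in> kp_coset T" for x
    proof -
      obtain s where s: "s \<in> kp_ops" "compact_on_kernel s" "x = (\<lambda>u. T u + s u)"
        using x unfolding kp_coset_def by blast
      show ?thesis
        by (rule kp_coset_eqI[OF kp_ops_smult[OF s(1), of c] compact_on_kernel_smult[OF s(2), of c]])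
          (simp add: s kp_scale_add)
    qed
    then show ?thesis
      unfolding alg unfolding op_algebra_def star_algebra.select_convs
      by (intro UN_const[OF kp_coset_self])
  qed
  show "star (kp_quotient_algebra N) (kp_coset T) = kp_coset (kp_adj T)"
    if T: "T \<in> kp_ops" for T :: "'k kalton_peck \<Rightarrow> 'k kalton_peck"
  proof -
    have "kp_coset (kp_adj x) = kp_coset (kp_adj T)" if x: "x \<in> kp_coset T" for x
    proof -
      obtain s where s: "s \<in> kp_ops" "compact_on_kernel s" "x = (\<lambda>u. T u + s u)"
        using x unfolding kp_coset_def by blast
      show ?thesis
        by (rule kp_coset_eqI[OF kp_adj_ops[OF s(1)] compact_on_kernel_adjI[OF s(1,2)]])
          (simp add: s(3) kp_adj_plus[OF T s(1)])
    qed
    then show ?thesis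
      unfolding alg unfolding op_algebra_def star_algebra.select_convs form_adjoint_equivalent[OF N]
      by (intro UN_const[OF kp_coset_self])
  qed
qed

section \<open>The topology of the quotient and the contradiction\<close>

lemma op_norm_bound:
  assumes N: "equivalent_kp_qnorm N" and T: "T \<in> kp_ops"
  shows "N (T u) \<le> op_norm N T * N u"
proof -
  obtain a b where ab: "0 < a" "0 < b" "\<And>u. a * norm u \<le> N u" "\<And>u. N u \<le> b * norm u"
    using equivalent_kp_qnormE[OF N] by blast
  have scale: "N (kp_scale c v) = norm c * N v" for c v
    using N unfolding equivalent_kp_qnorm_def by blast
  have "T \<in> bounded_ops kp_scale N" using T bounded_ops_equivalent[OF N] by simp
  then obtain C where C: "\<And>u. N (T u) \<le> C * N u"
    unfolding bounded_ops_def by blast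
  have N0: "0 \<le> N v" for v
    using order_trans[OF mult_nonneg_nonneg[OF less_imp_le[OF ab(1)] norm_ge_zero] ab(3)] .
  show ?thesis
  proof (cases "u = 0")
    case True
    have "N 0 = 0" using ab(3,4)[of 0] by simp
    moreover have "T 0 = 0" using linear_0[OF bounded_linear.linear[OF kp_ops_bounded_linear[OF T]]] .
    ultimately show ?thesis using True by simp
  next
    case False
    then have "0 < a * norm u" using ab(1) by simp
    then have Nu: "0 < N u" using ab(3)[of u] by linarith
    have "bdd_above ((\<lambda>u. N (T u)) ` {u. N u \<le> 1})"
    proof (rule bdd_aboveI2)
      fix v assume "v \<in> {u. N u \<le> 1}"
      then show "N (T v) \<le> \<bar>C\<bar>"
        using C[of v] mult_right_mono[OF abs_ge_self N0[of v], of C] mult_left_mono[of "N v" 1 "\<bar>C\<bar>"] by simp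
    qed
    moreover have "N (kp_scale (of_real (1 / N u)) u) \<le> 1"
      unfolding scale norm_of_real using Nu by simp
    ultimately have "N (T (kp_scale (of_real (1 / N u)) u)) \<le> op_norm N T"
      unfolding op_norm_def by (intro cSUP_upper) auto
    then have "1 / N u * N (T u) \<le> op_norm N T"
      unfolding kp_ops_scale[OF T] scale norm_of_real using Nu by simp
    then show ?thesis using Nu by (simp add: field_simps)
  qed
qed

text \<open>The substitute for the open unit ball of the quotient. It is measured by
  \<open>norm\<close>, since balls of \<open>N\<close> need not be open if \<open>N\<close> violates
  the triangle inequality; the uniform bound \<open>c < 1\<close> leaves room for
  perturbations.\<close>

definition strict_contraction_cosets :: "('k::real_or_complex kalton_peck \<Rightarrow> 'k kalton_peck) set set" where
  "strict_contraction_cosets =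
     {X \<in> kp_coset ` kp_ops. \<exists>R\<in>X. \<exists>c<1. \<forall>u. norm (R u) \<le> c * norm u}"

lemma openin_strict_contraction_cosets:
  assumes N: "equivalent_kp_qnorm (N :: 'k::real_or_complex kalton_peck \<Rightarrow> real)"
  shows "openin (algebra_topology (kp_quotient_algebra N)) (strict_contraction_cosets :: ('k kalton_peck \<Rightarrow> _) set set)"
  unfolding algebra_topology_def openin_gauge_topology carrier_quotient[OF N]
proof (intro conjI ballI)
  show "strict_contraction_cosets \<subseteq> kp_coset ` kp_ops" by (auto simp: strict_contraction_cosets_def)
  obtain a b where ab: "0 < a" "0 < b" "\<And>u. a * norm u \<le> N u" "\<And>u. N u \<le> b * norm u"
    using equivalent_kp_qnormE[OF N] by blast
  have neg: "kp_scale (- 1) v = - v" for v :: "'k kalton_peck" by (rule kp_eqI) simp_all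
  fix X :: "('k kalton_peck \<Rightarrow> 'k kalton_peck) set"
  assume "X \<in> strict_contraction_cosets"
  then obtain T x c where T: "T \<in> kp_ops" "X = kp_coset T" and x: "x \<in> X" and c: "c < 1" "\<And>u. norm (x u) \<le> c * norm u"
    unfolding strict_contraction_cosets_def by blast
  \<comment> \<open>A perturbation of size (1 - c) / 2 in terms of \<open>norm\<close> keeps the
    bound below 1; the quotient a / b converts from \<open>N\<close> to \<open>norm\<close>.\<close>
  define e where "e = a * (1 - c) / (2 * b)"
  have e: "0 < e" "e * b / a = (1 - c) / 2" using ab c by (simp_all add: e_def)
  show "\<exists>e>0. \<forall>Y\<in>kp_coset ` kp_ops.
      nrm (kp_quotient_algebra N) (add (kp_quotient_algebra N) Y (smult (kp_quotient_algebra N) (- 1) X)) < e \<longrightarrow>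
      Y \<in> strict_contraction_cosets"
  proof (intro exI[of _ e] conjI ballI impI e(1))
    fix Y :: "('k kalton_peck \<Rightarrow> 'k kalton_peck) set"
    assume "Y \<in> kp_coset ` kp_ops"
      and less: "nrm (kp_quotient_algebra N) (add (kp_quotient_algebra N) Y (smult (kp_quotient_algebra N) (- 1) X)) < e"
    then obtain T' where T': "T' \<in> kp_ops" "Y = kp_coset T'" by blast
    define D where "D u = T' u + kp_scale (- 1) (T u)" for u
    have D: "D \<in> kp_ops" unfolding D_def[abs_def] by (intro kp_ops_plus kp_ops_smult T T')
    have "add (kp_quotient_algebra N) Y (smult (kp_quotient_algebra N) (- 1) X) = kp_coset D"
      unfolding T(2) T'(2) smult_quotient[OF N T(1)] add_quotient[OF N T'(1) kp_ops_smult[OF T(1)]] D_def[abs_def] ..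
    then have "Inf (op_norm N ` kp_coset D) < e"
      using less by (simp add: nrm_quotient[OF N])
    then obtain z where z: "z \<in> kp_coset D" "op_norm N z < e"
      using cInf_lessD[of "op_norm N ` kp_coset D" e] kp_coset_self[of D] by blast
    have zn: "norm (z u) \<le> (1 - c) / 2 * norm u" for u
    proof -
      have "a * norm (z u) \<le> op_norm N z * N u"
        using ab(3)[of "z u"] op_norm_bound[OF N kp_coset_ops[OF D z(1)], of u] by linarith
      also have "\<dots> \<le> e * N u"
        using z(2) order_trans[OF mult_nonneg_nonneg[OF less_imp_le[OF ab(1)] norm_ge_zero] ab(3)[of u]]
        by (intro mult_right_mono) auto
      also have "\<dots> \<le> e * (b * norm u)" using e(1) by (intro mult_left_mono ab(4)) simp
      finally have "norm (z u) \<le> e * b / a * norm u" using ab(1) by (simp add: field_simps)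
      then show ?thesis unfolding e(2) .
    qed
    obtain S1 S2 where S1: "S1 \<in> kp_ops" "compact_on_kernel S1" "z = (\<lambda>u. D u + S1 u)"
      and S2: "S2 \<in> kp_ops" "compact_on_kernel S2" "x = (\<lambda>u. T u + S2 u)"
      using z(1) x unfolding T(2) kp_coset_def by blast
    have "(\<lambda>u. z u + x u) \<in> Y"
      unfolding T'(2) kp_coset_def
      by (intro CollectI bexI[of _ "\<lambda>u. S1 u + S2 u"] conjI kp_ops_plus compact_on_kernel_plus S1 S2)
        (auto simp: S1(3) S2(3) D_def neg algebra_simps)
    moreover have "norm (z u + x u) \<le> ((1 - c) / 2 + c) * norm u" for u
      using norm_triangle_ineq[of "z u" "x u"] zn[of u] c(2)[of u] unfolding distrib_right by linarith
    moreover have "(1 - c) / 2 + c < 1" using c(1) by (simp add: field_simps)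
    ultimately show "Y \<in> strict_contraction_cosets"
      unfolding strict_contraction_cosets_def using T'
      by (intro CollectI conjI bexI[of _ "\<lambda>u. z u + x u"] exI[of _ "(1 - c) / 2 + c"]) auto
  qed
qed

theorem theorem1p9:
  fixes N :: "'k::real_or_complex kalton_peck \<Rightarrow> real"
    and s :: "'k \<Rightarrow> 'h::ab_group_add \<Rightarrow> 'h"
    and ip :: "'h \<Rightarrow> 'h \<Rightarrow> 'k"
    and A :: "('k, 'h \<Rightarrow> 'h) star_algebra"
  assumes "equivalent_kp_qnorm N"
    and "cstar_algebra_on s ip A"
  shows "\<not> star_isomorphic (kp_quotient_algebra N) A"
proof
  assume "star_isomorphic (kp_quotient_algebra N) A"
  then obtain \<phi> where iso: "star_isomorphism (kp_quotient_algebra N) A \<phi>"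
    unfolding star_isomorphic_def by blast
  note N = assms(1)
  interpret hilbert_space s ip using assms(2) by (simp add: cstar_algebra_on_def)
  let ?H = "op_algebra s (ip_norm ip) ip" and ?Q = "kp_quotient_algebra N"
  obtain B where B: "closed_star_subalgebra ?H B" "A = ?H\<lparr>carrier := B\<rparr>"
    using assms(2) unfolding cstar_algebra_on_def by blast
  have A: "carrier A = B" "mult A = (\<lambda>T R. T \<circ> R)" "star A = form_adjoint s (ip_norm ip) ip"
    "add A = (\<lambda>T R u. T u + R u)" "smult A = (\<lambda>c T u. s c (T u))" "nrm A = op_norm (ip_norm ip)"
    by (simp_all add: B(2) op_algebra_def)
  have Bb: "B \<subseteq> bounded_ops s (ip_norm ip)"
    using B(1) by (simp add: closed_star_subalgebra_def op_algebra_def)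
  have bij: "bij_betw \<phi> (kp_coset ` kp_ops) B"
    using iso unfolding star_isomorphism_def A(1) carrier_quotient[OF N] by blast
  have \<phi>B: "\<phi> (kp_coset T) \<in> B" if "T \<in> kp_ops" for T
    using bij that unfolding bij_betw_def by blast
  have \<phi>mult: "\<phi> (kp_coset (S \<circ> T)) = \<phi> (kp_coset S) \<circ> \<phi> (kp_coset T)"
    if "S \<in> kp_ops" "T \<in> kp_ops" for S T
  proof -
    have "\<phi> (mult ?Q (kp_coset S) (kp_coset T)) = mult A (\<phi> (kp_coset S)) (\<phi> (kp_coset T))"
      using iso that unfolding star_isomorphism_def carrier_quotient[OF N] by blast
    then show ?thesis by (simp add: A mult_quotient[OF N that])
  qed
  have \<phi>star: "\<phi> (kp_coset (kp_adj T)) = form_adjoint s (ip_norm ip) ip (\<phi> (kp_coset T))" if "T \<in> kp_ops" for T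
  proof -
    have "\<phi> (star ?Q (kp_coset T)) = star A (\<phi> (kp_coset T))"
      using iso that unfolding star_isomorphism_def carrier_quotient[OF N] by blast
    then show ?thesis by (simp add: A star_quotient[OF N that])
  qed
  have \<phi>smult: "\<phi> (kp_coset (\<lambda>u. kp_scale c (T u))) = (\<lambda>u. s c (\<phi> (kp_coset T) u))" if "T \<in> kp_ops" for c T
  proof -
    have "\<phi> (smult ?Q c (kp_coset T)) = smult A c (\<phi> (kp_coset T))"
      using iso that unfolding star_isomorphism_def carrier_quotient[OF N] by blast
    then show ?thesis by (simp add: A smult_quotient[OF N that])
  qed
  \<comment> \<open>The image of the coset of the identity is a self-adjoint idempotent, not
    necessarily the identity of the Hilbert space.\<close>
  define J :: "'k kalton_peck \<Rightarrow> 'k kalton_peck" where "J = (\<lambda>u. u)"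
  have J: "J \<in> kp_ops" by (rule kp_opsI[where C = 1]) (simp_all add: J_def)
  have adjJ: "kp_adj J = J" by (rule kp_adj_unique[OF J]) (simp add: J_def)
  have EE: "form_adjoint s (ip_norm ip) ip (\<phi> (kp_coset J)) \<circ> \<phi> (kp_coset J) = \<phi> (kp_coset J)"
    unfolding \<phi>star[OF J, symmetric] adjJ \<phi>mult[OF J J, symmetric] by (simp add: J_def comp_def)
  define T where "T = (hadamard_op :: nat \<Rightarrow> 'k kalton_peck \<Rightarrow> 'k kalton_peck)"
  have T: "T m \<in> kp_ops" "kp_adj (T m) = T m" "T m \<circ> T m = J" for m
    by (simp_all add: T_def J_def hadamard_op_ops kp_adj_hadamard_op hadamard_op_involution comp_def)
  have contr: "ip_norm ip (\<phi> (kp_coset (T m)) x) \<le> ip_norm ip x" for m x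
  proof (rule partial_isometry_contraction[OF _ _ _ EE])
    show "form_adjoint s (ip_norm ip) ip (\<phi> (kp_coset (T m))) \<circ> \<phi> (kp_coset (T m)) = \<phi> (kp_coset J)"
      unfolding \<phi>star[OF T(1), symmetric] T(2) \<phi>mult[OF T(1) T(1), symmetric] T(3) ..
  qed (use \<phi>B J T(1) Bb in blast)+
  \<comment> \<open>Zero written as a multiple of \<open>J\<close>, so that compatibility of
    \<open>\<phi>\<close> with scalars yields its image.\<close>
  define Z where "Z = kp_coset (\<lambda>u. kp_scale 0 (J u))"
  have \<phi>Z: "\<phi> Z = (\<lambda>u. 0)" unfolding Z_def \<phi>smult[OF J] by simp
  have "Z \<in> strict_contraction_cosets"
    unfolding strict_contraction_cosets_def Z_def
    by (intro CollectI conjI imageI kp_ops_smult[OF J] bexI[OF _ kp_coset_self] exI[of _ 0]) simp_all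
  moreover have "openin (algebra_topology A) (\<phi> ` strict_contraction_cosets)"
  proof -
    have "open_map (algebra_topology ?Q) (algebra_topology A) \<phi>"
      using iso unfolding star_isomorphism_def by (intro homeomorphic_imp_open_map) blast
    then show ?thesis
      using openin_strict_contraction_cosets[OF N] unfolding open_map_def by blast
  qed
  \<comment> \<open>Openness of \<open>\<phi>\<close> at 0: the ball of radius \<open>e\<close> in
    the C*-algebra consists of images of operators that are strict contractions modulo the
    ideal.\<close>
  ultimately obtain e where e: "0 < e"
    "\<And>y. y \<in> B \<Longrightarrow> nrm A (add A y (smult A (- 1) (\<phi> Z))) < e \<Longrightarrow> y \<in> \<phi> ` strict_contraction_cosets"
    unfolding algebra_topology_def openin_gauge_topology A(1) by blast
  define c where "c = (of_real (e / 2) :: 'k)"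
  have nc: "norm c = e / 2" using e(1) by (simp add: c_def)
  \<comment> \<open>The image of \<open>c\<close> times \<open>T m\<close> has norm at most e / 2,
    so \<open>c\<close> times \<open>T m\<close> plus some \<open>S\<close> in the ideal is a
    contraction. Division by \<open>c\<close> gives the bound 2 / e for \<open>T m\<close> plus an
    element of the ideal, whatever \<open>m\<close> is.\<close>
  have "m * ln 2 / 2 \<le> 32 * (2 / e)" for m :: nat
  proof -
    let ?X = "kp_coset (\<lambda>u. kp_scale c (T m u))"
    have X: "(\<lambda>u. kp_scale c (T m u)) \<in> kp_ops" by (rule kp_ops_smult[OF T(1)])
    have "add A (\<phi> ?X) (smult A (- 1) (\<phi> Z)) = \<phi> ?X" by (simp add: A \<phi>Z)
    moreover have "nrm A (\<phi> ?X) \<le> e / 2"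
      unfolding A op_norm_def
    proof (rule cSUP_least)
      show "{u. ip_norm ip u \<le> 1} \<noteq> {}" using ip_norm_eq_0_iff[of 0] by (auto intro!: exI[of _ 0])
      fix u assume "u \<in> {u. ip_norm ip u \<le> 1}"
      then have "ip_norm ip (\<phi> (kp_coset (T m)) u) \<le> 1" using contr[of m u] by simp
      then show "ip_norm ip (\<phi> ?X u) \<le> e / 2"
        unfolding \<phi>smult[OF T(1)] ip_norm_scale nc using e(1) by simp
    qed
    ultimately have "\<phi> ?X \<in> \<phi> ` strict_contraction_cosets"
      using e(1) by (intro e(2) \<phi>B X) simp
    then obtain Y where Y: "Y \<in> strict_contraction_cosets" "\<phi> Y = \<phi> ?X" by auto
    have "Y = ?X"
      using Y bij X unfolding bij_betw_def strict_contraction_cosets_def by (auto dest: inj_onD)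
    then obtain R d where R: "R \<in> ?X" "d < 1" "\<And>u. norm (R u) \<le> d * norm u"
      using Y(1) unfolding strict_contraction_cosets_def by blast
    obtain S where S: "S \<in> kp_ops" "compact_on_kernel S" "R = (\<lambda>u. kp_scale c (T m u) + S u)"
      using R(1) unfolding kp_coset_def by blast
    have c0: "c \<noteq> 0" using e(1) by (simp add: c_def)
    have "norm (T m u + kp_scale (inverse c) (S u)) \<le> 2 / e * norm u" for u
    proof -
      have "T m u + kp_scale (inverse c) (S u) = kp_scale (inverse c) (R u)"
        by (rule kp_eqI) (use c0 in \<open>simp_all add: S(3) distrib_left\<close>)
      then have "norm (T m u + kp_scale (inverse c) (S u)) = 2 / e * norm (R u)"
        by (simp add: norm_inverse nc)
      also have "\<dots> \<le> 2 / e * (1 * norm u)"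
        using R(2) R(3)[of u] mult_right_mono[of d 1 "norm u"] e(1) by (intro mult_left_mono) auto
      finally show ?thesis by simp
    qed
    then show ?thesis
      unfolding T_def
      by (rule hadamard_op_essential_norm[OF kp_ops_smult[OF S(1)] compact_on_kernel_smult[OF S(2)]])
  qed
  moreover obtain m :: nat where "64 * (2 / e) / ln 2 < m" using reals_Archimedean2 by blast
  then have "64 * (2 / e) < m * ln 2" by (simp only: pos_divide_less_eq ln_gt_zero one_less_numeral_iff semiring_norm)
  then have "32 * (2 / e) < m * ln 2 / 2" by linarith
  ultimately show False by (meson not_le)
qed

end
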